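(* For all integers $n,d_A,d_B\ge 1$, \[ \sup_{\rho\in \mathrm{BEXT}_{n,n}(d_A,d_B)}\ \inf_{\sigma\in \mathrm{SEP}(d_A,d_B)}\ \|\rho-\sigma\|_2\ \le\ \min\left\{\frac{\sqrt{\min\{d_A,d_B\}-1}}{n},\ \frac{8\sqrt{2n-1}}{n}\right\}. \]
   Context: $\mathrm D(\mathcal H)$ denotes the density operators on a finite-dimensional complex Hilbert space $\mathcal H$, and $\|X\|_2=\sqrt{\mathrm{Tr}(X^\dagger X)}$ is the Hilbert--Schmidt norm. $\mathrm{Sym}^n(\mathcal H)\subseteq\mathcal H^{\otimes n}$ is the symmetric subspace. $\mathrm{SEP}(d_A,d_B):=\mathrm{conv}\{|u\rangle\langle u|\otimes|v\rangle\langle v|:u\in\mathbb C^{d_A},\ v\in\mathbb C^{d_B},\ \|u\|=\|v\|=1\}$. Label the tensor factors of $(\mathbb C^{d_A})^{\otimes n}\otimes(\mathbb C^{d_B})^{\otimes n}$ as $A_1,\dots,A_n,B_1,\dots,B_n$. $\mathrm{BEXT}_{n,n}(d_A,d_B)$ is the set of $A_1B_1$-marginals of states $\widetilde\rho\in\mathrm D(\mathrm{Sym}^n(\mathbb C^{d_A})\otimes\mathrm{Sym}^n(\mathbb C^{d_B}))$. *)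

theory Defs
  imports "HOL-Analysis.Analysis" "HOL-Combinatorics.Permutations"
begin

text \<open>
  The space \<open>\<complex>\<^sup>d\<close> is \<open>complex^'i\<close> with \<open>CARD('i) = d\<close>; tensor products are formed on index types:
  the tensor product of \<open>complex^'i\<close> and \<open>complex^'j\<close> is \<open>complex^('i \<times> 'j)\<close>, and the \<open>n\<close>-fold
  tensor power of \<open>complex^'a\<close> is \<open>complex^('n \<Rightarrow> 'a)\<close> with \<open>CARD('n) = n\<close>, the elements of
  \<open>'n\<close> labelling the tensor factors.
\<close>

definition tensor_vec :: "complex^'i \<Rightarrow> complex^'j \<Rightarrow> complex^('i \<times> 'j)"
  where "tensor_vec u v = (\<chi> x. u $ fst x * v $ snd x)"

definition tensor_op ::
    "complex^'i^'i \<Rightarrow> complex^'j^'j \<Rightarrow> complex^('i \<times> 'j)^('i \<times> 'j)"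
  where "tensor_op A B = (\<chi> x y. A $ fst x $ fst y * B $ snd x $ snd y)"

definition adjoint_op :: "complex^'i^'i \<Rightarrow> complex^'i^'i"
  where "adjoint_op A = (\<chi> i j. cnj (A $ j $ i))"

definition cinner_vec :: "complex^'i \<Rightarrow> complex^'i \<Rightarrow> complex"
  where "cinner_vec u v = (\<Sum>i\<in>UNIV. cnj (u $ i) * v $ i)"

definition pure_state :: "complex^'i \<Rightarrow> complex^'i^'i"
  where "pure_state u = (\<chi> i j. u $ i * cnj (u $ j))"

definition hs_norm :: "complex^'i^'i \<Rightarrow> real"
  where "hs_norm X = sqrt (Re (trace (adjoint_op X ** X)))"

definition density_ops :: "(complex^'i^'i) set"
  where "density_ops =
    {\<rho>. adjoint_op \<rho> = \<rho> \<and> (\<forall>\<psi>. 0 \<le> Re (cinner_vec \<psi> (\<rho> *v \<psi>))) \<and> trace \<rho> = 1}"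

text \<open>
  A density operator on a subspace \<open>W\<close> is identified with its extension by zero on the orthogonal
  complement of \<open>W\<close>.  For a self-adjoint operator, having range in \<open>W\<close> already implies that it
  vanishes on that complement.
\<close>

definition density_ops_on :: "(complex^'i) set \<Rightarrow> (complex^'i^'i) set"
  where "density_ops_on W = {\<rho> \<in> density_ops. range (\<lambda>\<psi>. \<rho> *v \<psi>) \<subseteq> W}"

definition sym_space :: "(complex^('n::finite \<Rightarrow> 'a::finite)) set"
  where "sym_space = {\<psi>. \<forall>\<pi>. \<pi> permutes UNIV \<longrightarrow> (\<forall>f. \<psi> $ (f \<circ> \<pi>) = \<psi> $ f)}"

text \<open>\<open>vec.span\<close> is the span over the scalar field, here over \<open>\<complex>\<close>.\<close>

definition tensor_space :: "(complex^'i) set \<Rightarrow> (complex^'j) set \<Rightarrow> (complex^('i \<times> 'j)) set"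
  where "tensor_space U V = vec.span {tensor_vec u v | u v. u \<in> U \<and> v \<in> V}"

definition SEP :: "(complex^('a::finite \<times> 'b::finite)^('a \<times> 'b)) set"
  where "SEP =
    convex hull {tensor_op (pure_state u) (pure_state v) | u v. norm u = 1 \<and> norm v = 1}"

text \<open>
  Partial trace over all factors except the \<open>A\<close>- and the \<open>B\<close>-factor labelled \<open>k\<close>: \<open>f\<close> and \<open>g\<close> range
  over the joint indices whose \<open>k\<close>-th entries are the row index of the marginal; the column
  index replaces these entries and leaves the traced-out ones equal.
\<close>

definition marginal ::
    "'n \<Rightarrow> complex^(('n::finite \<Rightarrow> 'a::finite) \<times> ('n \<Rightarrow> 'b::finite))^(('n \<Rightarrow> 'a) \<times> ('n \<Rightarrow> 'b))
      \<Rightarrow> complex^('a \<times> 'b)^('a \<times> 'b)"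
  where "marginal k R =
    (\<chi> x y. \<Sum>f | f k = fst x. \<Sum>g | g k = snd x.
       R $ (f, g) $ (f(k := fst y), g(k := snd y)))"

text \<open>
  The number of extensions is \<open>CARD('n)\<close>, and \<open>k\<close> is the label of the pair of factors that is kept,
  i.e. the label written \<open>1\<close> when the factors are enumerated.
\<close>

definition BEXT :: "'n::finite \<Rightarrow> (complex^('a::finite \<times> 'b::finite)^('a \<times> 'b)) set"
  where "BEXT k =
    marginal k ` density_ops_on (tensor_space
      (sym_space :: (complex^('n \<Rightarrow> 'a)) set) (sym_space :: (complex^('n \<Rightarrow> 'b)) set))"

end

theory Submission
  imports Defs
begin

text \<open>
  Let \<open>\<sigma>\<close> be the point of \<open>SEP\<close> closest to \<open>\<rho>\<close> and \<open>H = \<rho> - \<sigma>\<close>; it suffices to bound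
  \<open>\<langle>H, \<rho>\<rangle> - max \<langle>u v, H (u v)\<rangle>\<close> by the right hand side times \<open>\<parallel>H\<parallel>\<close>.  Let \<open>\<psi>\<close> be a top eigenvector, with
  eigenvalue \<open>\<mu>\<close>, of \<open>H\<close> acting on one \<open>A\<close>- and one \<open>B\<close>-factor and compressed to the symmetric space, and let
  \<open>u, v\<close> maximise \<open>\<bar>\<langle>u\<^sup>n v\<^sup>n, \<psi>\<rangle>\<bar>\<close>.  Testing the eigenvalue equation with \<open>u\<^sup>n v\<^sup>n\<close>, the
  components of \<open>H (u v)\<close> in \<open>u\<^sup>\<bottom> \<otimes> v\<close> and \<open>u \<otimes> v\<^sup>\<bottom>\<close> drop out by criticality, and by the
  second order condition the component in \<open>u\<^sup>\<bottom> \<otimes> v\<^sup>\<bottom>\<close> contributes at most its nuclear norm divided by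
  \<open>n\<close>.  Its rank is at most \<open>min d\<^sub>A d\<^sub>B - 1\<close>, which gives the first bound.

  For the second bound, \<open>H\<close> is first compressed to the at most \<open>2 n - 1\<close> directions of the \<open>B\<close>-factor in which
  \<open>\<rho>\<^sub>B\<close> has weight more than \<open>1 / (2 n)\<close>.  The error is small since \<open>\<langle>w, \<rho> w\<rangle> \<le> 1 / n + 1 / (2 n)\<close> for unit vectors
  \<open>w\<close> supported on the remaining directions.
\<close>

subsection \<open>Complex inner product and orthonormal sets\<close>

text \<open>The reduction rests on \<open>H \<bullet> (\<tau> - \<sigma>) \<le> 0\<close> for
  separable \<open>\<tau>\<close>: the number \<open>s = H \<bullet> \<sigma>\<close> dominates
  every product form of \<open>H\<close>, while the squared norm of \<open>H\<close> is
  \<open>H \<bullet> \<rho> - s\<close>, so a bound on \<open>H \<bullet> \<rho> - s\<close>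
  proportional to the norm of \<open>H\<close> can be divided by that norm. \<open>H\<close> on one
  pair of factors need not preserve the symmetric space, so the eigenvalue equation holds only
  against symmetric vectors; \<open>u^n v^n\<close> is one. Its overlap with the eigenvector is
  divided out and must be nonzero, which is polarization. The factor 1/n is a count: the mixed
  second-order coefficient of the overlap consists of n^2 equal terms, and maximality bounds it by n
  times the overlap. The obstacle to a dimension-free bound is the rank of the doubly orthogonal
  component. Keeping the directions of weight above t leaves at most 1/t of them, at cost
  sqrt(1/t)/n, and the discarded ones cost sqrt(1/n + t) up to constants; t of order 1/n balances
  both at 1/sqrt(n).\<close>

lemma cinner_vec_0_left [simp]: "cinner_vec 0 v = 0"
  by (simp add: cinner_vec_def)

lemma cinner_vec_0_right [simp]: "cinner_vec u 0 = 0"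
  by (simp add: cinner_vec_def)

lemma cinner_vec_add_left: "cinner_vec (u + v) w = cinner_vec u w + cinner_vec v w"
  and cinner_vec_add_right: "cinner_vec w (u + v) = cinner_vec w u + cinner_vec w v"
  and cinner_vec_diff_left: "cinner_vec (u - v) w = cinner_vec u w - cinner_vec v w"
  and cinner_vec_diff_right: "cinner_vec w (u - v) = cinner_vec w u - cinner_vec w v"
  by (simp_all add: cinner_vec_def algebra_simps sum.distrib sum_subtractf)

lemma cinner_vec_smult_left: "cinner_vec (c *s u) v = cnj c * cinner_vec u v"
  and cinner_vec_smult_right: "cinner_vec u (c *s v) = c * cinner_vec u v"
  by (simp_all add: cinner_vec_def sum_distrib_left algebra_simps)

lemma cinner_vec_sum_left: "cinner_vec (\<Sum>i\<in>I. f i) v = (\<Sum>i\<in>I. cinner_vec (f i) v)"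
  by (induction I rule: infinite_finite_induct) (simp_all add: cinner_vec_add_left)

lemma cinner_vec_sum_right: "cinner_vec u (\<Sum>i\<in>I. f i) = (\<Sum>i\<in>I. cinner_vec u (f i))"
  by (induction I rule: infinite_finite_induct) (simp_all add: cinner_vec_add_right)

lemma cinner_vec_commute: "cinner_vec u v = cnj (cinner_vec v u)"
  by (simp add: cinner_vec_def mult.commute)

lemma Re_cinner_vec: "Re (cinner_vec u v) = u \<bullet> v"
  by (simp add: cinner_vec_def inner_vec_def inner_complex_def)

lemma norm_vec_sq: "(norm (u::'a::real_normed_vector^'i))\<^sup>2 = (\<Sum>i\<in>UNIV. (norm (u $ i))\<^sup>2)"
  by (simp add: norm_vec_def L2_set_def sum_nonneg)

lemma of_real_cmod_sq: "complex_of_real ((cmod z)\<^sup>2) = cnj z * z"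
  by (metis complex_norm_square mult.commute)

lemma cinner_vec_self: "cinner_vec u u = of_real ((norm u)\<^sup>2)"
  unfolding norm_vec_sq cinner_vec_def of_real_sum of_real_cmod_sq ..

lemma norm_smult_vec: "norm (c *s (u::complex^'i)) = norm c * norm u"
proof -
  have "(norm (c *s u))\<^sup>2 = (norm c * norm u)\<^sup>2"
    unfolding norm_vec_sq power_mult_distrib by (simp add: norm_mult power_mult_distrib sum_distrib_left)
  then show ?thesis by (metis norm_ge_zero power2_eq_iff_nonneg mult_nonneg_nonneg)
qed

lemma exists_phase: "\<exists>c::complex. norm c = 1 \<and> c * z = of_real (norm z)"
proof (cases "z = 0")
  case False
  then have "norm (cnj z / norm z) = 1 \<and> cnj z / norm z * z = of_real (norm z)"
    by (simp add: norm_divide divide_simps mult.commute flip: complex_norm_square power2_eq_square)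
  then show ?thesis by blast
qed (auto intro: exI[of _ 1])

lemma norm_cinner_vec_le: "norm (cinner_vec u v) \<le> norm u * norm v"
proof -
  obtain c where c: "norm c = 1" "c * cinner_vec u v = of_real (norm (cinner_vec u v))"
    using exists_phase by blast
  then have "norm (cinner_vec u v) = Re (cinner_vec u (c *s v))"
    by (simp add: cinner_vec_smult_right)
  also have "\<dots> \<le> norm u * norm (c *s v)"
    unfolding Re_cinner_vec by (rule norm_cauchy_schwarz)
  finally show ?thesis using c by (simp add: norm_smult_vec)
qed

lemma norm_add_sq_cinner_vec:
  "(norm (u + v))\<^sup>2 = (norm u)\<^sup>2 + (norm v)\<^sup>2 + 2 * Re (cinner_vec u v)"
  unfolding Re_cinner_vec by (simp add: power2_norm_eq_inner inner_add inner_commute)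

lemma cinner_vec_axis: "cinner_vec (axis i 1) v = v $ i"
proof -
  have "cinner_vec (axis i 1) v = (\<Sum>j\<in>UNIV. if j = i then v $ i else 0)"
    unfolding cinner_vec_def by (rule sum.cong) (auto simp: axis_def)
  then show ?thesis by simp
qed

lemma norm_cinner_vec_axis: "norm (cinner_vec v (axis i 1)) = norm (v $ i)"
  using cinner_vec_axis[of i v] cinner_vec_commute[of v "axis i 1"] by simp

lemma norm_axis_one [simp]: "norm (axis i 1 :: complex^'i) = 1"
  by (simp add: norm_axis_1)

definition ortho_part :: "complex^'i \<Rightarrow> complex^'i \<Rightarrow> complex^'i"
  where "ortho_part u x = x - cinner_vec u x *s u"

lemma cinner_vec_ortho_part: "norm u = 1 \<Longrightarrow> cinner_vec u (ortho_part u x) = 0"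
  by (simp add: ortho_part_def cinner_vec_diff_right cinner_vec_smult_right cinner_vec_self)

lemma norm_ortho_part_le:
  assumes "norm u = 1"
  shows "norm (ortho_part u x) \<le> norm x"
proof -
  have "x = ortho_part u x + cinner_vec u x *s u"
    by (simp add: ortho_part_def)
  then have "(norm x)\<^sup>2 = (norm (ortho_part u x))\<^sup>2 + (norm (cinner_vec u x *s u))\<^sup>2
      + 2 * Re (cinner_vec (ortho_part u x) (cinner_vec u x *s u))"
    by (metis norm_add_sq_cinner_vec)
  moreover have "cinner_vec (ortho_part u x) u = 0"
    using cinner_vec_ortho_part[OF assms, of x] cinner_vec_commute[of "ortho_part u x" u] by simp
  ultimately have "(norm (ortho_part u x))\<^sup>2 \<le> (norm x)\<^sup>2"
    by (simp add: cinner_vec_smult_right)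
  then show ?thesis by (simp add: abs_le_square_iff[symmetric])
qed

lemma ortho_part_self: "norm u = 1 \<Longrightarrow> ortho_part u u = 0"
  by (simp add: ortho_part_def cinner_vec_self)

definition orthonormal :: "(complex^'i) set \<Rightarrow> bool"
  where "orthonormal S \<longleftrightarrow> (\<forall>b\<in>S. norm b = 1) \<and> (\<forall>b\<in>S. \<forall>c\<in>S. b \<noteq> c \<longrightarrow> cinner_vec b c = 0)"

definition proj_on :: "(complex^'i) set \<Rightarrow> complex^'i \<Rightarrow> complex^'i"
  where "proj_on S x = (\<Sum>b\<in>S. cinner_vec b x *s b)"

lemma cinner_proj_on:
  assumes "orthonormal S" "finite S" "b \<in> S"
  shows "cinner_vec b (proj_on S x) = cinner_vec b x"
proof -
  have "cinner_vec b (proj_on S x) = (\<Sum>c\<in>S. if c = b then cinner_vec b x else 0)"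
    unfolding proj_on_def cinner_vec_sum_right
    using assms by (intro sum.cong) (auto simp: orthonormal_def cinner_vec_smult_right cinner_vec_self)
  then show ?thesis using assms by simp
qed

lemma proj_on_orthogonal:
  assumes "orthonormal S" "finite S"
  shows "cinner_vec (proj_on S y) (x - proj_on S x) = 0"
  by (subst proj_on_def)
     (simp add: cinner_vec_sum_left cinner_vec_smult_left cinner_vec_diff_right cinner_proj_on[OF assms])

lemma norm_proj_on_sq:
  assumes "orthonormal S" "finite S"
  shows "(norm (proj_on S x))\<^sup>2 = (\<Sum>b\<in>S. (norm (cinner_vec b x))\<^sup>2)"
proof -
  have "complex_of_real ((norm (proj_on S x))\<^sup>2) = cinner_vec (proj_on S x) (proj_on S x)"
    by (simp add: cinner_vec_self)
  also have "\<dots> = (\<Sum>b\<in>S. cnj (cinner_vec b x) * cinner_vec b x)"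
    by (subst proj_on_def)
       (simp add: cinner_vec_sum_left cinner_vec_smult_left cinner_proj_on[OF assms])
  also have "\<dots> = of_real (\<Sum>b\<in>S. (norm (cinner_vec b x))\<^sup>2)"
    unfolding of_real_sum of_real_cmod_sq ..
  finally show ?thesis by (simp only: of_real_eq_iff)
qed

lemma norm_proj_on_pythagoras:
  assumes "orthonormal S" "finite S"
  shows "(norm x)\<^sup>2 = (norm (proj_on S x))\<^sup>2 + (norm (x - proj_on S x))\<^sup>2"
  using norm_add_sq_cinner_vec[of "proj_on S x" "x - proj_on S x"] proj_on_orthogonal[OF assms, of x x]
  by simp

lemma bessel:
  assumes "orthonormal S" "finite S"
  shows "(\<Sum>b\<in>S. (norm (cinner_vec b x))\<^sup>2) \<le> (norm x)\<^sup>2"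
  using norm_proj_on_pythagoras[OF assms, of x] norm_proj_on_sq[OF assms, of x] by simp

text \<open>Bessel's inequality for the i-th coordinate vector bounds the sum of the squared i-th
  entries over the set by 1, and summing over i counts the set. Finite subsets are treated first,
  because an infinite sum would be 0 by convention.\<close>

lemma orthonormal_card_le:
  fixes S :: "(complex^'i) set"
  assumes "orthonormal S"
  shows "finite S" "card S \<le> CARD('i)"
proof -
  have *: "card T \<le> CARD('i)" if "T \<subseteq> S" "finite T" for T
  proof -
    have o: "orthonormal T" using assms that by (auto simp: orthonormal_def)
    have "real (card T) = (\<Sum>b\<in>T. (norm b)\<^sup>2)"
      using o by (simp add: orthonormal_def)
    also have "\<dots> = (\<Sum>i\<in>UNIV. \<Sum>b\<in>T. (norm (b $ i))\<^sup>2)"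
      unfolding norm_vec_sq by (rule sum.swap)
    also have "\<dots> = (\<Sum>i\<in>UNIV. \<Sum>b\<in>T. (norm (cinner_vec b (axis i 1)))\<^sup>2)"
      by (simp add: norm_cinner_vec_axis)
    also have "\<dots> \<le> (\<Sum>i\<in>(UNIV::'i set). 1)"
    proof (rule sum_mono)
      fix i :: 'i
      show "(\<Sum>b\<in>T. (norm (cinner_vec b (axis i 1)))\<^sup>2) \<le> 1"
        using bessel[OF o that(2), of "axis i 1"] by simp
    qed
    finally show ?thesis by simp
  qed
  show "finite S"
  proof (rule ccontr)
    assume "infinite S"
    then obtain T where "T \<subseteq> S" "finite T" "card T = Suc CARD('i)"
      using infinite_arbitrarily_large by metis
    with *[of T] show False by simp
  qed
  then show "card S \<le> CARD('i)" using * by blast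
qed

text \<open>Maximality is by cardinality, which is bounded by the dimension. The predicate
  \<open>Q\<close> lets the same argument serve the completion to a basis and the greedy choice of
  directions of large marginal weight.\<close>

lemma maximal_orthonormal:
  fixes S0 :: "(complex^'i) set"
  assumes "orthonormal S0" "\<forall>b\<in>S0. Q b"
  obtains S where "S0 \<subseteq> S" "orthonormal S" "\<forall>b\<in>S. Q b"
    "\<And>x. norm x = 1 \<Longrightarrow> (\<forall>b\<in>S. cinner_vec b x = 0) \<Longrightarrow> \<not> Q x"
proof -
  let ?P = "\<lambda>S. S0 \<subseteq> S \<and> orthonormal S \<and> (\<forall>b\<in>S. Q b)"
  have "\<exists>S. ?P S \<and> (\<forall>T. ?P T \<longrightarrow> card T \<le> card S)"
  proof (rule ex_has_greatest_nat)
    show "?P S0" using assms by simp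
    show "\<forall>T. ?P T \<longrightarrow> card T < Suc CARD('i)"
      using orthonormal_card_le(2) less_Suc_eq_le by blast
  qed
  then obtain S where S: "?P S" and max: "\<And>T. ?P T \<Longrightarrow> card T \<le> card S" by blast
  have "\<not> Q x" if x: "norm x = 1" "\<forall>b\<in>S. cinner_vec b x = 0" for x
  proof
    assume "Q x"
    have "x \<notin> S" using x by (auto simp: cinner_vec_self)
    have "cinner_vec x b = 0" if "b \<in> S" for b
      using x that cinner_vec_commute[of x b] by simp
    then have "?P (insert x S)" using S x \<open>Q x\<close> by (auto simp: orthonormal_def)
    then have "card (insert x S) \<le> card S" by (rule max)
    then show False using \<open>x \<notin> S\<close> orthonormal_card_le(1)[of S] S by simp
  qed
  then show ?thesis using S that by blast
qed

lemma complete_orthonormal: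
  assumes "orthonormal S0"
  obtains S where "S0 \<subseteq> S" "orthonormal S" "\<And>x. proj_on S x = x"
proof -
  obtain S where S: "S0 \<subseteq> S" "orthonormal S"
    and max: "\<And>x. norm x = 1 \<Longrightarrow> (\<forall>b\<in>S. cinner_vec b x = 0) \<Longrightarrow> False"
    using maximal_orthonormal[OF assms, of "\<lambda>_. True"] by auto
  have fin: "finite S" using S orthonormal_card_le by blast
  have "proj_on S x = x" for x
  proof (rule ccontr)
    define y where "y = x - proj_on S x"
    assume "proj_on S x \<noteq> x"
    then have "y \<noteq> 0" by (simp add: y_def)
    have "norm (of_real (inverse (norm y)) *s y) = 1"
      using \<open>y \<noteq> 0\<close> by (simp add: norm_smult_vec norm_inverse)
    moreover have "\<forall>b\<in>S. cinner_vec b (of_real (inverse (norm y)) *s y) = 0"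
      by (simp add: y_def cinner_vec_smult_right cinner_vec_diff_right cinner_proj_on[OF S(2) fin])
    ultimately show False by (rule max)
  qed
  then show ?thesis using S that by blast
qed

subsection \<open>Slices, marginals and positive operators\<close>

text \<open>\<open>undefined\<close> only serves as a fixed dummy value at the label \<open>k\<close>: an element of \<open>rest k\<close> is a joint index
  of all factors but the \<open>k\<close>-th.\<close>

definition rest :: "'n \<Rightarrow> ('n \<Rightarrow> 'a) set"
  where "rest k = {f. f k = undefined}"

text \<open>The partial inner product of \<open>\<psi>\<close> with the basis vector
  \<open>r\<close> of all factors other than the pair labelled \<open>k\<close>. The entries of
  \<open>r\<close> at \<open>k\<close> are overwritten. Tracing out turns a pure state into the sum
  of the pure states of its slices.\<close>

definition slice :: "'n::finite \<Rightarrow> complex^(('n \<Rightarrow> 'a::finite) \<times> ('n \<Rightarrow> 'b::finite))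
    \<Rightarrow> ('n \<Rightarrow> 'a) \<times> ('n \<Rightarrow> 'b) \<Rightarrow> complex^('a \<times> 'b)"
  where "slice k \<psi> r = (\<chi> x. \<psi> $ ((fst r)(k := fst x), (snd r)(k := snd x)))"

lemma sum_rest:
  fixes \<phi> :: "('n::finite \<Rightarrow> 'a::finite) \<Rightarrow> 'c::comm_monoid_add"
  shows "(\<Sum>f\<in>UNIV. \<phi> f) = (\<Sum>f\<in>rest k. \<Sum>a\<in>UNIV. \<phi> (f(k := a)))"
  unfolding sum.cartesian_product
  by (rule sum.reindex_bij_witness[where i = "\<lambda>(f, a). f(k := a)" and j = "\<lambda>f. (f(k := undefined), f k)"])
     (auto simp: rest_def)

lemma sum_fiber:
  fixes \<phi> :: "('n::finite \<Rightarrow> 'a::finite) \<Rightarrow> 'c::comm_monoid_add"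
  shows "(\<Sum>f | f k = a. \<phi> f) = (\<Sum>f\<in>rest k. \<phi> (f(k := a)))"
  by (rule sum.reindex_bij_witness[where i = "\<lambda>f. f(k := a)" and j = "\<lambda>f. f(k := undefined)"])
     (auto simp: rest_def)

lemma sum_rest_pair:
  fixes \<phi> :: "('n::finite \<Rightarrow> 'a::finite) \<times> ('n \<Rightarrow> 'b::finite) \<Rightarrow> 'c::comm_monoid_add"
  shows "(\<Sum>x\<in>UNIV. \<phi> x) = (\<Sum>r\<in>rest k \<times> rest k. \<Sum>x\<in>UNIV. \<phi> ((fst r)(k := fst x), (snd r)(k := snd x)))"
proof -
  have "(\<Sum>x\<in>UNIV. \<phi> x) = (\<Sum>f\<in>UNIV. \<Sum>g\<in>UNIV. \<phi> (f, g))"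
    by (simp add: sum.cartesian_product)
  also have "\<dots> = (\<Sum>f\<in>rest k. \<Sum>a\<in>UNIV. \<Sum>g\<in>rest k. \<Sum>b\<in>UNIV. \<phi> (f(k := a), g(k := b)))"
    unfolding sum_rest[of _ k] ..
  also have "\<dots> = (\<Sum>f\<in>rest k. \<Sum>g\<in>rest k. \<Sum>a\<in>UNIV. \<Sum>b\<in>UNIV. \<phi> (f(k := a), g(k := b)))"
    by (intro sum.cong refl sum.swap)
  also have "\<dots> = (\<Sum>r\<in>rest k \<times> rest k. \<Sum>x\<in>UNIV. \<phi> ((fst r)(k := fst x), (snd r)(k := snd x)))"
    unfolding UNIV_Times_UNIV[symmetric] sum.cartesian_product' by simp
  finally show ?thesis .
qed

lemma cinner_vec_slices:
  "cinner_vec \<phi> \<psi> = (\<Sum>r\<in>rest k \<times> rest k. cinner_vec (slice k \<phi> r) (slice k \<psi> r))"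
  unfolding cinner_vec_def by (subst sum_rest_pair[of _ k]) (simp add: slice_def)

lemma norm_slices_sq: "(norm \<psi>)\<^sup>2 = (\<Sum>r\<in>rest k \<times> rest k. (norm (slice k \<psi> r))\<^sup>2)"
proof -
  have "complex_of_real ((norm \<psi>)\<^sup>2) = of_real (\<Sum>r\<in>rest k \<times> rest k. (norm (slice k \<psi> r))\<^sup>2)"
    unfolding of_real_sum cinner_vec_self[symmetric] by (rule cinner_vec_slices)
  then show ?thesis by (simp only: of_real_eq_iff)
qed

lemma marginal_pure_state:
  "marginal k (pure_state \<psi>) = (\<Sum>r\<in>rest k \<times> rest k. pure_state (slice k \<psi> r))"
  unfolding marginal_def sum_fiber sum.cartesian_product'
  by (simp add: vec_eq_iff pure_state_def slice_def)

lemma marginal_add: "marginal k (A + B) = marginal k A + marginal k B"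
  by (simp add: marginal_def vec_eq_iff sum.distrib)

lemma marginal_sum: "marginal k (\<Sum>i\<in>I. R i) = (\<Sum>i\<in>I. marginal k (R i))"
  by (induction I rule: infinite_finite_induct) (simp_all add: marginal_add, simp_all add: marginal_def vec_eq_iff)

lemma trace_pure_state: "trace (pure_state u) = of_real ((norm u)\<^sup>2)"
  unfolding cinner_vec_self[symmetric] by (simp add: trace_def pure_state_def cinner_vec_def mult.commute)

lemma trace_sum: "trace (\<Sum>i\<in>I. R i) = (\<Sum>i\<in>I. trace (R i))"
  unfolding trace_def sum_component by (rule sum.swap)

lemma pure_state_mult_vec: "pure_state u *v x = cinner_vec u x *s u"
  by (simp add: vec_eq_iff matrix_vector_mult_def pure_state_def cinner_vec_def
      sum_distrib_left sum_distrib_right mult_ac)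

lemma adjoint_pure_state [simp]: "adjoint_op (pure_state u) = pure_state u"
  by (simp add: adjoint_op_def pure_state_def vec_eq_iff)

lemma cnj_adjoint_nth: "adjoint_op A = A \<Longrightarrow> cnj (A $ i $ j) = A $ j $ i"
  by (drule arg_cong[of _ _ "\<lambda>B. B $ j $ i"]) (simp add: adjoint_op_def)

lemma mult_axis_nth: "(A *v axis j 1) $ i = (A $ i $ j :: complex)"
  by (simp add: matrix_vector_mult_def axis_def if_distrib cong: if_cong)

lemma cinner_vec_hermitian:
  assumes "adjoint_op A = A"
  shows "cinner_vec x (A *v y) = cinner_vec (A *v x) y"
proof -
  note A = cnj_adjoint_nth[OF assms]
  have "cinner_vec x (A *v y) = (\<Sum>i\<in>UNIV. \<Sum>j\<in>UNIV. cnj (x $ i) * (A $ i $ j * y $ j))"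
    by (simp add: cinner_vec_def matrix_vector_mult_def sum_distrib_left)
  also have "\<dots> = (\<Sum>j\<in>UNIV. \<Sum>i\<in>UNIV. cnj (x $ i) * (A $ i $ j * y $ j))"
    by (rule sum.swap)
  also have "\<dots> = cinner_vec (A *v x) y"
    by (simp add: cinner_vec_def matrix_vector_mult_def sum_distrib_left sum_distrib_right A mult_ac)
  finally show ?thesis .
qed

section \<open>Rank-one decomposition of positive operators\<close>

definition psd :: "complex^'i^'i \<Rightarrow> bool"
  where "psd A \<longleftrightarrow> adjoint_op A = A \<and> (\<forall>x. 0 \<le> Re (cinner_vec x (A *v x)))"

lemma Re_of_real_mult: "Re (of_real x * z) = x * Re z"
  by simp

text \<open>Positivity at \<open>x + c *s axis i 1\<close>, kept with a free \<open>c\<close>: a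
  large \<open>c\<close> handles a vanishing diagonal entry, the minimising \<open>c\<close> gives
  the Schur complement.\<close>

lemma psd_shift:
  assumes "psd A"
  shows "0 \<le> Re (cinner_vec x (A *v x)) + 2 * Re (cnj c * (A *v x) $ i) + (norm c)\<^sup>2 * Re (A $ i $ i)"
proof -
  have h: "adjoint_op A = A" using assms by (simp add: psd_def)
  have 1: "cinner_vec (c *s axis i 1) (A *v x) = cnj c * (A *v x) $ i"
    by (simp add: cinner_vec_smult_left cinner_vec_axis)
  have 2: "cinner_vec x (A *v (c *s axis i 1)) = cnj (cnj c * (A *v x) $ i)"
    unfolding cinner_vec_hermitian[OF h] by (subst cinner_vec_commute) (simp only: 1)
  have 3: "cinner_vec (c *s axis i 1) (A *v (c *s axis i 1)) = cnj c * c * A $ i $ i"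
    by (simp add: cinner_vec_smult_left cinner_vec_axis mult_axis_nth vector_scalar_commute)
  have "0 \<le> Re (cinner_vec (x + c *s axis i 1) (A *v (x + c *s axis i 1)))"
    using assms by (simp add: psd_def)
  also have "cinner_vec (x + c *s axis i 1) (A *v (x + c *s axis i 1))
      = cinner_vec x (A *v x) + (cnj c * (A *v x) $ i + cnj (cnj c * (A *v x) $ i)) + cnj c * c * A $ i $ i"
    by (simp add: matrix_vector_right_distrib cinner_vec_add_left cinner_vec_add_right 1 2 3)
  finally show ?thesis
    unfolding of_real_cmod_sq[symmetric] by (simp del: of_real_power complex_cnj_mult add: Re_of_real_mult)
qed

lemma psd_diag:
  assumes "psd A"
  shows "Im (A $ i $ i) = 0" "0 \<le> Re (A $ i $ i)"
proof -
  have "cnj (A $ i $ i) = A $ i $ i"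
    using assms cnj_adjoint_nth unfolding psd_def by blast
  then show "Im (A $ i $ i) = 0" by (simp add: complex_eq_iff)
  show "0 \<le> Re (A $ i $ i)"
    using psd_shift[OF assms, of 0 1 i] by simp
qed

text \<open>With a zero diagonal entry the shifted form is affine in \<open>c\<close>, hence
  unbounded below unless its slope vanishes. The chosen \<open>t\<close> makes its value
  \<open>- q - 2\<close>.\<close>

lemma psd_zero_diag:
  assumes "psd A" "A $ i $ i = 0"
  shows "(A *v x) $ i = 0"
proof (rule ccontr)
  define z where "z = (A *v x) $ i"
  define q where "q = Re (cinner_vec x (A *v x))"
  assume "(A *v x) $ i \<noteq> 0"
  then have z: "norm z > 0" by (simp add: z_def)
  define t where "t = (q + 1) / (norm z)\<^sup>2"
  have "0 \<le> q + 2 * Re (cnj (- of_real t * z) * z)"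
    using psd_shift[OF assms(1), of x "- of_real t * z" i] assms(2) by (simp add: z_def q_def)
  also have "cnj (- of_real t * z) * z = - of_real (t * (norm z)\<^sup>2)"
    by (simp add: mult.assoc flip: of_real_cmod_sq del: of_real_power)
  also have "t * (norm z)\<^sup>2 = q + 1" using z by (simp add: t_def)
  finally have "q + 2 \<le> 0" by simp
  moreover have "0 \<le> q" using assms(1) by (simp add: psd_def q_def)
  ultimately show False by simp
qed

text \<open>One elimination step of the Cholesky decomposition: \<open>A - pure_state u\<close> is
  the Schur complement with respect to the i-th entry, padded by zeros.\<close>

lemma psd_reduce:
  assumes "psd A" and ne: "A $ i $ i \<noteq> 0"
  defines "u \<equiv> of_real (1 / sqrt (Re (A $ i $ i))) *s (A *v axis i 1)"
  shows "psd (A - pure_state u)" "(A - pure_state u) $ i $ i = 0"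
proof -
  define d where "d = Re (A $ i $ i)"
  have Ad: "A $ i $ i = of_real d" using psd_diag[OF assms(1)] by (simp add: d_def complex_eq_iff)
  have "d \<noteq> 0" using ne Ad by auto
  then have d: "d > 0" using psd_diag(2)[OF assms(1), of i] unfolding d_def by linarith
  have h: "adjoint_op A = A" using assms by (simp add: psd_def)
  have u: "cinner_vec u x = of_real (1 / sqrt d) * (A *v x) $ i" for x
    by (simp add: u_def d_def cinner_vec_smult_left cinner_vec_axis flip: cinner_vec_hermitian[OF h])
  have "0 \<le> Re (cinner_vec x ((A - pure_state u) *v x))" for x
  proof -
    define z where "z = (A *v x) $ i"
    have zz: "cnj z * z = of_real ((norm z)\<^sup>2)" by (simp only: of_real_cmod_sq)
    have "cinner_vec x (pure_state u *v x) = cinner_vec u x * cnj (cinner_vec u x)"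
      unfolding pure_state_mult_vec cinner_vec_smult_right by (subst (2) cinner_vec_commute) (rule refl)
    also have "\<dots> = of_real ((norm (cinner_vec u x))\<^sup>2)" by (simp only: complex_norm_square)
    also have "(norm (cinner_vec u x))\<^sup>2 = (norm z)\<^sup>2 / d"
      using d by (simp add: u z_def norm_mult norm_divide power_mult_distrib power_divide)
    finally have p: "Re (cinner_vec x (pure_state u *v x)) = (norm z)\<^sup>2 / d" by simp
    \<comment> \<open>This value of \<open>c\<close> minimises the quadratic in the shifted form;
      the minimum is exactly the form of the Schur complement.\<close>
    have "0 \<le> Re (cinner_vec x (A *v x)) + 2 * Re (cnj (- z / of_real d) * z)
        + (norm (- z / of_real d))\<^sup>2 * d"
      using psd_shift[OF assms(1), of x "- z / of_real d" i] by (simp add: z_def d_def)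
    also have "cnj (- z / of_real d) * z = - of_real ((norm z)\<^sup>2 / d)"
      by (simp add: zz del: of_real_power)
    also have "(norm (- z / of_real d))\<^sup>2 * d = (norm z)\<^sup>2 / d"
      using d by (simp add: norm_divide power_divide power2_eq_square)
    finally show ?thesis
      using p by (simp add: matrix_vector_mult_diff_rdistrib cinner_vec_diff_right)
  qed
  then show "psd (A - pure_state u)"
    using h by (simp add: psd_def adjoint_op_def pure_state_def vec_eq_iff mult.commute)
  have "complex_of_real d = of_real (sqrt d) * of_real (sqrt d)"
    using d by (simp flip: of_real_mult)
  then have "u $ i = of_real (sqrt d)"
    using d by (simp add: u_def mult_axis_nth Ad)
  then show "(A - pure_state u) $ i $ i = 0"
    using d by (simp add: pure_state_def Ad flip: of_real_mult)
qed

text \<open>Elimination replaces the spectral theorem: orthogonality of the summands is not asked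
  for, and every vector removed is a multiple of a column of the current operator, so it stays in
  \<open>W\<close>. The induction is over a set that contains the support of the diagonal; indices
  without a pivot receive the zero vector.\<close>

lemma psd_eq_sum_pure_state:
  fixes A :: "complex^'i^'i"
  assumes "psd A" "vec.subspace W" "range (\<lambda>x. A *v x) \<subseteq> W"
  obtains \<psi> where "\<And>i. \<psi> i \<in> W" "A = (\<Sum>i\<in>(UNIV::'i set). pure_state (\<psi> i :: complex^'i))"
proof -
  have "\<exists>\<psi>. (\<forall>i. \<psi> i \<in> W) \<and> A = (\<Sum>i\<in>S. pure_state (\<psi> i))"
    if "finite S" "psd A" "range (\<lambda>x. A *v x) \<subseteq> W" "\<And>i. i \<notin> S \<Longrightarrow> A $ i $ i = 0"
    for S :: "'i set" and A :: "complex^'i^'i"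
    using that
  proof (induction S arbitrary: A rule: finite_induct)
    case empty
    have "A $ i $ j = 0" for i j
      using psd_zero_diag[OF empty(1), of i "axis j 1"] empty(3)[of i]
      by (simp add: mult_axis_nth)
    then have "A = 0" by (simp add: vec_eq_iff)
    then show ?case using vec.subspace_0[OF assms(2)] by auto
  next
    case (insert i S)
    show ?case
    proof (cases "A $ i $ i = 0")
      case True
      have "A $ j $ j = 0" if "j \<notin> S" for j using True that insert.prems(3) by (cases "j = i") auto
      from insert.IH[OF insert.prems(1,2) this]
      obtain \<psi> where \<psi>: "\<forall>i. \<psi> i \<in> W" "A = (\<Sum>i\<in>S. pure_state (\<psi> i))" by blast
      have "pure_state (0 :: complex^'i) = 0" by (simp add: pure_state_def vec_eq_iff)
      then have "A = (\<Sum>j\<in>insert i S. pure_state ((\<psi>(i := 0)) j))"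
        unfolding sum.insert[OF insert.hyps] \<psi>(2) using insert.hyps(2) by (auto intro: sum.cong)
      moreover have "\<forall>j. (\<psi>(i := 0)) j \<in> W" using \<psi>(1) vec.subspace_0[OF assms(2)] by auto
      ultimately show ?thesis by blast
    next
      case False
      define u where "u = of_real (1 / sqrt (Re (A $ i $ i))) *s (A *v axis i 1)"
      note r = psd_reduce[OF insert.prems(1) False, folded u_def]
      have u: "u \<in> W" unfolding u_def using insert.prems(2) assms(2) by (auto intro: vec.subspace_scale)
      have "range (\<lambda>x. (A - pure_state u) *v x) \<subseteq> W"
        using insert.prems(2) u assms(2)
        by (auto simp: matrix_vector_mult_diff_rdistrib pure_state_mult_vec
            intro!: vec.subspace_diff vec.subspace_scale)
      \<comment> \<open>The step creates no new diagonal entries: where the diagonal of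
        \<open>A\<close> vanishes so does the whole row, hence also \<open>u $ j\<close>.\<close>
      moreover have "(A - pure_state u) $ j $ j = 0" if "j \<notin> S" for j
      proof (cases "j = i")
        case False
        then have "A $ j $ j = 0" using that insert.prems(3) by simp
        then have "u $ j = 0" using psd_zero_diag[OF insert.prems(1)] by (simp add: u_def)
        then show ?thesis using \<open>A $ j $ j = 0\<close> by (simp add: pure_state_def)
      qed (use r in simp)
      ultimately obtain \<psi> where \<psi>: "\<forall>i. \<psi> i \<in> W" "A - pure_state u = (\<Sum>i\<in>S. pure_state (\<psi> i))"
        using insert.IH[OF r(1)] by blast
      have "A = pure_state u + (\<Sum>j\<in>S. pure_state ((\<psi>(i := u)) j))"
        using insert.hyps(2) \<psi>(2) by (auto simp: algebra_simps intro!: sum.cong)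
      then have "A = (\<Sum>j\<in>insert i S. pure_state ((\<psi>(i := u)) j))"
        using insert.hyps by simp
      moreover have "\<forall>j. (\<psi>(i := u)) j \<in> W" using \<psi>(1) u by auto
      ultimately show ?thesis by blast
    qed
  qed
  note * = this
  have "\<exists>\<psi>. (\<forall>i. \<psi> i \<in> W) \<and> A = (\<Sum>i\<in>(UNIV::'i set). pure_state (\<psi> i))"
    by (rule *) (use assms in auto)
  then show ?thesis using that by blast
qed

section \<open>Vectors symmetric in each block of factors\<close>

text \<open>Invariance under separate permutations of the two blocks of labels, a condition on
  entries that is easier to apply than membership in a span of product vectors. All bounds are
  proved on this space, which contains the tensor product of the symmetric spaces.\<close>

definition bisym :: "(complex^(('n::finite \<Rightarrow> 'a::finite) \<times> ('n \<Rightarrow> 'b::finite))) set"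
  where "bisym = {\<psi>. \<forall>\<pi> \<tau>. \<pi> permutes UNIV \<longrightarrow> \<tau> permutes UNIV \<longrightarrow>
    (\<forall>f g. \<psi> $ (f \<circ> \<pi>, g \<circ> \<tau>) = \<psi> $ (f, g))}"

lemma subspace_bisym: "vec.subspace bisym"
  by (auto simp: vec.subspace_def bisym_def)

lemma tensor_space_sym_subset_bisym: "tensor_space sym_space sym_space \<subseteq> bisym"
  unfolding tensor_space_def
  by (rule vec.span_minimal[OF _ subspace_bisym]) (auto simp: bisym_def sym_space_def tensor_vec_def)

definition power_vec :: "complex^'a \<Rightarrow> complex^('n::finite \<Rightarrow> 'a::finite)"
  where "power_vec u = (\<chi> f. \<Prod>i\<in>UNIV. u $ f i)"

lemma power_vec_sym: "(power_vec u :: complex^('n::finite \<Rightarrow> 'a::finite)) \<in> sym_space"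
proof -
  have "(\<Prod>i\<in>UNIV. u $ f (\<pi> i)) = (\<Prod>i\<in>UNIV. u $ f i)" if "\<pi> permutes UNIV" for \<pi> :: "'n \<Rightarrow> 'n" and f
    by (rule prod.reindex_bij_betw[OF permutes_imp_bij[OF that], of "\<lambda>i. u $ f i"])
  then show ?thesis unfolding sym_space_def power_vec_def by simp
qed

lemma tensor_power_vec_mem: "tensor_vec (power_vec u) (power_vec v) \<in> tensor_space sym_space sym_space"
  unfolding tensor_space_def 
  by (rule vec.span_base, rule CollectI, rule exI[of _ "power_vec u"], rule exI[of _ "power_vec v"])
     (simp add: power_vec_sym)

subsection \<open>Maximality conditions for polynomials\<close>

lemma le_of_le_add_small:
  fixes x y K :: real
  assumes "\<And>r. 0 < r \<Longrightarrow> r \<le> 1 \<Longrightarrow> x \<le> y + K * r"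
  shows "x \<le> y"
proof (rule ccontr)
  assume "\<not> x \<le> y"
  then have d: "x - y > 0" by simp
  define r where "r = min 1 ((x - y) / (2 * (\<bar>K\<bar> + 1)))"
  have r: "0 < r" "r \<le> 1" using d by (auto simp: r_def)
  have "K * r \<le> (\<bar>K\<bar> + 1) * r" using r by (intro mult_right_mono) auto
  also have "\<dots> \<le> (\<bar>K\<bar> + 1) * ((x - y) / (2 * (\<bar>K\<bar> + 1)))"
    by (intro mult_left_mono) (auto simp: r_def)
  also have "\<dots> = (x - y) / 2" by (simp add: field_simps)
  finally show False using assms[OF r] d by simp
qed

text \<open>First-order expansion with a crude remainder. What matters is that the constant
  \<open>4 ^ N\<close> does not depend on \<open>q\<close>, so that the remainder vanishes in the
  limit.\<close>

lemma one_plus_power_le: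
  fixes q :: real
  assumes "0 \<le> q" "q \<le> 1"
  shows "(1 + q) ^ N \<le> 1 + real N * q + 4 ^ N * q\<^sup>2"
proof (induction N)
  case (Suc N)
  have N: "real N \<le> 4 ^ N"
    using of_nat_less_two_power[of N] power_mono[of 2 "4::real" N] by simp
  have q: "q^3 \<le> q\<^sup>2" using assms by (simp add: power_decreasing)
  have "(1 + q) ^ Suc N \<le> (1 + q) * (1 + real N * q + 4 ^ N * q\<^sup>2)"
    using Suc assms by (simp add: mult_left_mono)
  also have "\<dots> = 1 + real (Suc N) * q + (real N * q\<^sup>2 + 4 ^ N * q\<^sup>2 + 4 ^ N * q^3)"
    by (simp add: algebra_simps power2_eq_square power3_eq_cube)
  also have "\<dots> \<le> 1 + real (Suc N) * q + (4 ^ N * q\<^sup>2 + 4 ^ N * q\<^sup>2 + 4 ^ N * q\<^sup>2)"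
    using N q by (intro add_mono mult_mono order_refl) (use assms in auto)
  also have "\<dots> \<le> 1 + real (Suc N) * q + 4 ^ Suc N * q\<^sup>2"
    by simp
  finally show ?case .
qed simp

lemma exists_aligning_phase:
  fixes z w :: complex
  shows "\<exists>c. norm c = 1 \<and> (\<forall>r\<ge>0. norm (z + of_real r * (c * w)) = norm z + r * norm w)"
proof -
  obtain p q where p: "norm p = 1" "p * z = of_real (norm z)"
    and q: "norm q = 1" "q * w = of_real (norm w)"
    using exists_phase by metis
  have "norm (z + of_real r * (q / p * w)) = norm z + r * norm w" if "r \<ge> 0" for r
  proof -
    have "p \<noteq> 0" using p by auto
    have "norm (z + of_real r * (q / p * w)) = norm (p * (z + of_real r * (q / p * w)))"
      using p by (simp add: norm_mult)
    also have "p * (z + of_real r * (q / p * w)) = p * z + of_real r * (q * w)"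
      using \<open>p \<noteq> 0\<close> by (simp add: field_simps)
    also have "\<dots> = of_real (norm z + r * norm w)" by (simp add: p q)
    also have "norm \<dots> = norm z + r * norm w" using that by (simp del: of_real_add of_real_mult)
    finally show ?thesis .
  qed
  then show ?thesis using p q by (intro exI[of _ "q / p"]) (simp add: norm_divide)
qed

text \<open>The upper bound has no term linear in the modulus of \<open>s\<close>, whereas the right
  phase of \<open>s\<close> makes the modulus of the polynomial grow at the rate
  \<open>norm c1\<close>; dividing by \<open>r\<close> and letting it tend to 0 leaves nothing for
  \<open>c1\<close>. The polynomial is a family of monomials with repeated degrees, since the
  application sums over sets of labels, with degree \<open>card S\<close>.\<close>

lemma first_order_maximum:
  fixes c :: "'i \<Rightarrow> complex" and a b :: "'i \<Rightarrow> nat"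
  assumes fin: "finite I"
    and bound: "\<And>s. norm (\<Sum>i\<in>I. c i * s ^ a i)
      \<le> norm (\<Sum>i | i \<in> I \<and> a i = 0. c i) * (1 + (norm s)\<^sup>2) ^ N"
  shows "(\<Sum>i | i \<in> I \<and> a i = 1. c i) = 0"
proof -
  define c0 where "c0 = (\<Sum>i | i \<in> I \<and> a i = 0. c i)"
  define c1 where "c1 = (\<Sum>i | i \<in> I \<and> a i = 1. c i)"
  define K where "K = (\<Sum>i\<in>I. norm (c i))"
  obtain \<beta> where \<beta>: "norm \<beta> = 1" "\<And>r. r \<ge> 0 \<Longrightarrow> norm (c0 + of_real r * (\<beta> * c1)) = norm c0 + r * norm c1"
    using exists_aligning_phase by blast
  have "norm c1 \<le> 0 + ((real N + 4 ^ N) * norm c0 + K) * r" if r: "0 < r" "r \<le> 1" for r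
  proof -
    define s where "s = of_real r * \<beta>"
    have s: "norm s = r" using r \<beta> by (simp add: s_def norm_mult)
    have "(\<Sum>i\<in>I. c i * s ^ a i)
        = (\<Sum>i\<in>I. (if a i = 0 then c i else 0) + (if a i = 1 then s * c i else 0)
            + (if 2 \<le> a i then c i * s ^ a i else 0))"
      by (rule sum.cong) (auto simp: not_less_eq_eq numeral_2_eq_2 le_Suc_eq)
    also have "\<dots> = c0 + s * c1 + (\<Sum>i\<in>I. if 2 \<le> a i then c i * s ^ a i else 0)"
      using fin by (simp add: sum.distrib sum.inter_filter c0_def c1_def sum_distrib_left if_distrib[of "(*) _"] cong: if_cong)
    finally have e: "(\<Sum>i\<in>I. c i * s ^ a i)
        = c0 + s * c1 + (\<Sum>i\<in>I. if 2 \<le> a i then c i * s ^ a i else 0)" .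
    have R: "norm (\<Sum>i\<in>I. if 2 \<le> a i then c i * s ^ a i else 0) \<le> K * r\<^sup>2"
      unfolding K_def sum_distrib_right
      by (rule sum_norm_le) (use r in \<open>auto simp: norm_mult norm_power s intro!: mult_left_mono power_decreasing\<close>)
    have "norm c0 + r * norm c1 = norm (c0 + s * c1)"
      using \<beta>(2)[of r] r by (simp add: s_def mult_ac)
    also have "\<dots> \<le> norm (\<Sum>i\<in>I. c i * s ^ a i) + K * r\<^sup>2"
      using R e norm_triangle_ineq4[of "\<Sum>i\<in>I. c i * s ^ a i" "\<Sum>i\<in>I. if 2 \<le> a i then c i * s ^ a i else 0"]
      by simp
    also have "\<dots> \<le> norm c0 * (1 + r\<^sup>2) ^ N + K * r\<^sup>2"
      using bound[of s] by (simp add: s c0_def)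
    also have "\<dots> \<le> norm c0 * (1 + real N * r\<^sup>2 + 4 ^ N * (r\<^sup>2)\<^sup>2) + K * r\<^sup>2"
      using one_plus_power_le[of "r\<^sup>2" N] r by (intro order_refl add_mono mult_left_mono) (auto simp: power_le_one)
    also have "\<dots> \<le> norm c0 * (1 + real N * r\<^sup>2 + 4 ^ N * r\<^sup>2) + K * r\<^sup>2"
      using r by (intro add_mono mult_left_mono order_refl) (auto simp: power_le_one power2_eq_square mult_le_one intro!: mult_left_le)
    finally have "r * norm c1 \<le> r * (((real N + 4 ^ N) * norm c0 + K) * r)"
      by (simp add: algebra_simps power2_eq_square)
    then show ?thesis using r by simp
  qed
  then have "norm c1 \<le> 0" by (rule le_of_le_add_small)
  then show ?thesis by (simp add: c1_def)
qed

text \<open>Evaluating at \<open>s = \<beta> r \<i>\<^sup>k\<close>, \<open>t = r \<i>\<^sup>-\<^sup>k\<close> and averaging over \<open>k\<close> removes all terms of total degree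
  at most two except the constant one and the one in \<open>s t\<close>.\<close>

lemma second_order_maximum:
  fixes c :: "'i \<Rightarrow> complex" and a b :: "'i \<Rightarrow> nat"
  assumes fin: "finite I"
    and bound: "\<And>s t. norm s = norm t \<Longrightarrow> norm (\<Sum>i\<in>I. c i * s ^ a i * t ^ b i)
      \<le> norm (\<Sum>i | i \<in> I \<and> a i = 0 \<and> b i = 0. c i) * (1 + (norm s)\<^sup>2) ^ N"
  shows "norm (\<Sum>i | i \<in> I \<and> a i = 1 \<and> b i = 1. c i)
    \<le> real N * norm (\<Sum>i | i \<in> I \<and> a i = 0 \<and> b i = 0. c i)"
proof -
  define c0 where "c0 = (\<Sum>i | i \<in> I \<and> a i = 0 \<and> b i = 0. c i)"
  define c1 where "c1 = (\<Sum>i | i \<in> I \<and> a i = 1 \<and> b i = 1. c i)"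
  define K where "K = (\<Sum>i\<in>I. norm (c i))"
  define e where "e m = (\<Sum>k<4. \<i> ^ (k * m)) / 4" for m :: nat
  have e_norm: "norm (e m) \<le> 1" for m
  proof -
    have "norm (\<Sum>k<4. \<i> ^ (k * m)) \<le> (\<Sum>k<(4::nat). 1)"
      by (rule sum_norm_le) (simp add: norm_power)
    then show ?thesis by (simp add: e_def norm_divide)
  qed
  \<comment> \<open>\<open>e m\<close> averages the m-th powers of the fourth roots of unity, so it
    is 1 if 4 divides \<open>m\<close> and 0 otherwise. The values listed are those at
    \<open>a + 3 * b\<close> for all monomials of total degree at most two; only 0 and 4, that is
    degrees (0, 0) and (1, 1), survive.\<close>
  have e_vals: "e 0 = 1" "e 4 = 1" "e 1 = 0" "e 2 = 0" "e 3 = 0" "e 6 = 0"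
    by (simp_all add: e_def numeral_eq_Suc lessThan_Suc)
  obtain \<beta> where \<beta>: "norm \<beta> = 1" "\<And>r. r \<ge> 0 \<Longrightarrow> norm (c0 + of_real r * (\<beta> * c1)) = norm c0 + r * norm c1"
    using exists_aligning_phase by blast
  have "norm c1 \<le> real N * norm c0 + (4 ^ N * norm c0 + K) * r" if r: "0 < r" "r \<le> 1" for r
  proof -
    \<comment> \<open>\<open>\<i> ^ (3 * k)\<close> is the inverse of \<open>\<i> ^ k\<close>,
      written with a natural exponent.\<close>
    define p where "p k = (\<Sum>i\<in>I. c i * (of_real r * \<beta> * \<i> ^ k) ^ a i * (of_real r * \<i> ^ (3 * k)) ^ b i)" for k :: nat
    define d where "d i = c i * \<beta> ^ a i * of_real r ^ (a i + b i) * e (a i + 3 * b i)" for i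
    have p: "norm (p k) \<le> norm c0 * (1 + r\<^sup>2) ^ N" for k
      using bound[of "of_real r * \<beta> * \<i> ^ k" "of_real r * \<i> ^ (3 * k)"] r \<beta>
      by (simp add: p_def c0_def norm_mult norm_power)
    have "(\<Sum>k<4. p k) / 4 = (\<Sum>i\<in>I. \<Sum>k<4. c i * (of_real r * \<beta> * \<i> ^ k) ^ a i * (of_real r * \<i> ^ (3 * k)) ^ b i) / 4"
      unfolding p_def by (subst sum.swap) (rule refl)
    also have "\<dots> = (\<Sum>i\<in>I. d i)"
      unfolding sum_divide_distrib d_def e_def
      by (intro sum.cong refl)
         (simp add: sum_distrib_left sum_divide_distrib power_mult_distrib power_add mult_ac distrib_left flip: power_mult)
    also have "\<dots> = (\<Sum>i\<in>I. (if a i = 0 \<and> b i = 0 then c i else 0)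
        + (if a i = 1 \<and> b i = 1 then of_real (r\<^sup>2) * \<beta> * c i else 0) + (if 3 \<le> a i + b i then d i else 0))"
    proof (rule sum.cong)
      fix i assume "i \<in> I"
      consider "a i = 0 \<and> b i = 0" | "a i = 1 \<and> b i = 0" | "a i = 0 \<and> b i = 1" | "a i = 1 \<and> b i = 1"
        | "a i = 2 \<and> b i = 0" | "a i = 0 \<and> b i = 2" | "3 \<le> a i + b i" by linarith
      then show "d i = (if a i = 0 \<and> b i = 0 then c i else 0)
        + (if a i = 1 \<and> b i = 1 then of_real (r\<^sup>2) * \<beta> * c i else 0) + (if 3 \<le> a i + b i then d i else 0)"
        by cases (use e_vals in \<open>auto simp: d_def power2_eq_square\<close>)
    qed simp
    also have "\<dots> = c0 + of_real (r\<^sup>2) * (\<beta> * c1) + (\<Sum>i\<in>I. if 3 \<le> a i + b i then d i else 0)"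
      using fin by (simp add: sum.distrib sum.inter_filter c0_def c1_def sum_distrib_left mult.assoc if_distrib[of "(*) _"] cong: if_cong)
    finally have E: "(\<Sum>k<4. p k) / 4
        = c0 + of_real (r\<^sup>2) * (\<beta> * c1) + (\<Sum>i\<in>I. if 3 \<le> a i + b i then d i else 0)" .
    have R: "norm (\<Sum>i\<in>I. if 3 \<le> a i + b i then d i else 0) \<le> K * r ^ 3"
      unfolding K_def sum_distrib_right
    proof (rule sum_norm_le)
      fix i assume "i \<in> I"
      have "norm (d i) = norm (c i) * (r ^ (a i + b i) * norm (e (a i + 3 * b i)))"
        using r \<beta> by (simp add: d_def norm_mult norm_power mult.assoc)
      moreover have "r ^ (a i + b i) * norm (e (a i + 3 * b i)) \<le> r ^ 3 * 1" if "3 \<le> a i + b i"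
        using r that e_norm by (intro mult_mono power_decreasing) auto
      ultimately show "norm (if 3 \<le> a i + b i then d i else 0) \<le> norm (c i) * r ^ 3"
        using r by (auto intro!: mult_left_mono)
    qed
    have "norm (\<Sum>k<4. p k) \<le> (\<Sum>k<(4::nat). norm c0 * (1 + r\<^sup>2) ^ N)"
      by (rule sum_norm_le) (rule p)
    then have P: "norm ((\<Sum>k<4. p k) / 4) \<le> norm c0 * (1 + r\<^sup>2) ^ N"
      by (simp add: norm_divide)
    have "norm c0 + r\<^sup>2 * norm c1 = norm (c0 + of_real (r\<^sup>2) * (\<beta> * c1))"
      using \<beta>(2)[of "r\<^sup>2"] by simp
    also have "\<dots> \<le> norm ((\<Sum>k<4. p k) / 4) + K * r ^ 3"
      unfolding E
      using R norm_triangle_ineq4[of "c0 + of_real (r\<^sup>2) * (\<beta> * c1) + (\<Sum>i\<in>I. if 3 \<le> a i + b i then d i else 0)"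
          "\<Sum>i\<in>I. if 3 \<le> a i + b i then d i else 0"]
      by simp
    also have "\<dots> \<le> norm c0 * (1 + real N * r\<^sup>2 + 4 ^ N * (r\<^sup>2)\<^sup>2) + K * r ^ 3"
      using one_plus_power_le[of "r\<^sup>2" N] r
      by (intro order_refl add_mono order.trans[OF P] mult_left_mono) (auto simp: power_le_one)
    also have "\<dots> \<le> norm c0 * (1 + real N * r\<^sup>2 + 4 ^ N * r ^ 3) + K * r ^ 3"
      using r by (intro add_mono mult_left_mono order_refl) (auto simp flip: power_mult intro!: power_decreasing)
    finally have "r\<^sup>2 * norm c1 \<le> r\<^sup>2 * (real N * norm c0 + (4 ^ N * norm c0 + K) * r)"
      by (simp add: algebra_simps power2_eq_square power3_eq_cube)
    then show ?thesis using r by simp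
  qed
  then have "norm c1 \<le> real N * norm c0" by (rule le_of_le_add_small)
  then show ?thesis by (simp add: c1_def c0_def)
qed

subsection \<open>Perturbing symmetric product vectors\<close>

text \<open>These are the terms in the expansion of the tensor power of
  \<open>u + z *s x\<close>.\<close>

definition mix :: "'n::finite set \<Rightarrow> complex^'a \<Rightarrow> complex^'a \<Rightarrow> complex^('n \<Rightarrow> 'a::finite)"
  where "mix S x u = (\<chi> f. (\<Prod>i\<in>S. x $ f i) * (\<Prod>i\<in>-S. u $ f i))"

lemma mix_empty: "mix {} x u = power_vec u"
  by (simp add: mix_def power_vec_def vec_eq_iff)

lemma power_vec_add_smult:
  "(power_vec (u + z *s x) :: complex^('n::finite \<Rightarrow> 'a::finite)) = (\<Sum>S\<in>UNIV. z ^ card S *s mix S x u)"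
proof -
  have "(\<Prod>i\<in>UNIV. z * x $ f i + u $ f i)
      = (\<Sum>S\<in>UNIV. z ^ card S * ((\<Prod>i\<in>S. x $ f i) * (\<Prod>i\<in>-S. u $ f i)))" for f :: "'n \<Rightarrow> 'a"
    by (subst prod_add) (simp_all add: prod.distrib Compl_eq_Diff_UNIV mult.assoc)
  then show ?thesis by (simp add: vec_eq_iff power_vec_def mix_def add.commute)
qed

lemma tensor_vec_sum: "tensor_vec (\<Sum>i\<in>I. f i) (\<Sum>j\<in>J. g j) = (\<Sum>(i, j)\<in>I \<times> J. tensor_vec (f i) (g j))"
  by (simp add: tensor_vec_def vec_eq_iff sum_product sum.cartesian_product case_prod_unfold)

lemma tensor_vec_smult: "tensor_vec (a *s u) (b *s v) = (a * b) *s tensor_vec u v"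
  by (simp add: tensor_vec_def vec_eq_iff mult_ac)

lemma tensor_vec_sum_left: "tensor_vec (\<Sum>i\<in>I. f i) v = (\<Sum>i\<in>I. tensor_vec (f i) v)"
  and tensor_vec_sum_right: "tensor_vec v (\<Sum>i\<in>I. g i) = (\<Sum>i\<in>I. tensor_vec v (g i))"
  by (simp_all add: tensor_vec_def vec_eq_iff sum_distrib_left sum_distrib_right)

lemma tensor_vec_smult_left: "tensor_vec (a *s u) v = a *s tensor_vec u v"
  and tensor_vec_smult_right: "tensor_vec u (a *s v) = a *s tensor_vec u v"
  by (simp_all add: tensor_vec_def vec_eq_iff mult_ac)

lemma norm_tensor_vec: "norm (tensor_vec u v) = norm u * norm v"
proof -
  have "(norm (tensor_vec u v))\<^sup>2 = (norm u * norm v)\<^sup>2"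
    unfolding norm_vec_sq power_mult_distrib sum_product
    by (simp add: tensor_vec_def norm_mult power_mult_distrib sum.cartesian_product case_prod_unfold)
  then show ?thesis by (metis norm_ge_zero power2_eq_iff_nonneg mult_nonneg_nonneg)
qed

definition product_overlap :: "complex^(('n::finite \<Rightarrow> 'a::finite) \<times> ('n \<Rightarrow> 'b::finite)) \<Rightarrow> complex^'a \<Rightarrow> complex^'b \<Rightarrow> complex"
  where "product_overlap \<psi> u v = cinner_vec (tensor_vec (power_vec u) (power_vec v)) \<psi>"

text \<open>The overlap is antilinear in the product vector. Perturbing by conjugated scalars makes
  it a polynomial in \<open>s\<close> and \<open>t\<close>.\<close>

lemma product_overlap_shift:
  "product_overlap \<psi> (u + cnj s *s x) (v + cnj t *s y)
    = (\<Sum>p\<in>UNIV. cinner_vec (tensor_vec (mix (fst p) x u) (mix (snd p) y v)) \<psi> * s ^ card (fst p) * t ^ card (snd p))"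
  unfolding product_overlap_def power_vec_add_smult tensor_vec_sum UNIV_Times_UNIV cinner_vec_sum_left
  by (rule sum.cong)
     (simp_all add: case_prod_unfold tensor_vec_smult cinner_vec_smult_left mult_ac)

lemma mix_permute:
  assumes "\<pi> permutes UNIV"
  shows "mix S x u $ (f \<circ> \<pi>) = mix (\<pi> ` S) x u $ f"
proof -
  have inj: "inj \<pi>" using assms by (rule permutes_inj)
  have *: "\<pi> ` (- S) = - \<pi> ` S"
    using permutes_bij[OF assms] by (rule bij_image_Compl_eq)
  have "(\<Prod>i\<in>\<pi> ` T. h i) = (\<Prod>i\<in>T. h (\<pi> i))" for T and h :: "_ \<Rightarrow> complex"
    using inj by (simp add: prod.reindex inj_on_subset)
  then show ?thesis by (simp add: mix_def flip: *)
qed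

lemma cinner_vec_bisym_permute:
  assumes "\<psi> \<in> bisym" "\<pi> permutes UNIV" "\<tau> permutes UNIV"
  shows "cinner_vec (tensor_vec (mix S x u) (mix S' y v)) \<psi>
    = cinner_vec (tensor_vec (mix (\<pi> ` S) x u) (mix (\<tau> ` S') y v)) \<psi>"
proof -
  have b: "bij (\<lambda>(f, g). (f \<circ> \<pi>, g \<circ> \<tau>))"
    using permutes_inv_o[OF assms(2)] permutes_inv_o[OF assms(3)]
    by (intro o_bij[where g = "\<lambda>(f, g). (f \<circ> inv \<pi>, g \<circ> inv \<tau>)"])
       (auto simp: fun_eq_iff o_def)
  show ?thesis
    unfolding cinner_vec_def
    by (subst sum.reindex_bij_betw[OF b, symmetric])
       (use assms in \<open>simp add: case_prod_unfold tensor_vec_def mix_permute bisym_def\<close>)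
qed

text \<open>Transpositions move the perturbed labels to \<open>k\<close>. Hence a first-order
  coefficient of the overlap is n times, and the mixed second-order one n^2 times, the corresponding
  term at \<open>k\<close>.\<close>

lemma cinner_vec_bisym_singleton:
  assumes "\<psi> \<in> bisym"
  shows "cinner_vec (tensor_vec (mix {i} x u) (mix {j} y v)) \<psi>
      = cinner_vec (tensor_vec (mix {k} x u) (mix {k} y v)) \<psi>"
    and "cinner_vec (tensor_vec (mix {i} x u) (mix {} y v)) \<psi>
      = cinner_vec (tensor_vec (mix {k} x u) (mix {} y v)) \<psi>"
    and "cinner_vec (tensor_vec (mix {} x u) (mix {j} y v)) \<psi>
      = cinner_vec (tensor_vec (mix {} x u) (mix {k} y v)) \<psi>"
  using cinner_vec_bisym_permute[OF assms, of "Transposition.transpose i k" "Transposition.transpose j k" "{i}" x u "{j}"]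
    cinner_vec_bisym_permute[OF assms, of "Transposition.transpose i k" id "{i}" x u "{}"]
    cinner_vec_bisym_permute[OF assms, of id "Transposition.transpose j k" "{}" x u "{j}"]
  by (simp_all add: permutes_swap_id permutes_id)

text \<open>The vector \<open>w\<close> sits on the pair labelled \<open>k\<close>, and
  \<open>u\<close>, \<open>v\<close> on all other factors. In contrast to \<open>mix\<close> it
  admits an entangled \<open>w\<close>, as needed for
  \<open>w = H *v tensor_vec u v\<close>.\<close>

definition place :: "'n::finite \<Rightarrow> complex^'a::finite \<Rightarrow> complex^'b::finite \<Rightarrow> complex^('a \<times> 'b)
    \<Rightarrow> complex^(('n \<Rightarrow> 'a) \<times> ('n \<Rightarrow> 'b))"
  where "place k u v w = (\<chi> h. (\<Prod>i\<in>-{k}. u $ fst h i) * (\<Prod>i\<in>-{k}. v $ snd h i) * w $ (fst h k, snd h k))"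

lemma place_add: "place k u v (w + w') = place k u v w + place k u v w'"
  and place_smult: "place k u v (c *s w) = c *s place k u v w"
  and place_0: "place k u v 0 = 0"
  by (simp_all add: place_def vec_eq_iff algebra_simps)

lemma place_sum: "place k u v (\<Sum>i\<in>I. w i) = (\<Sum>i\<in>I. place k u v (w i))"
  by (induction I rule: infinite_finite_induct) (simp_all add: place_add place_0)

lemma slice_place:
  "slice k (place k u v w) r = ((\<Prod>i\<in>-{k}. u $ fst r i) * (\<Prod>i\<in>-{k}. v $ snd r i)) *s w"
proof -
  have "(\<Prod>i\<in>-{k}. u $ (f(k := a)) i) = (\<Prod>i\<in>-{k}. u $ f i)" for u :: "complex^'x" and f a
    by (rule prod.cong) auto
  then show ?thesis by (simp add: vec_eq_iff slice_def place_def del: fun_upd_apply) simp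
qed

lemma place_tensor: "place k u v (tensor_vec x y) = tensor_vec (mix {k} x u) (mix {k} y v)"
  by (simp add: place_def tensor_vec_def mix_def vec_eq_iff mult_ac)

lemma mix_singleton_self: "mix {k} u u = power_vec u"
  by (simp add: mix_def power_vec_def vec_eq_iff prod.remove[of UNIV k] Compl_eq_Diff_UNIV)

lemma norm_add_orthogonal_sq:
  assumes "norm u = 1" "norm x = 1" "cinner_vec u x = 0"
  shows "(norm (u + z *s x))\<^sup>2 = 1 + (norm z)\<^sup>2"
  using assms by (simp add: norm_add_sq_cinner_vec norm_smult_vec cinner_vec_smult_right)

text \<open>The norm is the square root of \<open>1 + (norm z)\<^sup>2\<close>. Dropping the root is
  harmless in the first-order condition, where only the absence of a linear term counts.\<close>

lemma norm_add_orthogonal_power: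
  assumes "norm u = 1" "norm x = 1" "cinner_vec u x = 0"
  shows "norm (u + z *s x) ^ N \<le> (1 + (norm z)\<^sup>2) ^ N"
proof (rule power_mono)
  have one: "1 \<le> norm (u + z *s x)"
    by (rule power2_le_imp_le) (simp_all only: norm_add_orthogonal_sq[OF assms], simp_all)
  have "norm (u + z *s x) \<le> (norm (u + z *s x))\<^sup>2"
    using one by (rule self_le_power) simp
  then show "norm (u + z *s x) \<le> 1 + (norm z)\<^sup>2"
    unfolding norm_add_orthogonal_sq[OF assms] .
qed simp

section \<open>Optimality conditions at a maximal product overlap\<close>

context
  fixes k :: "'n::finite" and \<psi> :: "complex^(('n \<Rightarrow> 'a::finite) \<times> ('n \<Rightarrow> 'b::finite))"
    and u :: "complex^'a" and v :: "complex^'b"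
  assumes sym: "\<psi> \<in> bisym" and u: "norm u = 1" and v: "norm v = 1"
    and max: "\<And>u' v'. norm (product_overlap \<psi> u' v') \<le> norm (product_overlap \<psi> u v) * (norm u' ^ CARD('n) * norm v' ^ CARD('n))"
begin

lemma card_singletons: "{S :: 'n set. card S = 1} = range (\<lambda>i. {i})"
  by (auto simp: card_1_singleton_iff)

text \<open>The linear coefficient of the overlap at \<open>u + cnj s *s x\<close> is n times the
  quantity in question, and it vanishes at a maximum.\<close>

lemma place_orthogonal_left:
  assumes x: "norm x = 1" "cinner_vec u x = 0"
  shows "cinner_vec (place k u v (tensor_vec x v)) \<psi> = 0"
proof -
  let ?c = "\<lambda>S. cinner_vec (tensor_vec (mix S x u) (power_vec v)) \<psi>"
  have product_overlap: "product_overlap \<psi> (u + cnj s *s x) v = (\<Sum>S\<in>UNIV. ?c S * s ^ card S)" for s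
    by (simp add: product_overlap_def power_vec_add_smult tensor_vec_sum_left tensor_vec_smult_left
        cinner_vec_sum_left cinner_vec_smult_left mult.commute)
  have "(\<Sum>S | S \<in> UNIV \<and> card S = 1. ?c S) = 0"
  proof (rule first_order_maximum[where N = "CARD('n)"])
    fix s
    have "{S :: 'n set. S \<in> UNIV \<and> card S = 0} = {{}}" by auto
    then have c0: "(\<Sum>S | S \<in> UNIV \<and> card S = 0. ?c S) = product_overlap \<psi> u v"
      by (simp only: sum.insert) (simp add: product_overlap_def mix_empty)
    have "norm (product_overlap \<psi> (u + cnj s *s x) v) \<le> norm (product_overlap \<psi> u v) * (1 + (norm s)\<^sup>2) ^ CARD('n)"
      using norm_add_orthogonal_power[OF u x, of "cnj s" "CARD('n)"]
      by (intro order.trans[OF max] mult_left_mono) (simp_all only: v power_one mult_1_right complex_mod_cnj norm_ge_zero)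
    then show "norm (\<Sum>S\<in>UNIV. ?c S * s ^ card S)
      \<le> norm (\<Sum>S | S \<in> UNIV \<and> card S = 0. ?c S) * (1 + (norm s)\<^sup>2) ^ CARD('n)"
      unfolding c0 product_overlap .
  qed simp
  also have "(\<Sum>S | S \<in> UNIV \<and> card S = 1. ?c S) = (\<Sum>i\<in>UNIV. ?c {i})"
    by (simp add: card_singletons sum.reindex del: One_nat_def)
  also have "\<dots> = (\<Sum>i\<in>(UNIV::'n set). ?c {k})"
    unfolding mix_empty[symmetric, where x = v] by (intro sum.cong refl cinner_vec_bisym_singleton(2)[OF sym])
  finally show ?thesis by (simp add: place_tensor mix_singleton_self)
qed

lemma place_orthogonal_right:
  assumes y: "norm y = 1" "cinner_vec v y = 0"
  shows "cinner_vec (place k u v (tensor_vec u y)) \<psi> = 0"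
proof -
  let ?c = "\<lambda>S. cinner_vec (tensor_vec (power_vec u) (mix S y v)) \<psi>"
  have product_overlap: "product_overlap \<psi> u (v + cnj s *s y) = (\<Sum>S\<in>UNIV. ?c S * s ^ card S)" for s
    by (simp add: product_overlap_def power_vec_add_smult tensor_vec_sum_right tensor_vec_smult_right
        cinner_vec_sum_left cinner_vec_smult_left mult.commute)
  have "(\<Sum>S | S \<in> UNIV \<and> card S = 1. ?c S) = 0"
  proof (rule first_order_maximum[where N = "CARD('n)"])
    fix s
    have "{S :: 'n set. S \<in> UNIV \<and> card S = 0} = {{}}" by auto
    then have c0: "(\<Sum>S | S \<in> UNIV \<and> card S = 0. ?c S) = product_overlap \<psi> u v"
      by (simp only: sum.insert) (simp add: product_overlap_def mix_empty)
    have "norm (product_overlap \<psi> u (v + cnj s *s y)) \<le> norm (product_overlap \<psi> u v) * (1 + (norm s)\<^sup>2) ^ CARD('n)"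
      using norm_add_orthogonal_power[OF v y, of "cnj s" "CARD('n)"]
      by (intro order.trans[OF max] mult_left_mono) (simp_all only: u power_one mult_1_left complex_mod_cnj norm_ge_zero)
    then show "norm (\<Sum>S\<in>UNIV. ?c S * s ^ card S)
      \<le> norm (\<Sum>S | S \<in> UNIV \<and> card S = 0. ?c S) * (1 + (norm s)\<^sup>2) ^ CARD('n)"
      unfolding c0 product_overlap .
  qed simp
  also have "(\<Sum>S | S \<in> UNIV \<and> card S = 1. ?c S) = (\<Sum>i\<in>UNIV. ?c {i})"
    by (simp add: card_singletons sum.reindex del: One_nat_def)
  also have "\<dots> = (\<Sum>i\<in>(UNIV::'n set). ?c {k})"
    unfolding mix_empty[symmetric, where x = u] by (intro sum.cong refl cinner_vec_bisym_singleton(3)[OF sym])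
  finally show ?thesis by (simp add: place_tensor mix_singleton_self)
qed

text \<open>The coefficient of \<open>s * t\<close> is n^2 times the quantity in question, while the
  second-order condition bounds it by n times the overlap; the quotient is the decisive 1/n.\<close>

lemma place_orthogonal_both_unit:
  assumes x: "norm x = 1" "cinner_vec u x = 0" and y: "norm y = 1" "cinner_vec v y = 0"
  shows "norm (cinner_vec (place k u v (tensor_vec x y)) \<psi>) \<le> norm (product_overlap \<psi> u v) / real CARD('n)"
proof -
  let ?c = "\<lambda>p :: 'n set \<times> 'n set. cinner_vec (tensor_vec (mix (fst p) x u) (mix (snd p) y v)) \<psi>"
  have "{p :: 'n set \<times> 'n set. p \<in> UNIV \<and> card (fst p) = 0 \<and> card (snd p) = 0} = {({}, {})}" by auto
  then have c0: "(\<Sum>p | p \<in> UNIV \<and> card (fst p) = 0 \<and> card (snd p) = 0. ?c p) = product_overlap \<psi> u v"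
    by (simp only: sum.insert) (simp add: product_overlap_def mix_empty)
  have "{p :: 'n set \<times> 'n set. p \<in> UNIV \<and> card (fst p) = 1 \<and> card (snd p) = 1}
      = {S. card S = 1} \<times> {S. card S = 1}" by auto
  then have "(\<Sum>p | p \<in> UNIV \<and> card (fst p) = 1 \<and> card (snd p) = 1. ?c p) = (\<Sum>i\<in>UNIV. \<Sum>j\<in>UNIV. ?c ({i}, {j}))"
    by (simp add: card_singletons sum.reindex sum.cartesian_product' del: One_nat_def)
  also have "\<dots> = (\<Sum>i\<in>(UNIV::'n set). \<Sum>j\<in>(UNIV::'n set). ?c ({k}, {k}))"
    unfolding fst_conv snd_conv by (intro sum.cong refl cinner_vec_bisym_singleton(1)[OF sym])
  finally have c1: "(\<Sum>p | p \<in> UNIV \<and> card (fst p) = 1 \<and> card (snd p) = 1. ?c p)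
      = of_real (real CARD('n) * real CARD('n)) * ?c ({k}, {k})" by simp
  have "norm (\<Sum>p | p \<in> UNIV \<and> card (fst p) = 1 \<and> card (snd p) = 1. ?c p)
      \<le> real CARD('n) * norm (\<Sum>p | p \<in> UNIV \<and> card (fst p) = 0 \<and> card (snd p) = 0. ?c p)"
  proof (rule second_order_maximum)
    fix s t :: complex assume st: "norm s = norm t"
    \<comment> \<open>For parameters of equal modulus the two square roots combine to exactly
      \<open>1 + (norm s)\<^sup>2\<close>. No factor is lost, so the exponent in the second-order
      condition is n and not 2 n.\<close>
    have sq: "(norm (u + cnj s *s x) * norm (v + cnj t *s y))\<^sup>2 = (1 + (norm s)\<^sup>2)\<^sup>2"
      using norm_add_orthogonal_sq[OF u x, of "cnj s"] norm_add_orthogonal_sq[OF v y, of "cnj t"] st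
      by (simp only: power_mult_distrib complex_mod_cnj) (simp add: power2_eq_square)
    have "norm (u + cnj s *s x) * norm (v + cnj t *s y) = 1 + (norm s)\<^sup>2"
      using sq by (rule power2_eq_imp_eq) auto
    then show "norm (\<Sum>p\<in>UNIV. ?c p * s ^ card (fst p) * t ^ card (snd p))
      \<le> norm (\<Sum>p | p \<in> UNIV \<and> card (fst p) = 0 \<and> card (snd p) = 0. ?c p) * (1 + (norm s)\<^sup>2) ^ CARD('n)"
      using max[of "u + cnj s *s x" "v + cnj t *s y"] unfolding c0 product_overlap_shift[symmetric] power_mult_distrib[symmetric]
      by simp
  qed simp
  then have "real CARD('n) * (real CARD('n) * norm (?c ({k}, {k}))) \<le> real CARD('n) * norm (product_overlap \<psi> u v)"
    unfolding c0 c1 by (simp add: norm_mult)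
  then have "real CARD('n) * norm (?c ({k}, {k})) \<le> norm (product_overlap \<psi> u v)" by simp
  then show ?thesis by (simp add: place_tensor field_simps)
qed

lemma place_orthogonal_both:
  assumes x: "cinner_vec u x = 0" and y: "cinner_vec v y = 0"
  shows "norm (cinner_vec (place k u v (tensor_vec x y)) \<psi>) \<le> norm x * norm y * (norm (product_overlap \<psi> u v) / real CARD('n))"
proof (cases "x = 0 \<or> y = 0")
  case True
  then have "tensor_vec x y = 0" by (auto simp: tensor_vec_def vec_eq_iff)
  then show ?thesis by (simp add: place_0)
next
  case False
  define x' where "x' = of_real (1 / norm x) *s x"
  define y' where "y' = of_real (1 / norm y) *s y"
  have x': "norm x' = 1" "cinner_vec u x' = 0" "x = of_real (norm x) *s x'"
    using False x by (simp_all add: x'_def norm_smult_vec cinner_vec_smult_right norm_divide)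
  have y': "norm y' = 1" "cinner_vec v y' = 0" "y = of_real (norm y) *s y'"
    using False y by (simp_all add: y'_def norm_smult_vec cinner_vec_smult_right norm_divide)
  have "norm (cinner_vec (place k u v (tensor_vec x y)) \<psi>)
      = norm x * norm y * norm (cinner_vec (place k u v (tensor_vec x' y')) \<psi>)"
    using arg_cong2[OF x'(3) y'(3), of tensor_vec]
    by (simp add: tensor_vec_smult place_smult cinner_vec_smult_left norm_mult)
  then show ?thesis
    using mult_left_mono[OF place_orthogonal_both_unit[OF x'(1,2) y'(1,2)], of "norm x * norm y"] by simp
qed

end

subsection \<open>The compressed operator\<close>

text \<open>If \<open>\<sigma>\<close> misses a label \<open>i\<close>, flipping the sign at
  \<open>i\<close> changes the first product but not the second, so the terms cancel in pairs. If it
  is bijective, the products agree and each term is 1.\<close>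

lemma sum_sign_products:
  fixes \<sigma> :: "'n::finite \<Rightarrow> 'n"
  defines "sg \<equiv> \<lambda>(\<epsilon> :: 'n \<Rightarrow> bool) i. if \<epsilon> i then 1 else (-1 :: complex)"
  shows "(\<Sum>\<epsilon>\<in>UNIV. (\<Prod>i\<in>UNIV. sg \<epsilon> i) * (\<Prod>j\<in>UNIV. sg \<epsilon> (\<sigma> j)))
    = (if bij \<sigma> then of_nat (card (UNIV :: ('n \<Rightarrow> bool) set)) else 0)"
proof (cases "bij \<sigma>")
  case True
  have "(\<Prod>i\<in>UNIV. sg \<epsilon> i) * (\<Prod>j\<in>UNIV. sg \<epsilon> (\<sigma> j)) = 1" for \<epsilon>
  proof -
    have "(\<Prod>j\<in>UNIV. sg \<epsilon> (\<sigma> j)) = (\<Prod>i\<in>UNIV. sg \<epsilon> i)"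
      by (rule prod.reindex_bij_betw[OF True, of "sg \<epsilon>"])
    moreover have "sg \<epsilon> i * sg \<epsilon> i = 1" for i by (simp add: sg_def)
    ultimately show ?thesis by (simp flip: prod.distrib)
  qed
  then show ?thesis using True by simp
next
  case False
  then obtain i where i: "i \<notin> range \<sigma>" using finite_UNIV_surj_inj[of \<sigma>] by (auto simp: bij_def)
  let ?f = "\<lambda>\<epsilon>. (\<Prod>i\<in>UNIV. sg \<epsilon> i) * (\<Prod>j\<in>UNIV. sg \<epsilon> (\<sigma> j))"
  define flip where "flip \<epsilon> = \<epsilon>(i := \<not> \<epsilon> i)" for \<epsilon> :: "'n \<Rightarrow> bool"
  have flip: "?f (flip \<epsilon>) = - ?f \<epsilon>" for \<epsilon>
  proof -
    have "(\<Prod>j\<in>UNIV. sg (flip \<epsilon>) (\<sigma> j)) = (\<Prod>j\<in>UNIV. sg \<epsilon> (\<sigma> j))"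
      using i by (intro prod.cong) (auto simp: sg_def flip_def)
    moreover have "(\<Prod>j\<in>UNIV - {i}. sg (flip \<epsilon>) j) = (\<Prod>j\<in>UNIV - {i}. sg \<epsilon> j)"
      by (intro prod.cong) (auto simp: sg_def flip_def)
    moreover have "sg (flip \<epsilon>) i = - sg \<epsilon> i" by (simp add: sg_def flip_def)
    ultimately show ?thesis by (simp add: prod.remove[of UNIV i])
  qed
  have "bij flip" by (rule o_bij[of flip]) (auto simp: flip_def fun_eq_iff)
  then have "(\<Sum>\<epsilon>\<in>UNIV. ?f \<epsilon>) = (\<Sum>\<epsilon>\<in>UNIV. ?f (flip \<epsilon>))"
    by (rule sum.reindex_bij_betw[of flip UNIV UNIV ?f, symmetric])
  also have "\<dots> = - (\<Sum>\<epsilon>\<in>UNIV. ?f \<epsilon>)" by (simp only: flip sum_negf)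
  finally show ?thesis using False by simp
qed

text \<open>The polarization identity: the form is evaluated at signed sums of the basis vectors
  labelled by \<open>h\<close>, and averaging against the product of the signs retains one copy of
  \<open>G h\<close> for every bijection of the labels.\<close>

lemma symmetric_form_polarization:
  fixes G :: "('n::finite \<Rightarrow> 'a::finite) \<Rightarrow> complex"
  assumes sym: "\<And>\<pi> f. bij \<pi> \<Longrightarrow> G (f \<circ> \<pi>) = G f"
    and zero: "\<And>u :: complex^'a. (\<Sum>f\<in>UNIV. (\<Prod>i\<in>UNIV. u $ f i) * G f) = 0"
  shows "G h = 0"
proof -
  define sg where "sg = (\<lambda>(\<epsilon> :: 'n \<Rightarrow> bool) i. if \<epsilon> i then 1 else (-1 :: complex))"
  have expand: "(\<Sum>\<sigma>\<in>UNIV. (\<Prod>j\<in>UNIV. sg \<epsilon> (\<sigma> j)) * G (h \<circ> \<sigma>)) = 0" for \<epsilon>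
  proof -
    \<comment> \<open>\<open>h\<close> may repeat indices, so each entry collects the signs of all
      labels that \<open>h\<close> sends there.\<close>
    define u :: "complex^'a" where "u = (\<chi> a. \<Sum>i\<in>UNIV. if a = h i then sg \<epsilon> i else 0)"
    have "(\<Prod>j\<in>UNIV. u $ f j) = (\<Sum>\<sigma>\<in>UNIV. if f = h \<circ> \<sigma> then \<Prod>j\<in>UNIV. sg \<epsilon> (\<sigma> j) else 0)" for f :: "'n \<Rightarrow> 'a"
    proof -
      have "(\<Prod>j\<in>UNIV. u $ f j) = (\<Sum>\<sigma>\<in>UNIV. \<Prod>j\<in>UNIV. if f j = h (\<sigma> j) then sg \<epsilon> (\<sigma> j) else 0)"
        unfolding u_def vec_lambda_beta by (subst prod_sum_PiE) (simp_all add: PiE_UNIV_domain)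
      also have "\<dots> = (\<Sum>\<sigma>\<in>UNIV. if f = h \<circ> \<sigma> then \<Prod>j\<in>UNIV. sg \<epsilon> (\<sigma> j) else 0)"
        by (rule sum.cong) (auto simp: fun_eq_iff)
      finally show ?thesis .
    qed
    then have "0 = (\<Sum>f\<in>UNIV. \<Sum>\<sigma>\<in>UNIV. if f = h \<circ> \<sigma> then (\<Prod>j\<in>UNIV. sg \<epsilon> (\<sigma> j)) * G f else 0)"
      using zero[of u] by (simp add: sum_distrib_right if_distrib[of "\<lambda>x. x * _"] cong: if_cong)
    also have "\<dots> = (\<Sum>\<sigma>\<in>UNIV. \<Sum>f\<in>UNIV. if f = h \<circ> \<sigma> then (\<Prod>j\<in>UNIV. sg \<epsilon> (\<sigma> j)) * G f else 0)"
      by (rule sum.swap)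
    finally show ?thesis by simp
  qed
  let ?N = "of_nat (card (UNIV :: ('n \<Rightarrow> bool) set)) :: complex"
  have "0 = (\<Sum>\<epsilon>\<in>UNIV. (\<Prod>i\<in>UNIV. sg \<epsilon> i) * (\<Sum>\<sigma>\<in>UNIV. (\<Prod>j\<in>UNIV. sg \<epsilon> (\<sigma> j)) * G (h \<circ> \<sigma>)))"
    by (simp only: expand) simp
  also have "\<dots> = (\<Sum>\<sigma>\<in>UNIV. (\<Sum>\<epsilon>\<in>UNIV. (\<Prod>i\<in>UNIV. sg \<epsilon> i) * (\<Prod>j\<in>UNIV. sg \<epsilon> (\<sigma> j))) * G (h \<circ> \<sigma>))"
    unfolding sum_distrib_left sum_distrib_right mult.assoc by (rule sum.swap)
  also have "\<dots> = (\<Sum>\<sigma>\<in>(UNIV :: ('n \<Rightarrow> 'n) set). if bij \<sigma> then ?N * G h else 0)"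
    unfolding sg_def sum_sign_products by (rule sum.cong) (auto simp: sym)
  also have "\<dots> = of_nat (card {\<sigma> :: 'n \<Rightarrow> 'n. bij \<sigma>}) * (?N * G h)"
    by (simp add: sum.If_cases)
  finally have "card {\<sigma> :: 'n \<Rightarrow> 'n. bij \<sigma>} = 0 \<or> card (UNIV :: ('n \<Rightarrow> bool) set) = 0 \<or> G h = 0"
    by auto
  moreover have "id \<in> {\<sigma> :: 'n \<Rightarrow> 'n. bij \<sigma>}" by simp
  then have "card {\<sigma> :: 'n \<Rightarrow> 'n. bij \<sigma>} \<noteq> 0" by (metis card_0_eq emptyE finite)
  ultimately show ?thesis by simp
qed

text \<open>Polarization is applied to one block at a time: for fixed \<open>u\<close> the partial
  contraction \<open>G u\<close> is still symmetric in the second block. Conjugating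
  \<open>u\<close> and \<open>v\<close> turns the overlap into a form without conjugates. This
  guarantees that the maximal overlap with an eigenvector is nonzero.\<close>

lemma product_overlap_eq_zero_imp:
  fixes \<psi> :: "complex^(('n::finite \<Rightarrow> 'a::finite) \<times> ('n \<Rightarrow> 'b::finite))"
  assumes "\<psi> \<in> bisym" and zero: "\<And>u v. product_overlap \<psi> u v = 0"
  shows "\<psi> = 0"
proof -
  have sym: "\<psi> $ (f \<circ> \<pi>, g \<circ> \<tau>) = \<psi> $ (f, g)" if "bij \<pi>" "bij \<tau>" for f g \<pi> \<tau>
    using assms(1) bij_imp_permutes[of \<pi> UNIV] bij_imp_permutes[of \<tau> UNIV] that by (simp add: bisym_def)
  define G where "G u g = (\<Sum>f\<in>UNIV. (\<Prod>i\<in>UNIV. u $ f i) * \<psi> $ (f, g))" for u :: "complex^'a" and g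
  have conj: "cnj (\<Prod>i\<in>UNIV. w $ f i) = (\<Prod>i\<in>UNIV. (\<chi> i. cnj (w $ i)) $ f i)" for w :: "complex^'x" and f :: "'n \<Rightarrow> 'x"
    by simp
  have "(\<Sum>g\<in>UNIV. (\<Prod>i\<in>UNIV. v $ g i) * G u g) = 0" for u v
  proof -
    have "(\<Sum>g\<in>UNIV. (\<Prod>i\<in>UNIV. v $ g i) * G u g)
        = (\<Sum>f\<in>UNIV. \<Sum>g\<in>UNIV. (\<Prod>i\<in>UNIV. u $ f i) * (\<Prod>i\<in>UNIV. v $ g i) * \<psi> $ (f, g))"
      unfolding G_def sum_distrib_left by (subst sum.swap) (simp add: mult_ac)
    also have "\<dots> = product_overlap \<psi> (\<chi> i. cnj (u $ i)) (\<chi> i. cnj (v $ i))"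
      by (simp add: product_overlap_def cinner_vec_def tensor_vec_def power_vec_def sum.cartesian_product case_prod_unfold)
    finally show ?thesis by (simp add: zero)
  qed
  moreover have "G u (g \<circ> \<tau>) = G u g" if "bij \<tau>" for u g \<tau>
    unfolding G_def using sym[of id \<tau>] that by simp
  ultimately have G0: "G u g = 0" for u g
    by (intro symmetric_form_polarization[of "G u"])
  have "\<psi> $ (f, g) = 0" for f g
  proof (rule symmetric_form_polarization[of "\<lambda>f. \<psi> $ (f, g)"])
    fix \<pi> :: "'n \<Rightarrow> 'n" and f assume "bij \<pi>"
    then show "\<psi> $ (f \<circ> \<pi>, g) = \<psi> $ (f, g)" using sym[of \<pi> id f g] by simp
  qed (use G0 in \<open>simp add: G_def\<close>)
  then show ?thesis by (simp add: vec_eq_iff)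
qed

lemma exists_unit_direction:
  fixes x :: "complex^'a"
  obtains x' where "norm x' = 1" "x = of_real (norm x) *s x'"
proof (cases "x = 0")
  case True
  then show ?thesis by (intro that[of "axis undefined 1"]) auto
next
  case False
  then show ?thesis
    by (intro that[of "of_real (1 / norm x) *s x"]) (simp_all add: norm_smult_vec norm_divide)
qed

lemma power_vec_smult: "(power_vec (c *s u) :: complex^('n::finite \<Rightarrow> 'a::finite)) = c ^ CARD('n) *s power_vec u"
  by (simp add: power_vec_def vec_eq_iff prod.distrib)

text \<open>Compactness of the product of unit spheres gives the maximum. The homogeneous form of
  the conclusion allows perturbed vectors to be inserted without normalisation.\<close>

lemma product_overlap_attains_max:
  fixes \<psi> :: "complex^(('n::finite \<Rightarrow> 'a::finite) \<times> ('n \<Rightarrow> 'b::finite))"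
  obtains u v where "norm u = 1" "norm v = 1"
    "\<And>u' v'. norm (product_overlap \<psi> u' v') \<le> norm (product_overlap \<psi> u v) * (norm u' ^ CARD('n) * norm v' ^ CARD('n))"
proof -
  let ?S = "sphere 0 1 \<times> sphere 0 1 :: ((complex^'a) \<times> (complex^'b)) set"
  have "compact ?S" by (intro compact_Times compact_sphere)
  moreover have "(axis undefined 1, axis undefined 1) \<in> ?S" by simp
  then have "?S \<noteq> {}" by blast
  moreover have "continuous_on ?S (\<lambda>p. norm (product_overlap \<psi> (fst p) (snd p)))"
    unfolding product_overlap_def cinner_vec_def tensor_vec_def power_vec_def vec_lambda_beta
    by (intro continuous_intros)
  ultimately have "\<exists>p\<in>?S. \<forall>q\<in>?S. norm (product_overlap \<psi> (fst q) (snd q)) \<le> norm (product_overlap \<psi> (fst p) (snd p))"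
    by (rule continuous_attains_sup)
  then obtain p where p: "p \<in> ?S" "\<And>q. q \<in> ?S \<Longrightarrow> norm (product_overlap \<psi> (fst q) (snd q)) \<le> norm (product_overlap \<psi> (fst p) (snd p))"
    by blast
  have "norm (product_overlap \<psi> u' v') \<le> norm (product_overlap \<psi> (fst p) (snd p)) * (norm u' ^ CARD('n) * norm v' ^ CARD('n))" for u' v'
  proof -
    obtain u v where u: "norm u = 1" "u' = of_real (norm u') *s u" and v: "norm v = 1" "v' = of_real (norm v') *s v"
      using exists_unit_direction by metis
    have "norm (product_overlap \<psi> u' v') = norm u' ^ CARD('n) * norm v' ^ CARD('n) * norm (product_overlap \<psi> u v)"
      using arg_cong2[OF u(2) v(2), of "product_overlap \<psi>"]
      by (simp add: product_overlap_def power_vec_smult tensor_vec_smult cinner_vec_smult_left norm_mult norm_power)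
    also have "\<dots> \<le> norm u' ^ CARD('n) * norm v' ^ CARD('n) * norm (product_overlap \<psi> (fst p) (snd p))"
      using p(2)[of "(u, v)"] u v by (intro mult_left_mono) auto
    finally show ?thesis by (simp add: mult_ac)
  qed
  then show ?thesis using p(1) by (intro that[of "fst p" "snd p"]) auto
qed

section \<open>The compressed quadratic form and its top eigenvector\<close>

text \<open>The sesquilinear form of \<open>H\<close> acting on the pair of factors labelled
  \<open>k\<close>, tensored with the identity on all others. Summed over a pure-state decomposition
  of an extension, its diagonal values give the pairing of \<open>H\<close> with the
  marginal.\<close>

definition hform :: "'n::finite \<Rightarrow> complex^('a::finite \<times> 'b::finite)^('a \<times> 'b)
    \<Rightarrow> complex^(('n \<Rightarrow> 'a) \<times> ('n \<Rightarrow> 'b)) \<Rightarrow> complex^(('n \<Rightarrow> 'a) \<times> ('n \<Rightarrow> 'b)) \<Rightarrow> complex"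
  where "hform k H \<phi> \<psi> = (\<Sum>r\<in>rest k \<times> rest k. cinner_vec (slice k \<phi> r) (H *v slice k \<psi> r))"

lemma slice_add: "slice k (\<phi> + \<psi>) r = slice k \<phi> r + slice k \<psi> r"
  and slice_smult: "slice k (c *s \<psi>) r = c *s slice k \<psi> r"
  by (simp_all add: slice_def vec_eq_iff)

lemma hform_add_left: "hform k H (\<phi> + \<phi>') \<psi> = hform k H \<phi> \<psi> + hform k H \<phi>' \<psi>"
  and hform_add_right: "hform k H \<phi> (\<psi> + \<psi>') = hform k H \<phi> \<psi> + hform k H \<phi> \<psi>'"
  and hform_smult_left: "hform k H (c *s \<phi>) \<psi> = cnj c * hform k H \<phi> \<psi>"
  and hform_smult_right: "hform k H \<phi> (c *s \<psi>) = c * hform k H \<phi> \<psi>"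
  by (simp_all add: hform_def slice_add slice_smult cinner_vec_add_left cinner_vec_add_right
      cinner_vec_smult_left cinner_vec_smult_right matrix_vector_right_distrib
      vector_scalar_commute sum.distrib sum_distrib_left)

lemma hform_commute:
  assumes "adjoint_op H = H"
  shows "hform k H \<phi> \<psi> = cnj (hform k H \<psi> \<phi>)"
  unfolding hform_def cnj_sum
  by (rule sum.cong) (use cinner_vec_hermitian[OF assms] cinner_vec_commute in metis)+

lemma linear_coeff_zero:
  fixes a d :: real
  assumes "\<And>t. 0 \<le> 2 * t * a + t\<^sup>2 * d"
  shows "a = 0"
proof -
  have "2 * \<bar>a\<bar> \<le> 0 + \<bar>d\<bar> * r" if r: "0 < r" "r \<le> 1" for r
  proof -
    have "0 \<le> 2 * (- sgn a * r) * a + (- sgn a * r)\<^sup>2 * d" by (rule assms)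
    also have "\<dots> \<le> r * (\<bar>d\<bar> * r - 2 * \<bar>a\<bar>)"
      by (cases a "0::real" rule: linorder_cases)
         (use r in \<open>auto simp: power2_eq_square algebra_simps mult_left_mono\<close>)
    finally show ?thesis using r by (simp add: zero_le_mult_iff)
  qed
  then have "2 * \<bar>a\<bar> \<le> 0" by (rule le_of_le_add_small)
  then show ?thesis by simp
qed

lemma closed_bisym: "closed bisym"
proof (rule closed_subspace)
  show "subspace bisym" by (auto simp: subspace_def bisym_def)
qed

lemma tensor_power_vec_bisym: "tensor_vec (power_vec u) (power_vec v) \<in> bisym"
  using tensor_power_vec_mem tensor_space_sym_subset_bisym by blast

lemma norm_power_vec_axis: "norm (power_vec (axis a 1) :: complex^('n::finite \<Rightarrow> 'a::finite)) = 1"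
proof -
  have "power_vec (axis a 1) = (axis (\<lambda>_. a) 1 :: complex^('n \<Rightarrow> 'a))"
    by (auto simp: power_vec_def vec_eq_iff axis_def fun_eq_iff)
  then show ?thesis by simp
qed

text \<open>A maximiser of the form on the unit sphere of \<open>bisym\<close>. The equation is
  weak, tested against \<open>bisym\<close> only, which amounts to an eigenvector of the compression
  without constructing that operator.\<close>

lemma top_eigenvector:
  fixes H :: "complex^('a::finite \<times> 'b::finite)^('a \<times> 'b)" and k :: "'n::finite"
  assumes H: "adjoint_op H = H"
  obtains \<psi> \<mu> where "\<psi> \<in> bisym" "\<psi> \<noteq> 0" "\<And>\<phi>. \<phi> \<in> bisym \<Longrightarrow> hform k H \<phi> \<psi> = of_real \<mu> * cinner_vec \<phi> \<psi>"
    "\<And>\<phi>. \<phi> \<in> bisym \<Longrightarrow> Re (hform k H \<phi> \<phi>) \<le> \<mu> * (norm \<phi>)\<^sup>2"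
proof -
  let ?S = "bisym \<inter> sphere 0 1 :: (complex^(('n \<Rightarrow> 'a) \<times> ('n \<Rightarrow> 'b))) set"
  have "compact ?S" by (intro closed_Int_compact closed_bisym compact_sphere)
  moreover have "tensor_vec (power_vec (axis undefined 1)) (power_vec (axis undefined 1)) \<in> ?S"
    by (simp add: tensor_power_vec_bisym norm_tensor_vec norm_power_vec_axis)
  then have "?S \<noteq> {}" by blast
  moreover have "continuous_on ?S (\<lambda>\<psi>. Re (hform k H \<psi> \<psi>))"
    unfolding hform_def cinner_vec_def matrix_vector_mult_def slice_def vec_lambda_beta
    by (intro continuous_intros)
  ultimately have "\<exists>\<psi>\<in>?S. \<forall>\<phi>\<in>?S. Re (hform k H \<phi> \<phi>) \<le> Re (hform k H \<psi> \<psi>)"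
    by (rule continuous_attains_sup)
  then obtain \<psi> where \<psi>: "\<psi> \<in> ?S" and max: "\<And>\<phi>. \<phi> \<in> ?S \<Longrightarrow> Re (hform k H \<phi> \<phi>) \<le> Re (hform k H \<psi> \<psi>)"
    by blast
  define \<mu> where "\<mu> = Re (hform k H \<psi> \<psi>)"
  have q: "Re (hform k H \<phi> \<phi>) \<le> \<mu> * (norm \<phi>)\<^sup>2" if "\<phi> \<in> bisym" for \<phi>
  proof (cases "\<phi> = 0")
    case True
    then have "hform k H \<phi> \<phi> = 0" using hform_smult_left[of k H 0 \<phi> \<phi>] by simp
    then show ?thesis using True by simp
  next
    case False
    define \<phi>' where "\<phi>' = of_real (1 / norm \<phi>) *s \<phi>"
    have "\<phi>' \<in> ?S" using False that vec.subspace_scale[OF subspace_bisym]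
      by (simp add: \<phi>'_def norm_smult_vec norm_divide)
    then have "Re (hform k H \<phi>' \<phi>') \<le> \<mu>" unfolding \<mu>_def by (rule max)
    moreover have "hform k H \<phi>' \<phi>' = of_real (1 / (norm \<phi>)\<^sup>2) * hform k H \<phi> \<phi>"
      by (simp add: \<phi>'_def hform_smult_left hform_smult_right power2_eq_square)
    ultimately have "Re (hform k H \<phi> \<phi>) / (norm \<phi>)\<^sup>2 \<le> \<mu>"
      unfolding Re_of_real_mult by simp
    then show ?thesis using False by (simp add: field_simps)
  qed
  have Re0: "Re (of_real \<mu> * cinner_vec \<phi> \<psi> - hform k H \<phi> \<psi>) = 0" if "\<phi> \<in> bisym" for \<phi>
  proof (rule linear_coeff_zero)
    fix t :: real
    have m: "\<psi> + of_real t *s \<phi> \<in> bisym"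
      using \<psi> that subspace_bisym by (auto intro: vec.subspace_add vec.subspace_scale)
    have "hform k H (\<psi> + of_real t *s \<phi>) (\<psi> + of_real t *s \<phi>)
        = hform k H \<psi> \<psi> + of_real t * (hform k H \<phi> \<psi> + cnj (hform k H \<phi> \<psi>)) + of_real (t\<^sup>2) * hform k H \<phi> \<phi>"
      by (simp add: hform_add_left hform_add_right hform_smult_left hform_smult_right
          hform_commute[OF H, of _ \<psi> \<phi>] algebra_simps power2_eq_square)
    then have "Re (hform k H (\<psi> + of_real t *s \<phi>) (\<psi> + of_real t *s \<phi>))
        = \<mu> + 2 * t * Re (hform k H \<phi> \<psi>) + t\<^sup>2 * Re (hform k H \<phi> \<phi>)"
      by (simp add: \<mu>_def del: of_real_power)
    moreover have "(norm (\<psi> + of_real t *s \<phi>))\<^sup>2 = 1 + t\<^sup>2 * (norm \<phi>)\<^sup>2 + 2 * t * Re (cinner_vec \<phi> \<psi>)"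
      using \<psi> cinner_vec_commute[of \<psi> \<phi>]
      by (simp add: norm_add_sq_cinner_vec norm_smult_vec cinner_vec_smult_right power_mult_distrib)
    ultimately show "0 \<le> 2 * t * Re (of_real \<mu> * cinner_vec \<phi> \<psi> - hform k H \<phi> \<psi>)
        + t\<^sup>2 * (\<mu> * (norm \<phi>)\<^sup>2 - Re (hform k H \<phi> \<phi>))"
      using q[OF m] by (simp add: algebra_simps)
  qed
  have "hform k H \<phi> \<psi> = of_real \<mu> * cinner_vec \<phi> \<psi>" if "\<phi> \<in> bisym" for \<phi>
  proof -
    \<comment> \<open>The variation yields the real part only; testing with
      \<open>\<i> *s \<phi>\<close> supplies the imaginary part.\<close>
    have "\<i> *s \<phi> \<in> bisym" using that subspace_bisym by (auto intro: vec.subspace_scale)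
    from Re0[OF this] Re0[OF that] show ?thesis
      by (simp add: complex_eq_iff hform_smult_left cinner_vec_smult_left)
  qed
  then show ?thesis using q \<psi> by (intro that[of \<psi> \<mu>]) auto
qed

lemma hform_place:
  assumes "adjoint_op H = H"
  shows "hform k H (place k u v w) \<psi> = cinner_vec (place k u v (H *v w)) \<psi>"
  unfolding hform_def cinner_vec_slices[of "place k u v (H *v w)" \<psi> k] slice_place
  by (simp add: cinner_vec_hermitian[OF assms] vector_scalar_commute)

lemma cinner_tensor_vec: "cinner_vec (tensor_vec u v) (tensor_vec x y) = cinner_vec u x * cinner_vec v y"
  unfolding cinner_vec_def tensor_vec_def sum_product
  by (simp add: sum.cartesian_product case_prod_unfold mult_ac)

text \<open>The bound \<open>B\<close> on some expansion into product vectors stands in for the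
  nuclear norm of the doubly orthogonal component, so no singular value decomposition is required.
  The index type of the expansion is left open because later expansions run over vectors of either
  factor.\<close>

theorem compression_bound:
  fixes H :: "complex^('a::finite \<times> 'b::finite)^('a \<times> 'b)" and k :: "'n::finite"
  assumes H: "adjoint_op H = H"
    and sep: "\<And>u v. norm u = 1 \<Longrightarrow> norm v = 1 \<Longrightarrow> Re (cinner_vec (tensor_vec u v) (H *v tensor_vec u v)) \<le> s"
    and dec: "\<And>u v. norm u = 1 \<Longrightarrow> norm v = 1 \<Longrightarrow> \<exists>(J :: 'j set) \<alpha> \<beta>. finite J \<and>
      H *v tensor_vec u v = (\<Sum>j\<in>J. tensor_vec (\<alpha> j) (\<beta> j)) \<and>
      (\<Sum>j\<in>J. norm (ortho_part u (\<alpha> j)) * norm (ortho_part v (\<beta> j))) \<le> B"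
    and \<phi>: "\<phi> \<in> bisym"
  shows "Re (hform k H \<phi> \<phi>) \<le> (s + B / real CARD('n)) * (norm \<phi>)\<^sup>2"
proof -
  obtain \<psi> \<mu> where \<psi>: "\<psi> \<in> bisym" "\<psi> \<noteq> 0"
    and eig: "\<And>\<phi>. \<phi> \<in> bisym \<Longrightarrow> hform k H \<phi> \<psi> = of_real \<mu> * cinner_vec \<phi> \<psi>"
    and top: "\<And>\<phi>. \<phi> \<in> bisym \<Longrightarrow> Re (hform k H \<phi> \<phi>) \<le> \<mu> * (norm \<phi>)\<^sup>2"
    using top_eigenvector[OF H] by metis
  obtain u v where u: "norm u = 1" and v: "norm v = 1"
    and max: "\<And>u' v'. norm (product_overlap \<psi> u' v') \<le> norm (product_overlap \<psi> u v) * (norm u' ^ CARD('n) * norm v' ^ CARD('n))"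
    using product_overlap_attains_max by metis
  \<comment> \<open>Otherwise every product overlap would vanish, and with it the
    eigenvector.\<close>
  have F0: "norm (product_overlap \<psi> u v) > 0"
  proof (rule ccontr)
    assume "\<not> norm (product_overlap \<psi> u v) > 0"
    then have "product_overlap \<psi> u' v' = 0" for u' v' using max[of u' v'] by simp
    then show False using product_overlap_eq_zero_imp[OF \<psi>(1)] \<psi>(2) by blast
  qed
  define L where "L w = cinner_vec (place k u v w) \<psi>" for w
  have L_add: "L (w + w') = L w + L w'" and L_smult: "L (c *s w) = cnj c * L w"
    and L_sum: "L (\<Sum>j\<in>J. f j) = (\<Sum>j\<in>J. L (f j))" for w w' c and J :: "'j set" and f
    by (simp_all add: L_def place_add place_smult place_sum cinner_vec_add_left cinner_vec_smult_left
        cinner_vec_sum_left)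
  have Luv: "L (tensor_vec u v) = product_overlap \<psi> u v"
    by (simp add: L_def place_tensor mix_singleton_self product_overlap_def)
  have Lx: "L (tensor_vec x v) = 0" if "cinner_vec u x = 0" for x
  proof (cases "x = 0")
    case False
    obtain x' where x': "norm x' = 1" "x = of_real (norm x) *s x'" by (rule exists_unit_direction)
    have "of_real (norm x) * cinner_vec u x' = 0" using that by (subst (asm) x'(2)) (simp add: cinner_vec_smult_right)
    then have "L (tensor_vec x' v) = 0"
      unfolding L_def using place_orthogonal_left[OF \<psi>(1) u v max x'(1)] False by simp
    then show ?thesis by (subst x'(2)) (simp add: tensor_vec_smult_left L_smult)
  qed (simp add: L_def tensor_vec_smult_left[of 0, simplified] place_0)
  have Ly: "L (tensor_vec u y) = 0" if "cinner_vec v y = 0" for y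
  proof (cases "y = 0")
    case False
    obtain y' where y': "norm y' = 1" "y = of_real (norm y) *s y'" by (rule exists_unit_direction)
    have "of_real (norm y) * cinner_vec v y' = 0" using that by (subst (asm) y'(2)) (simp add: cinner_vec_smult_right)
    then have "L (tensor_vec u y') = 0"
      unfolding L_def using place_orthogonal_right[OF \<psi>(1) u v max y'(1)] False by simp
    then show ?thesis by (subst y'(2)) (simp add: tensor_vec_smult_right L_smult)
  qed (simp add: L_def tensor_vec_smult_right[of _ 0, simplified] place_0)
  obtain J :: "'j set" and \<alpha> \<beta> where J: "finite J" "H *v tensor_vec u v = (\<Sum>j\<in>J. tensor_vec (\<alpha> j) (\<beta> j))"
    and B: "(\<Sum>j\<in>J. norm (ortho_part u (\<alpha> j)) * norm (ortho_part v (\<beta> j))) \<le> B"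
    using dec[OF u v] by blast
  define c where "c = cinner_vec (tensor_vec u v) (H *v tensor_vec u v)"
  have c: "c = (\<Sum>j\<in>J. cinner_vec u (\<alpha> j) * cinner_vec v (\<beta> j))"
    by (simp add: c_def J(2) cinner_vec_sum_right cinner_tensor_vec)
  define x where "x j = ortho_part u (\<alpha> j)" for j
  define y where "y j = ortho_part v (\<beta> j)" for j
  have x0: "cinner_vec u (x j) = 0" and y0: "cinner_vec v (y j) = 0" for j
    by (simp_all add: x_def y_def cinner_vec_ortho_part u v)
  have L1: "L (tensor_vec (\<alpha> j) (\<beta> j)) = cnj (cinner_vec u (\<alpha> j) * cinner_vec v (\<beta> j)) * product_overlap \<psi> u v
      + L (tensor_vec (x j) (y j))" for j
  proof -
    have "tensor_vec (\<alpha> j) (\<beta> j) = (cinner_vec u (\<alpha> j) * cinner_vec v (\<beta> j)) *s tensor_vec u v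
        + cinner_vec v (\<beta> j) *s tensor_vec (x j) v + cinner_vec u (\<alpha> j) *s tensor_vec u (y j)
        + tensor_vec (x j) (y j)"
      by (simp add: tensor_vec_def vec_eq_iff x_def y_def ortho_part_def algebra_simps)
    then show ?thesis by (simp add: L_add L_smult Luv Lx Ly x0 y0)
  qed
  \<comment> \<open>Placing \<open>u\<close> tensor \<open>v\<close> gives the full product power,
    which is symmetric, so the eigenvalue equation may be tested with it; \<open>H\<close> can then
    be moved onto the placed vector.\<close>
  have "of_real \<mu> * product_overlap \<psi> u v = hform k H (place k u v (tensor_vec u v)) \<psi>"
    using eig[OF tensor_power_vec_bisym, of u v] by (simp add: place_tensor mix_singleton_self product_overlap_def)
  also have "\<dots> = L (H *v tensor_vec u v)"
    by (simp add: hform_place[OF H] L_def)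
  also have "\<dots> = cnj c * product_overlap \<psi> u v + (\<Sum>j\<in>J. L (tensor_vec (x j) (y j)))"
    by (simp add: J(2) L_sum L1 c sum.distrib sum_distrib_right)
  finally have "(of_real \<mu> - cnj c) * product_overlap \<psi> u v = (\<Sum>j\<in>J. L (tensor_vec (x j) (y j)))"
    by (simp add: algebra_simps)
  then have "norm (of_real \<mu> - cnj c) * norm (product_overlap \<psi> u v) = norm (\<Sum>j\<in>J. L (tensor_vec (x j) (y j)))"
    by (metis norm_mult)
  also have "\<dots> \<le> (\<Sum>j\<in>J. norm (x j) * norm (y j) * (norm (product_overlap \<psi> u v) / real CARD('n)))"
    unfolding L_def using place_orthogonal_both[OF \<psi>(1) u v max x0 y0] by (intro sum_norm_le)
  also have "\<dots> \<le> B * (norm (product_overlap \<psi> u v) / real CARD('n))"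
    unfolding sum_distrib_right[symmetric] using B by (intro mult_right_mono) (auto simp: x_def y_def)
  finally have "norm (of_real \<mu> - cnj c) \<le> B / real CARD('n)"
    using F0 by (simp add: field_simps)
  moreover have "\<mu> - Re c \<le> norm (of_real \<mu> - cnj c)"
    using complex_Re_le_cmod[of "of_real \<mu> - cnj c"] by simp
  moreover have "Re c \<le> s" unfolding c_def using sep u v by simp
  ultimately have "\<mu> \<le> s + B / real CARD('n)" by simp
  then have "\<mu> * (norm \<phi>)\<^sup>2 \<le> (s + B / real CARD('n)) * (norm \<phi>)\<^sup>2" by (rule mult_right_mono) simp
  with top[OF \<phi>] show ?thesis by simp
qed

subsection \<open>Overlaps of extendible states\<close>

definition exchange :: "'n \<Rightarrow> 'b \<times> ('n \<Rightarrow> 'b) \<Rightarrow> 'b \<times> ('n \<Rightarrow> 'b)"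
  where "exchange j p = (snd p j, (snd p)(j := fst p))"

lemma exchange_exchange [simp]: "exchange j (exchange j p) = p"
  by (simp add: exchange_def)

lemma bij_exchange: "bij (exchange j)"
  by (rule o_bij[of "exchange j"]) (simp_all add: fun_eq_iff)

text \<open>Let \<open>X\<close> exchange a further factor with one of \<open>n\<close> factors.  On vectors symmetric in the \<open>n\<close> factors
  the quadratic form of \<open>1 + n X\<close> is that of \<open>n + 1\<close> times the projection onto the symmetric space of all
  \<open>n + 1\<close> factors.\<close>

lemma exchange_form_nonneg:
  fixes Z :: "'b::finite \<times> ('n::finite \<Rightarrow> 'b) \<Rightarrow> complex"
  assumes sym: "\<And>\<tau> b g. bij \<tau> \<Longrightarrow> Z (b, g \<circ> \<tau>) = Z (b, g)"
  shows "0 \<le> Re ((\<Sum>p\<in>UNIV. cnj (Z p) * Z p) + of_nat CARD('n) * (\<Sum>p\<in>UNIV. cnj (Z p) * Z (exchange k p)))"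
proof -
  \<comment> \<open>\<open>V\<close> is n + 1 times the symmetrisation of \<open>Z\<close>: on
    functions symmetric in the n factors, the identity and the n exchanges represent all
    cosets.\<close>
  define V where "V p = Z p + (\<Sum>j\<in>UNIV. Z (exchange j p))" for p
  define X where "X j = (\<Sum>p\<in>UNIV. cnj (Z p) * Z (exchange j p))" for j
  have reindex: "(\<Sum>p\<in>UNIV. F (exchange j p)) = (\<Sum>p\<in>UNIV. F p)" for F :: "_ \<Rightarrow> complex" and j :: 'n
    by (rule sum.reindex_bij_betw[OF bij_exchange])
  have bij_t: "bij (Transposition.transpose i j)" for i j :: 'n by simp
  have V: "V (exchange i p) = V p" for i p
  proof -
    \<comment> \<open>For \<open>j \<noteq> i\<close> the double exchange is a single one up to a
      transposition of labels, which \<open>Z\<close> ignores. For \<open>j = i\<close> it merely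
      interchanges two summands of \<open>V\<close>.\<close>
    have "Z (exchange j (exchange i p)) = Z (exchange j p)" if "j \<noteq> i" for j
    proof -
      have "exchange j (exchange i p) = (snd p j, (snd p)(j := fst p) \<circ> Transposition.transpose i j)"
        using that by (auto simp: exchange_def fun_eq_iff Transposition.transpose_def)
      then show ?thesis using sym[OF bij_t] by (simp add: exchange_def)
    qed
    then have "(\<Sum>j\<in>UNIV - {i}. Z (exchange j (exchange i p))) = (\<Sum>j\<in>UNIV - {i}. Z (exchange j p))"
      by (intro sum.cong) auto
    then show ?thesis by (simp add: V_def sum.remove[of UNIV i])
  qed
  have X: "X j = X k" for j
  proof -
    let ?t = "Transposition.transpose j k"
    have b: "bij (\<lambda>p :: 'b \<times> ('n \<Rightarrow> 'b). (fst p, snd p \<circ> ?t))"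
      by (rule o_bij[of "\<lambda>p. (fst p, snd p \<circ> ?t)"]) (auto simp: fun_eq_iff)
    have "Z (exchange j (b, g \<circ> ?t)) = Z (exchange k (b, g))" for b g
    proof -
      have "exchange j (b, g \<circ> ?t) = (g k, g(k := b) \<circ> ?t)"
        by (auto simp: exchange_def fun_eq_iff Transposition.transpose_def)
      then show ?thesis using sym[OF bij_t] by (simp add: exchange_def)
    qed
    then show ?thesis
      unfolding X_def
      by (subst sum.reindex_bij_betw[OF b, symmetric]) (simp add: sym[OF bij_t])
  qed
  have V1: "(\<Sum>p\<in>UNIV. cnj (V p) * Z (exchange j p)) = (\<Sum>p\<in>UNIV. cnj (V p) * Z p)" for j
    using reindex[of "\<lambda>p. cnj (V p) * Z p" j] by (simp add: V)
  have X1: "(\<Sum>p\<in>UNIV. cnj (Z (exchange j p)) * Z p) = X k" for j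
    using reindex[of "\<lambda>p. cnj (Z (exchange j p)) * Z p" j] X[of j] by (simp add: X_def)
  \<comment> \<open>Since \<open>V\<close> is fixed by every exchange, its squared norm is n + 1
    times its inner product with \<open>Z\<close>, which is the form to be shown
    nonnegative.\<close>
  have "(\<Sum>p\<in>UNIV. cnj (V p) * V p)
      = (\<Sum>p\<in>UNIV. cnj (V p) * Z p) + (\<Sum>j\<in>UNIV. \<Sum>p\<in>UNIV. cnj (V p) * Z (exchange j p))"
    by (subst (2) V_def) (simp add: distrib_left sum.distrib sum_distrib_left sum.swap[of _ UNIV "UNIV :: 'n set"])
  also have "\<dots> = of_real (real CARD('n) + 1) * (\<Sum>p\<in>UNIV. cnj (V p) * Z p)"
    unfolding V1 by (simp add: algebra_simps)
  also have "(\<Sum>p\<in>UNIV. cnj (V p) * Z p) = (\<Sum>p\<in>UNIV. cnj (Z p) * Z p)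
      + (\<Sum>j\<in>UNIV. \<Sum>p\<in>UNIV. cnj (Z (exchange j p)) * Z p)"
    by (simp add: V_def distrib_right sum.distrib sum_distrib_right sum.swap[of _ UNIV "UNIV :: 'n set"])
  also have "\<dots> = (\<Sum>p\<in>UNIV. cnj (Z p) * Z p) + of_nat CARD('n) * X k"
    unfolding X1 by simp
  finally have "(\<Sum>p\<in>UNIV. cnj (V p) * V p)
      = of_real (real CARD('n) + 1) * ((\<Sum>p\<in>UNIV. cnj (Z p) * Z p) + of_nat CARD('n) * X k)" .
  moreover have "(\<Sum>p\<in>UNIV. cnj (V p) * V p) = of_real (\<Sum>p\<in>UNIV. (norm (V p))\<^sup>2)"
    unfolding of_real_sum of_real_cmod_sq ..
  ultimately have "Re (of_real (real CARD('n) + 1) * ((\<Sum>p\<in>UNIV. cnj (Z p) * Z p) + of_nat CARD('n) * X k))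
      = Re (of_real (\<Sum>p\<in>UNIV. (norm (V p))\<^sup>2))"
    by (simp only:)
  then have "(real CARD('n) + 1) * Re ((\<Sum>p\<in>UNIV. cnj (Z p) * Z p) + of_nat CARD('n) * X k)
      = (\<Sum>p\<in>UNIV. (norm (V p))\<^sup>2)"
    by (simp only: Re_of_real_mult Re_complex_of_real)
  moreover have "0 \<le> (\<Sum>p\<in>UNIV. (norm (V p))\<^sup>2)" by (simp add: sum_nonneg)
  ultimately have "0 \<le> (real CARD('n) + 1) * Re ((\<Sum>p\<in>UNIV. cnj (Z p) * Z p) + of_nat CARD('n) * X k)"
    by (simp only:)
  moreover have "0 < real CARD('n) + 1" by linarith
  ultimately show ?thesis unfolding X_def by (simp only: zero_le_mult_iff) linarith
qed

definition contract :: "'n \<Rightarrow> ('b::finite \<Rightarrow> complex) \<Rightarrow> (('n \<Rightarrow> 'b) \<Rightarrow> complex) \<Rightarrow> ('n \<Rightarrow> 'b) \<Rightarrow> complex"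
  where "contract k w \<phi> r = (\<Sum>b\<in>UNIV. cnj (w b) * \<phi> (r(k := b)))"

text \<open>After the exchange \<open>w1\<close> meets the k-th factor of \<open>\<phi>2\<close>,
  and \<open>w2\<close> that of \<open>\<phi>1\<close>; the remaining factors pair the two
  contractions.\<close>

lemma exchange_form_product:
  fixes w1 w2 :: "'b::finite \<Rightarrow> complex" and \<phi>1 \<phi>2 :: "('n::finite \<Rightarrow> 'b) \<Rightarrow> complex"
  shows "(\<Sum>p\<in>UNIV. cnj (w1 (fst p) * \<phi>1 (snd p)) * (w2 (fst (exchange k p)) * \<phi>2 (snd (exchange k p))))
    = (\<Sum>r\<in>rest k. contract k w1 \<phi>2 r * cnj (contract k w2 \<phi>1 r))"
proof -
  have "(\<Sum>p\<in>UNIV. cnj (w1 (fst p) * \<phi>1 (snd p)) * (w2 (fst (exchange k p)) * \<phi>2 (snd (exchange k p))))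
      = (\<Sum>b\<in>UNIV. \<Sum>g\<in>UNIV. cnj (w1 b * \<phi>1 g) * (w2 (g k) * \<phi>2 (g(k := b))))"
    by (simp add: exchange_def sum.cartesian_product case_prod_unfold)
  also have "\<dots> = (\<Sum>b\<in>UNIV. \<Sum>r\<in>rest k. \<Sum>b'\<in>UNIV. cnj (w1 b * \<phi>1 (r(k := b'))) * (w2 b' * \<phi>2 (r(k := b))))"
    by (subst sum_rest[of _ k]) simp
  also have "\<dots> = (\<Sum>r\<in>rest k. \<Sum>b\<in>UNIV. \<Sum>b'\<in>UNIV. cnj (w1 b * \<phi>1 (r(k := b'))) * (w2 b' * \<phi>2 (r(k := b))))"
    by (rule sum.swap)
  also have "\<dots> = (\<Sum>r\<in>rest k. contract k w1 \<phi>2 r * cnj (contract k w2 \<phi>1 r))"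
    unfolding contract_def cnj_sum sum_product by (simp add: mult_ac)
  finally show ?thesis .
qed

text \<open>Positivity of the exchange form on the antisymmetrised vectors
  \<open>w\<^sub>a' \<otimes> \<phi>\<^sub>a - w\<^sub>a \<otimes> \<phi>\<^sub>a'\<close>.\<close>

lemma symmetric_overlap_bound:
  fixes w :: "'a::finite \<Rightarrow> 'b::finite \<Rightarrow> complex" and \<phi> :: "'a \<Rightarrow> ('n::finite \<Rightarrow> 'b) \<Rightarrow> complex"
  assumes sym: "\<And>a \<tau> g. bij \<tau> \<Longrightarrow> \<phi> a (g \<circ> \<tau>) = \<phi> a g"
  shows "real CARD('n) * (\<Sum>r\<in>rest k. (norm (\<Sum>a\<in>UNIV. contract k (w a) (\<phi> a) r))\<^sup>2)
    \<le> (\<Sum>a\<in>UNIV. \<Sum>b\<in>UNIV. (norm (w a b))\<^sup>2) * (\<Sum>a\<in>UNIV. \<Sum>g\<in>UNIV. (norm (\<phi> a g))\<^sup>2)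
      + real CARD('n) * (\<Sum>a\<in>UNIV. \<Sum>a'\<in>UNIV. \<Sum>r\<in>rest k. (norm (contract k (w a') (\<phi> a) r))\<^sup>2)"
proof -
  define D where "D a a' p = w a' (fst p) * \<phi> a (snd p)" for a a' and p :: "'b \<times> ('n \<Rightarrow> 'b)"
  define Q where "Q F G = (\<Sum>p\<in>UNIV. cnj (F p) * G p) + of_nat CARD('n) * (\<Sum>p\<in>UNIV. cnj (F p) * G (exchange k p))"
    for F G :: "'b \<times> ('n \<Rightarrow> 'b) \<Rightarrow> complex"
  have Q_diff: "Q (\<lambda>p. F p - G p) (\<lambda>p. F p - G p) = Q F F - Q F G - Q G F + Q G G" for F G
    by (simp add: Q_def algebra_simps sum.distrib sum_subtractf)
  \<comment> \<open>Of the expanded squares, the diagonal terms give the right hand side; the cross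
    terms give the left hand side plus a sum of squares that is dropped at the end.\<close>
  have "0 \<le> Re (\<Sum>a\<in>UNIV. \<Sum>a'\<in>UNIV. Q (\<lambda>p. D a a' p - D a' a p) (\<lambda>p. D a a' p - D a' a p))"
    unfolding Re_sum Q_def by (intro sum_nonneg exchange_form_nonneg) (simp add: D_def sym)
  also have "(\<Sum>a\<in>UNIV. \<Sum>a'\<in>UNIV. Q (\<lambda>p. D a a' p - D a' a p) (\<lambda>p. D a a' p - D a' a p))
      = 2 * (\<Sum>a\<in>UNIV. \<Sum>a'\<in>UNIV. Q (D a a') (D a a')) - 2 * (\<Sum>a\<in>UNIV. \<Sum>a'\<in>UNIV. Q (D a a') (D a' a))"
  proof -
    have "(\<Sum>a\<in>UNIV. \<Sum>a'\<in>UNIV. Q (D a' a) (D a' a)) = (\<Sum>a\<in>UNIV. \<Sum>a'\<in>UNIV. Q (D a a') (D a a'))"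
      "(\<Sum>a\<in>UNIV. \<Sum>a'\<in>UNIV. Q (D a' a) (D a a')) = (\<Sum>a\<in>UNIV. \<Sum>a'\<in>UNIV. Q (D a a') (D a' a))"
      by (rule sum.swap)+
    then show ?thesis unfolding Q_diff by (simp add: sum.distrib sum_subtractf)
  qed
  also have "(\<Sum>a\<in>UNIV. \<Sum>a'\<in>UNIV. Q (D a a') (D a a'))
      = of_real ((\<Sum>a\<in>UNIV. \<Sum>b\<in>UNIV. (norm (w a b))\<^sup>2) * (\<Sum>a\<in>UNIV. \<Sum>g\<in>UNIV. (norm (\<phi> a g))\<^sup>2)
      + real CARD('n) * (\<Sum>a\<in>UNIV. \<Sum>a'\<in>UNIV. \<Sum>r\<in>rest k. (norm (contract k (w a') (\<phi> a) r))\<^sup>2))"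
  proof -
    have "Q (D a a') (D a a') = of_real ((\<Sum>b\<in>UNIV. (norm (w a' b))\<^sup>2) * (\<Sum>g\<in>UNIV. (norm (\<phi> a g))\<^sup>2)
        + real CARD('n) * (\<Sum>r\<in>rest k. (norm (contract k (w a') (\<phi> a) r))\<^sup>2))" for a a'
    proof -
      have "(\<Sum>p\<in>UNIV. cnj (D a a' p) * D a a' p) = of_real (\<Sum>p\<in>UNIV. (norm (D a a' p))\<^sup>2)"
        unfolding of_real_sum of_real_cmod_sq ..
      also have "(\<Sum>p\<in>UNIV. (norm (D a a' p))\<^sup>2) = (\<Sum>b\<in>UNIV. (norm (w a' b))\<^sup>2) * (\<Sum>g\<in>UNIV. (norm (\<phi> a g))\<^sup>2)"
        by (simp add: D_def norm_mult power_mult_distrib sum_product sum.cartesian_product case_prod_unfold)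
      finally show ?thesis
        unfolding Q_def D_def exchange_form_product complex_norm_square[symmetric]
        by (simp add: D_def)
    qed
    moreover have "(\<Sum>a\<in>UNIV. \<Sum>a'\<in>UNIV. (\<Sum>b\<in>UNIV. (norm (w a' b))\<^sup>2) * (\<Sum>g\<in>UNIV. (norm (\<phi> a g))\<^sup>2))
      = (\<Sum>a\<in>UNIV. \<Sum>b\<in>UNIV. (norm (w a b))\<^sup>2) * (\<Sum>a\<in>UNIV. \<Sum>g\<in>UNIV. (norm (\<phi> a g))\<^sup>2)"
      unfolding sum_product by (rule sum.swap)
    ultimately show ?thesis
      by (simp add: sum.distrib sum_distrib_left flip: of_real_sum del: of_real_mult of_real_add)
  qed
  also have "(\<Sum>a\<in>UNIV. \<Sum>a'\<in>UNIV. Q (D a a') (D a' a))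
      = of_real ((\<Sum>b\<in>UNIV. \<Sum>g\<in>UNIV. (norm (\<Sum>a\<in>UNIV. cnj (w a b) * \<phi> a g))\<^sup>2)
      + real CARD('n) * (\<Sum>r\<in>rest k. (norm (\<Sum>a\<in>UNIV. contract k (w a) (\<phi> a) r))\<^sup>2))"
  proof -
    have "(\<Sum>a\<in>UNIV. \<Sum>a'\<in>UNIV. \<Sum>p\<in>UNIV. cnj (D a a' p) * D a' a p)
        = (\<Sum>b\<in>UNIV. \<Sum>g\<in>UNIV. of_real ((norm (\<Sum>a\<in>UNIV. cnj (w a b) * \<phi> a g))\<^sup>2))"
    proof -
      have "(\<Sum>a\<in>UNIV. \<Sum>a'\<in>UNIV. \<Sum>p\<in>UNIV. cnj (D a a' p) * D a' a p)
          = (\<Sum>p\<in>UNIV. \<Sum>a\<in>UNIV. \<Sum>a'\<in>UNIV. cnj (D a a' p) * D a' a p)"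
        by (simp only: sum.swap[of _ "UNIV :: ('b \<times> ('n \<Rightarrow> 'b)) set"])
      also have "\<dots> = (\<Sum>p\<in>UNIV. of_real ((norm (\<Sum>a\<in>UNIV. cnj (w a (fst p)) * \<phi> a (snd p)))\<^sup>2))"
        unfolding of_real_cmod_sq D_def cnj_sum sum_product by (simp add: mult_ac)
      finally show ?thesis by (simp add: sum.cartesian_product case_prod_unfold)
    qed
    moreover have "(\<Sum>a\<in>UNIV. \<Sum>a'\<in>UNIV. \<Sum>p\<in>UNIV. cnj (D a a' p) * D a' a (exchange k p))
        = (\<Sum>r\<in>rest k. of_real ((norm (\<Sum>a\<in>UNIV. contract k (w a) (\<phi> a) r))\<^sup>2))"
    proof -
      have "(\<Sum>a\<in>UNIV. \<Sum>a'\<in>UNIV. \<Sum>p\<in>UNIV. cnj (D a a' p) * D a' a (exchange k p))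
          = (\<Sum>a\<in>UNIV. \<Sum>a'\<in>UNIV. \<Sum>r\<in>rest k. contract k (w a') (\<phi> a') r * cnj (contract k (w a) (\<phi> a) r))"
        unfolding D_def exchange_form_product ..
      also have "\<dots> = (\<Sum>r\<in>rest k. \<Sum>a\<in>UNIV. \<Sum>a'\<in>UNIV. contract k (w a') (\<phi> a') r * cnj (contract k (w a) (\<phi> a) r))"
        by (simp only: sum.swap[of _ "rest k"])
      also have "\<dots> = (\<Sum>r\<in>rest k. of_real ((norm (\<Sum>a\<in>UNIV. contract k (w a) (\<phi> a) r))\<^sup>2))"
        unfolding of_real_cmod_sq cnj_sum sum_product by (simp add: mult_ac)
      finally show ?thesis .
    qed
    ultimately show ?thesis
      unfolding Q_def sum.distrib sum_distrib_left[symmetric] by simp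
  qed
  finally have "real CARD('n) * (\<Sum>r\<in>rest k. (norm (\<Sum>a\<in>UNIV. contract k (w a) (\<phi> a) r))\<^sup>2)
      + (\<Sum>b\<in>UNIV. \<Sum>g\<in>UNIV. (norm (\<Sum>a\<in>UNIV. cnj (w a b) * \<phi> a g))\<^sup>2)
    \<le> (\<Sum>a\<in>UNIV. \<Sum>b\<in>UNIV. (norm (w a b))\<^sup>2) * (\<Sum>a\<in>UNIV. \<Sum>g\<in>UNIV. (norm (\<phi> a g))\<^sup>2)
      + real CARD('n) * (\<Sum>a\<in>UNIV. \<Sum>a'\<in>UNIV. \<Sum>r\<in>rest k. (norm (contract k (w a') (\<phi> a) r))\<^sup>2)"
    unfolding minus_complex.sel Re_of_real_mult[of 2, simplified] Re_complex_of_real by simp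
  moreover have "0 \<le> (\<Sum>b\<in>UNIV. \<Sum>g\<in>UNIV. (norm (\<Sum>a\<in>UNIV. cnj (w a b) * \<phi> a g))\<^sup>2)"
    by (intro sum_nonneg) simp
  ultimately show ?thesis by linarith
qed

definition row_vec :: "complex^('a::finite \<times> 'b::finite) \<Rightarrow> 'a \<Rightarrow> complex^'b"
  where "row_vec w a = (\<chi> b. w $ (a, b))"

lemma sum_UNIV_pair: "(\<Sum>x\<in>UNIV. f x) = (\<Sum>a\<in>UNIV. \<Sum>b\<in>UNIV. f (a, b))"
  by (simp add: sum.cartesian_product)

lemma norm_sq_row_vec: "(norm w)\<^sup>2 = (\<Sum>a\<in>UNIV. (norm (row_vec w a))\<^sup>2)"
  by (simp add: norm_vec_sq row_vec_def sum_UNIV_pair)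

text \<open>With \<open>\<rho>\<close> the marginal of a unit vector \<open>\<psi>\<close>, a unit
  vector \<open>w\<close> has weight in \<open>\<rho>\<close> at most 1/n plus the weights of its
  rows in the marginal of \<open>\<rho>\<close> on the right factor. The symmetric overlap bound is
  summed over the settings \<open>f\<close> of the remaining left factors, the kept left index being
  the family index.\<close>

theorem overlap_bound:
  fixes \<psi> :: "complex^(('n::finite \<Rightarrow> 'a::finite) \<times> ('n \<Rightarrow> 'b::finite))"
  assumes "\<psi> \<in> bisym"
  shows "real CARD('n) * (\<Sum>r\<in>rest k \<times> rest k. (norm (cinner_vec w (slice k \<psi> r)))\<^sup>2)
    \<le> (norm w)\<^sup>2 * (norm \<psi>)\<^sup>2 + real CARD('n) * (\<Sum>r\<in>rest k \<times> rest k. \<Sum>a\<in>UNIV. \<Sum>a'\<in>UNIV.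
        (norm (cinner_vec (row_vec w a') (row_vec (slice k \<psi> r) a)))\<^sup>2)"
proof -
  define \<phi> where "\<phi> f a g = \<psi> $ (f(k := a), g)" for f :: "'n \<Rightarrow> 'a" and a and g :: "'n \<Rightarrow> 'b"
  have c: "contract k (\<lambda>b. w $ (a', b)) (\<phi> f a) g = cinner_vec (row_vec w a') (row_vec (slice k \<psi> (f, g)) a)" for f g a a'
    by (simp add: contract_def \<phi>_def cinner_vec_def row_vec_def slice_def)
  have t: "(\<Sum>a\<in>UNIV. contract k (\<lambda>b. w $ (a, b)) (\<phi> f a) g) = cinner_vec w (slice k \<psi> (f, g))" for f g
    by (simp add: contract_def \<phi>_def cinner_vec_def slice_def sum_UNIV_pair)
  have W: "(\<Sum>a\<in>UNIV. \<Sum>b\<in>UNIV. (norm (w $ (a, b)))\<^sup>2) = (norm w)\<^sup>2"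
    by (simp add: norm_vec_sq sum_UNIV_pair)
  have P: "(\<Sum>f\<in>rest k. \<Sum>a\<in>UNIV. \<Sum>g\<in>UNIV. (norm (\<phi> f a g))\<^sup>2) = (norm \<psi>)\<^sup>2"
    unfolding norm_vec_sq sum_UNIV_pair \<phi>_def
    by (rule sum_rest[of "\<lambda>f. \<Sum>g\<in>UNIV. (norm (\<psi> $ (f, g)))\<^sup>2", symmetric])
  have sym: "\<phi> f a (g \<circ> \<tau>) = \<phi> f a g" if "bij \<tau>" for f a g \<tau>
  proof -
    have "\<psi> $ (f(k := a) \<circ> id, g \<circ> \<tau>) = \<psi> $ (f(k := a), g)"
      using assms bij_imp_permutes[of \<tau> UNIV] that permutes_id unfolding bisym_def by blast
    then show ?thesis by (simp add: \<phi>_def)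
  qed
  have "(\<Sum>f\<in>rest k. real CARD('n) * (\<Sum>g\<in>rest k. (norm (cinner_vec w (slice k \<psi> (f, g))))\<^sup>2))
    \<le> (\<Sum>f\<in>rest k. (norm w)\<^sup>2 * (\<Sum>a\<in>UNIV. \<Sum>g\<in>UNIV. (norm (\<phi> f a g))\<^sup>2)
      + real CARD('n) * (\<Sum>a\<in>UNIV. \<Sum>a'\<in>UNIV. \<Sum>g\<in>rest k. (norm (cinner_vec (row_vec w a') (row_vec (slice k \<psi> (f, g)) a)))\<^sup>2))"
    unfolding c[symmetric] t[symmetric] W[symmetric]
    by (intro sum_mono symmetric_overlap_bound sym)
  also have "\<dots> = (norm w)\<^sup>2 * (norm \<psi>)\<^sup>2 + real CARD('n) * (\<Sum>r\<in>rest k \<times> rest k. \<Sum>a\<in>UNIV. \<Sum>a'\<in>UNIV.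
        (norm (cinner_vec (row_vec w a') (row_vec (slice k \<psi> r) a)))\<^sup>2)"
    unfolding sum.distrib sum_distrib_left[symmetric] P sum.cartesian_product'
    by (simp only: sum.swap[of _ "rest k" UNIV])
  finally show ?thesis
    unfolding sum_distrib_left[symmetric] sum.cartesian_product' .
qed

section \<open>Hilbert-Schmidt norm and expansions into product vectors\<close>

lemma hs_norm_eq_norm: "hs_norm X = norm X"
proof -
  have "trace (adjoint_op X ** X) = (\<Sum>i\<in>UNIV. \<Sum>j\<in>UNIV. of_real ((norm (X $ j $ i))\<^sup>2))"
    unfolding of_real_cmod_sq by (simp add: trace_def matrix_matrix_mult_def adjoint_op_def)
  also have "\<dots> = of_real (\<Sum>i\<in>UNIV. \<Sum>j\<in>UNIV. (norm (X $ j $ i))\<^sup>2)"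
    by simp
  also have "(\<Sum>i\<in>UNIV. \<Sum>j\<in>UNIV. (norm (X $ j $ i))\<^sup>2) = (norm X)\<^sup>2"
    unfolding norm_vec_sq by (rule sum.swap)
  finally show ?thesis by (simp add: hs_norm_def)
qed

lemma norm_mult_vec_le: "norm ((A :: complex^'j^'i) *v x) \<le> norm A * norm x"
proof -
  have "(norm (A *v x))\<^sup>2 \<le> (\<Sum>i\<in>UNIV. (norm (A $ i))\<^sup>2 * (norm x)\<^sup>2)"
    unfolding norm_vec_sq[of "A *v x"]
  proof (rule sum_mono)
    fix i
    have "(A *v x) $ i = cinner_vec (\<chi> j. cnj (A $ i $ j)) x"
      by (simp add: matrix_vector_mult_def cinner_vec_def)
    moreover have "norm (\<chi> j. cnj (A $ i $ j)) = norm (A $ i)"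
      by (simp add: norm_vec_def)
    ultimately have "norm ((A *v x) $ i) \<le> norm (A $ i) * norm x"
      by (metis norm_cinner_vec_le)
    then show "(norm ((A *v x) $ i))\<^sup>2 \<le> (norm (A $ i))\<^sup>2 * (norm x)\<^sup>2"
      by (metis norm_ge_zero power_mono power_mult_distrib)
  qed
  also have "\<dots> = (norm A * norm x)\<^sup>2"
    by (simp add: norm_vec_sq[of A] power_mult_distrib sum_distrib_right)
  finally show ?thesis by (rule power2_le_imp_le) simp
qed

lemma sum_norm_le_sqrt_card:
  assumes "finite S" "(\<Sum>b\<in>S. (norm (f b))\<^sup>2) \<le> c\<^sup>2" "0 \<le> c"
  shows "(\<Sum>b\<in>S. norm (f b)) \<le> sqrt (real (card S)) * c"
proof -
  have "(\<Sum>b\<in>S. norm (f b) * 1)\<^sup>2 \<le> (\<Sum>b\<in>S. (norm (f b))\<^sup>2) * (\<Sum>b\<in>S. 1\<^sup>2)"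
    by (rule Cauchy_Schwarz_ineq_sum)
  also have "\<dots> \<le> c\<^sup>2 * real (card S)"
    using assms by (simp add: mult_right_mono)
  also have "\<dots> = (sqrt (real (card S)) * c)\<^sup>2"
    by (simp add: power_mult_distrib)
  finally have "(\<Sum>b\<in>S. norm (f b) * 1) \<le> sqrt (real (card S)) * c"
    by (rule power2_le_imp_le) (simp add: assms(3))
  then show ?thesis by simp
qed

definition proj_right :: "(complex^'b) set \<Rightarrow> complex^('a::finite \<times> 'b::finite) \<Rightarrow> complex^('a \<times> 'b)"
  where "proj_right S w = (\<chi> x. proj_on S (row_vec w (fst x)) $ snd x)"

definition right_coeff :: "complex^'b \<Rightarrow> complex^('a::finite \<times> 'b::finite) \<Rightarrow> complex^'a"
  where "right_coeff b w = (\<chi> a. cinner_vec b (row_vec w a))"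

lemma proj_right_eq_sum: "proj_right S w = (\<Sum>b\<in>S. tensor_vec (right_coeff b w) b)"
  by (simp add: proj_right_def proj_on_def right_coeff_def tensor_vec_def vec_eq_iff)

lemma sum_norm_right_coeff_sq:
  assumes "orthonormal S" "finite S"
  shows "(\<Sum>b\<in>S. (norm (right_coeff b w))\<^sup>2) \<le> (norm w)\<^sup>2"
proof -
  have "(\<Sum>b\<in>S. (norm (right_coeff b w))\<^sup>2) = (\<Sum>a\<in>UNIV. \<Sum>b\<in>S. (norm (cinner_vec b (row_vec w a)))\<^sup>2)"
    unfolding norm_vec_sq right_coeff_def vec_lambda_beta by (rule sum.swap)
  also have "\<dots> \<le> (norm w)\<^sup>2"
    unfolding norm_sq_row_vec[of w] by (intro sum_mono bessel assms)
  finally show ?thesis .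
qed

text \<open>Cauchy-Schwarz and Bessel over the orthonormal set. If \<open>v\<close> belongs to it,
  its own term has no part orthogonal to \<open>v\<close> and drops out; this is the origin of the
  -1 in the first bound.\<close>

lemma decomposition_right:
  assumes "orthonormal S" "norm u = 1" "norm v = 1"
  shows "(\<Sum>b\<in>S. norm (ortho_part u (right_coeff b w)) * norm (ortho_part v b))
    \<le> sqrt (real (card (S - {v}))) * norm w"
proof -
  have fin: "finite S" using assms(1) by (rule orthonormal_card_le)
  have o: "orthonormal (S - {v})" using assms(1) by (auto simp: orthonormal_def)
  have "(\<Sum>b\<in>S. norm (ortho_part u (right_coeff b w)) * norm (ortho_part v b))
      = (\<Sum>b\<in>S - {v}. norm (ortho_part u (right_coeff b w)) * norm (ortho_part v b))"
    using fin assms(3) by (intro sum.mono_neutral_right) (auto simp: ortho_part_self)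
  also have "\<dots> \<le> (\<Sum>b\<in>S - {v}. norm (right_coeff b w) * 1)"
  proof (intro sum_mono mult_mono)
    fix b assume "b \<in> S - {v}"
    then have "norm b = 1" using assms(1) by (auto simp: orthonormal_def)
    then show "norm (ortho_part v b) \<le> 1" using norm_ortho_part_le[OF assms(3), of b] by simp
  qed (auto intro: norm_ortho_part_le assms)
  also have "\<dots> \<le> sqrt (real (card (S - {v}))) * norm w"
    using sum_norm_le_sqrt_card[OF _ sum_norm_right_coeff_sq[OF o]] fin by simp
  finally show ?thesis .
qed

definition flip_vec :: "complex^('a::finite \<times> 'b::finite) \<Rightarrow> complex^('b \<times> 'a)"
  where "flip_vec w = (\<chi> x. w $ (snd x, fst x))"

lemma flip_tensor_vec: "flip_vec (tensor_vec u v) = tensor_vec v u"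
  by (simp add: flip_vec_def tensor_vec_def vec_eq_iff mult.commute)

lemma flip_vec_sum: "flip_vec (\<Sum>i\<in>I. f i) = (\<Sum>i\<in>I. flip_vec (f i))"
  by (simp add: flip_vec_def vec_eq_iff)

lemma flip_flip_vec: "flip_vec (flip_vec w) = w"
  by (simp add: flip_vec_def vec_eq_iff)

lemma norm_flip_vec: "norm (flip_vec w) = norm w"
proof -
  have "(norm (flip_vec w))\<^sup>2 = (norm w)\<^sup>2"
    unfolding norm_vec_sq sum_UNIV_pair flip_vec_def by (subst sum.swap) simp
  then show ?thesis by (simp add: power2_eq_iff_nonneg)
qed

lemma proj_right_complete: "(\<And>x. proj_on S x = x) \<Longrightarrow> proj_right S w = w"
  by (simp add: proj_right_def row_vec_def vec_eq_iff)

lemma exists_decomposition_right: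
  fixes w :: "complex^('a::finite \<times> 'b::finite)"
  assumes u: "norm u = 1" and v: "norm v = 1"
  obtains S :: "(complex^'b) set" and \<alpha> where "finite S" "w = (\<Sum>b\<in>S. tensor_vec (\<alpha> b) b)"
    "(\<Sum>b\<in>S. norm (ortho_part u (\<alpha> b)) * norm (ortho_part v b)) \<le> sqrt (real CARD('b) - 1) * norm w"
proof -
  \<comment> \<open>The basis is taken through \<open>v\<close>, so that one of its terms
    vanishes.\<close>
  have "orthonormal {v}" using v by (simp add: orthonormal_def)
  then obtain S where S: "{v} \<subseteq> S" "orthonormal S" "\<And>x. proj_on S x = x"
    using complete_orthonormal by metis
  have "Suc (card (S - {v})) \<le> CARD('b)"
    using S(1) orthonormal_card_le[OF S(2)] by (subst card_Suc_Diff1) auto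
  then have "real (card (S - {v})) \<le> real CARD('b) - 1" by linarith
  then have "sqrt (real (card (S - {v}))) * norm w \<le> sqrt (real CARD('b) - 1) * norm w"
    by (intro mult_right_mono) simp_all
  then show ?thesis
    using decomposition_right[OF S(2) u v, of w] orthonormal_card_le(1)[OF S(2)]
      proj_right_complete[OF S(3), of w] proj_right_eq_sum[of S w]
    by (intro that[of S "\<lambda>b. right_coeff b w"]) auto
qed

lemma exists_decomposition_left:
  fixes w :: "complex^('a::finite \<times> 'b::finite)"
  assumes u: "norm u = 1" and v: "norm v = 1"
  obtains S :: "(complex^'a) set" and \<beta> where "finite S" "w = (\<Sum>a\<in>S. tensor_vec a (\<beta> a))"
    "(\<Sum>a\<in>S. norm (ortho_part u a) * norm (ortho_part v (\<beta> a))) \<le> sqrt (real CARD('a) - 1) * norm w"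
proof -
  obtain S \<beta> where S: "finite S" "flip_vec w = (\<Sum>a\<in>S. tensor_vec (\<beta> a) a)"
    "(\<Sum>a\<in>S. norm (ortho_part v (\<beta> a)) * norm (ortho_part u a)) \<le> sqrt (real CARD('a) - 1) * norm (flip_vec w)"
    using exists_decomposition_right[OF v u, of "flip_vec w"] by blast
  have w: "w = (\<Sum>a\<in>S. tensor_vec a (\<beta> a))"
    using arg_cong[OF S(2), of flip_vec] by (simp add: flip_flip_vec flip_vec_sum flip_tensor_vec)
  have "(\<Sum>a\<in>S. norm (ortho_part u a) * norm (ortho_part v (\<beta> a))) \<le> sqrt (real CARD('a) - 1) * norm w"
    using S(3) unfolding norm_flip_vec by (simp only: mult.commute)
  then show ?thesis by (rule that[OF S(1) w])
qed

subsection \<open>Distance to separable states\<close>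

lemma hermitianI:
  assumes "\<And>x y. cinner_vec x (A *v y) = cinner_vec (A *v x) y"
  shows "adjoint_op A = A"
proof -
  have "cnj (A $ j $ i) = A $ i $ j" for i j
    using assms[of "axis i 1" "axis j 1"] cinner_vec_commute[of "A *v axis i 1" "axis j 1"]
    by (simp add: cinner_vec_axis mult_axis_nth)
  then show ?thesis by (simp add: adjoint_op_def vec_eq_iff)
qed

lemma inner_pure_state:
  assumes "adjoint_op H = H"
  shows "H \<bullet> pure_state \<eta> = Re (cinner_vec \<eta> (H *v \<eta>))"
proof -
  have inner: "a \<bullet> b = Re (cnj a * b)" for a b :: complex
    by (simp add: inner_complex_def)
  have "H \<bullet> pure_state \<eta> = (\<Sum>i\<in>UNIV. \<Sum>j\<in>UNIV. Re (H $ j $ i * \<eta> $ i * cnj (\<eta> $ j)))"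
    unfolding inner_vec_def inner cnj_adjoint_nth[OF assms] pure_state_def by (simp only: vec_lambda_beta mult.assoc)
  also have "\<dots> = (\<Sum>j\<in>UNIV. \<Sum>i\<in>UNIV. Re (H $ j $ i * \<eta> $ i * cnj (\<eta> $ j)))"
    by (rule sum.swap)
  also have "\<dots> = Re (cinner_vec \<eta> (H *v \<eta>))"
    unfolding cinner_vec_def matrix_vector_mult_def vec_lambda_beta sum_distrib_left Re_sum
    by (simp add: mult_ac)
  finally show ?thesis .
qed

lemma psd_pure_state: "psd (pure_state u)"
proof -
  have "cinner_vec x (pure_state u *v x) = of_real ((norm (cinner_vec u x))\<^sup>2)" for x
    unfolding pure_state_mult_vec cinner_vec_smult_right of_real_cmod_sq
    by (subst cinner_vec_commute[of x u]) (rule mult.commute)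
  then show ?thesis by (simp add: psd_def del: of_real_power)
qed

text \<open>The supremum of an empty set of reals would carry no information, so a member is
  exhibited: the marginal of a power of a product basis vector.\<close>

lemma BEXT_nonempty:
  fixes k :: "'n::finite"
  shows "(BEXT k :: (complex^('a::finite \<times> 'b::finite)^('a \<times> 'b)) set) \<noteq> {}"
proof -
  define W where "W = tensor_space (sym_space :: (complex^('n \<Rightarrow> 'a)) set) (sym_space :: (complex^('n \<Rightarrow> 'b)) set)"
  define u where "u = (tensor_vec (power_vec (axis undefined 1)) (power_vec (axis undefined 1)) :: complex^(('n \<Rightarrow> 'a) \<times> ('n \<Rightarrow> 'b)))"
  have u: "u \<in> W" "norm u = 1"
    by (simp_all add: u_def W_def tensor_power_vec_mem norm_tensor_vec norm_power_vec_axis)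
  have "vec.subspace W" by (simp add: W_def tensor_space_def vec.subspace_span)
  then have "range (\<lambda>x. pure_state u *v x) \<subseteq> W"
    using u(1) by (auto simp: pure_state_mult_vec intro: vec.subspace_scale)
  moreover have "pure_state u \<in> density_ops"
    using psd_pure_state[of u] u(2) by (simp add: density_ops_def psd_def trace_pure_state)
  ultimately have "pure_state u \<in> density_ops_on W" by (simp add: density_ops_on_def)
  then show ?thesis by (auto simp: BEXT_def W_def)
qed

text \<open>The extension is decomposed before the trace is taken, so that each
  \<open>\<psi> i\<close> is symmetric. The mixing weights are absorbed into the norms of these
  vectors.\<close>

lemma BEXT_decomposition:
  fixes \<rho> :: "complex^('a::finite \<times> 'b::finite)^('a \<times> 'b)" and k :: "'n::finite"
  assumes "\<rho> \<in> BEXT k"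
  obtains \<psi> :: "('n \<Rightarrow> 'a) \<times> ('n \<Rightarrow> 'b) \<Rightarrow> complex^(('n \<Rightarrow> 'a) \<times> ('n \<Rightarrow> 'b))"
  where "\<And>i. \<psi> i \<in> bisym" "(\<Sum>i\<in>UNIV. (norm (\<psi> i))\<^sup>2) = 1"
    "\<rho> = (\<Sum>i\<in>UNIV. \<Sum>r\<in>rest k \<times> rest k. pure_state (slice k (\<psi> i) r))"
proof -
  define W where "W = tensor_space (sym_space :: (complex^('n \<Rightarrow> 'a)) set) (sym_space :: (complex^('n \<Rightarrow> 'b)) set)"
  obtain R where R: "R \<in> density_ops_on W" "\<rho> = marginal k R"
    using assms by (auto simp: BEXT_def W_def)
  have "psd R" "range (\<lambda>x. R *v x) \<subseteq> W" "trace R = 1"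
    using R(1) by (auto simp: density_ops_on_def density_ops_def psd_def)
  moreover have "vec.subspace W" by (simp add: W_def tensor_space_def vec.subspace_span)
  ultimately obtain \<psi> where \<psi>: "\<And>i. \<psi> i \<in> W" "R = (\<Sum>i\<in>(UNIV :: (('n \<Rightarrow> 'a) \<times> ('n \<Rightarrow> 'b)) set). pure_state (\<psi> i))"
    using psd_eq_sum_pure_state by metis
  have "of_real (\<Sum>i\<in>UNIV. (norm (\<psi> i))\<^sup>2) = (1 :: complex)"
    using \<open>trace R = 1\<close> unfolding \<psi>(2) trace_sum trace_pure_state of_real_sum .
  then have "(\<Sum>i\<in>UNIV. (norm (\<psi> i))\<^sup>2) = 1" by (simp only: of_real_eq_1_iff)
  moreover have "\<psi> i \<in> bisym" for i
    using \<psi>(1) tensor_space_sym_subset_bisym unfolding W_def by blast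
  ultimately show ?thesis
    using R(2) unfolding \<psi>(2) marginal_sum marginal_pure_state by (intro that[of \<psi>])
qed

lemma tensor_op_pure_state: "tensor_op (pure_state u) (pure_state v) = pure_state (tensor_vec u v)"
  by (simp add: tensor_op_def pure_state_def tensor_vec_def vec_eq_iff mult_ac)

lemma SEP_alt: "SEP = convex hull ((\<lambda>p. pure_state (tensor_vec (fst p) (snd p))) ` (sphere 0 1 \<times> sphere 0 1))"
  unfolding SEP_def tensor_op_pure_state by (rule arg_cong[of _ _ "\<lambda>S. convex hull S"]) force

lemma compact_SEP: "compact (SEP :: (complex^('a::finite \<times> 'b::finite)^('a \<times> 'b)) set)"
  unfolding SEP_alt pure_state_def tensor_vec_def vec_lambda_beta
  by (intro compact_convex_hull compact_continuous_image compact_Times compact_sphere continuous_intros)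

lemma convex_SEP: "convex SEP"
  unfolding SEP_def by (rule convex_convex_hull)

lemma pure_tensor_in_SEP: "norm u = 1 \<Longrightarrow> norm v = 1 \<Longrightarrow> pure_state (tensor_vec u v) \<in> SEP"
  unfolding SEP_alt by (rule hull_inc) force

lemma SEP_hermitian_trace:
  assumes "\<sigma> \<in> SEP"
  shows "adjoint_op \<sigma> = \<sigma>" "trace \<sigma> = 1"
proof -
  have "SEP \<subseteq> {\<sigma> :: complex^('a \<times> 'b)^('a \<times> 'b). adjoint_op \<sigma> = \<sigma> \<and> trace \<sigma> = 1}"
    unfolding SEP_alt
  proof (rule hull_minimal)
    show "convex {\<sigma> :: complex^('a \<times> 'b)^('a \<times> 'b). adjoint_op \<sigma> = \<sigma> \<and> trace \<sigma> = 1}"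
    proof (rule convexI)
      fix x y :: "complex^('a \<times> 'b)^('a \<times> 'b)" and s t :: real
      assume xy: "x \<in> {\<sigma>. adjoint_op \<sigma> = \<sigma> \<and> trace \<sigma> = 1}" "y \<in> {\<sigma>. adjoint_op \<sigma> = \<sigma> \<and> trace \<sigma> = 1}"
        and st: "s + t = 1"
      have "trace (s *\<^sub>R x + t *\<^sub>R y) = of_real s * trace x + of_real t * trace y"
        by (simp add: trace_def sum.distrib sum_distrib_left scaleR_conv_of_real[where 'a = complex])
      also have "\<dots> = of_real (s + t)" using xy by simp
      finally have "trace (s *\<^sub>R x + t *\<^sub>R y) = 1" using st by simp
      moreover have "adjoint_op (s *\<^sub>R x + t *\<^sub>R y) = s *\<^sub>R adjoint_op x + t *\<^sub>R adjoint_op y"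
        by (simp add: adjoint_op_def vec_eq_iff)
      ultimately show "s *\<^sub>R x + t *\<^sub>R y \<in> {\<sigma>. adjoint_op \<sigma> = \<sigma> \<and> trace \<sigma> = 1}" using xy by simp
    qed
  qed (auto simp: trace_pure_state norm_tensor_vec)
  then show "adjoint_op \<sigma> = \<sigma>" "trace \<sigma> = 1" using assms by auto
qed

lemma hform_le_sqrt_dim:
  fixes H :: "complex^('a::finite \<times> 'b::finite)^('a \<times> 'b)" and k :: "'n::finite"
  assumes H: "adjoint_op H = H"
    and sep: "\<And>u v. norm u = 1 \<Longrightarrow> norm v = 1 \<Longrightarrow> Re (cinner_vec (tensor_vec u v) (H *v tensor_vec u v)) \<le> s"
    and \<phi>: "\<phi> \<in> bisym"
  shows "Re (hform k H \<phi> \<phi>) \<le> (s + sqrt (real (min CARD('a) CARD('b)) - 1) * norm H / real CARD('n)) * (norm \<phi>)\<^sup>2"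
proof -
  have nH: "sqrt d * norm (H *v tensor_vec u v) \<le> sqrt d * norm H" if "norm u = 1" "norm v = 1" "0 \<le> d" for u v d
    using norm_mult_vec_le[of H "tensor_vec u v"] that by (intro mult_left_mono) (simp_all add: norm_tensor_vec)
  have pos: "0 \<le> real CARD('a) - 1" "0 \<le> real CARD('b) - 1"
    using zero_less_card_finite[where 'a = 'a] zero_less_card_finite[where 'a = 'b] by linarith+
  show ?thesis
  \<comment> \<open>The expansion runs over a basis of the smaller factor.\<close>
  proof (cases "CARD('b) \<le> CARD('a)")
    case True
    then have m: "min CARD('a) CARD('b) = CARD('b)" by (rule min_absorb2)
    have dec: "\<exists>(J :: (complex^'b) set) \<alpha> \<beta>. finite J \<and>
      H *v tensor_vec u v = (\<Sum>j\<in>J. tensor_vec (\<alpha> j) (\<beta> j)) \<and>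
      (\<Sum>j\<in>J. norm (ortho_part u (\<alpha> j)) * norm (ortho_part v (\<beta> j))) \<le> sqrt (real CARD('b) - 1) * norm H"
      if u: "norm u = 1" and v: "norm v = 1" for u v
    proof -
      obtain S :: "(complex^'b) set" and \<alpha> where "finite S" "H *v tensor_vec u v = (\<Sum>b\<in>S. tensor_vec (\<alpha> b) b)"
        "(\<Sum>b\<in>S. norm (ortho_part u (\<alpha> b)) * norm (ortho_part v b)) \<le> sqrt (real CARD('b) - 1) * norm (H *v tensor_vec u v)"
        using exists_decomposition_right[OF u v] by blast
      with nH[OF u v pos(2)] show ?thesis
        by (intro exI[of _ S] exI[of _ \<alpha>] exI[of _ "\<lambda>b. b"] conjI) (assumption | erule order_trans)+
    qed
    show ?thesis unfolding m by (rule compression_bound[OF H sep dec \<phi>])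
  next
    case False
    then have m: "min CARD('a) CARD('b) = CARD('a)" by (intro min_absorb1) linarith
    have dec: "\<exists>(J :: (complex^'a) set) \<alpha> \<beta>. finite J \<and>
      H *v tensor_vec u v = (\<Sum>j\<in>J. tensor_vec (\<alpha> j) (\<beta> j)) \<and>
      (\<Sum>j\<in>J. norm (ortho_part u (\<alpha> j)) * norm (ortho_part v (\<beta> j))) \<le> sqrt (real CARD('a) - 1) * norm H"
      if u: "norm u = 1" and v: "norm v = 1" for u v
    proof -
      obtain S :: "(complex^'a) set" and \<beta> where "finite S" "H *v tensor_vec u v = (\<Sum>a\<in>S. tensor_vec a (\<beta> a))"
        "(\<Sum>a\<in>S. norm (ortho_part u a) * norm (ortho_part v (\<beta> a))) \<le> sqrt (real CARD('a) - 1) * norm (H *v tensor_vec u v)"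
        using exists_decomposition_left[OF u v] by blast
      with nH[OF u v pos(1)] show ?thesis
        by (intro exI[of _ S] exI[of _ "\<lambda>a. a"] exI[of _ \<beta>] conjI) (assumption | erule order_trans)+
    qed
    show ?thesis unfolding m by (rule compression_bound[OF H sep dec \<phi>])
  qed
qed

section \<open>Truncating the right factor\<close>

text \<open>For an orthonormal set this is the identity tensored with the orthogonal projection onto
  the span of \<open>S\<close>, as a matrix, so that the compression of \<open>H\<close> is again an
  operator to which the compression bound applies.\<close>

definition proj_mat :: "(complex^'b) set \<Rightarrow> complex^('a::finite \<times> 'b::finite)^('a \<times> 'b)"
  where "proj_mat S = (\<chi> x y. if fst x = fst y then \<Sum>b\<in>S. b $ snd x * cnj (b $ snd y) else 0)"

lemma proj_mat_mult: "proj_mat S *v w = proj_right S w"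
proof -
  have "(proj_mat S *v w) $ x = proj_right S w $ x" for x
  proof -
    have "(proj_mat S *v w) $ x = (\<Sum>a\<in>UNIV. if fst x = a then \<Sum>c\<in>UNIV. (\<Sum>b\<in>S. b $ snd x * cnj (b $ c)) * w $ (a, c) else 0)"
      unfolding matrix_vector_mult_def proj_mat_def vec_lambda_beta sum_UNIV_pair
      by (rule sum.cong) auto
    also have "\<dots> = (\<Sum>c\<in>UNIV. \<Sum>b\<in>S. b $ snd x * cnj (b $ c) * w $ (fst x, c))"
      by (simp add: sum_distrib_right)
    also have "\<dots> = (\<Sum>b\<in>S. \<Sum>c\<in>UNIV. b $ snd x * cnj (b $ c) * w $ (fst x, c))"
      by (rule sum.swap)
    also have "\<dots> = proj_right S w $ x"
      by (simp add: proj_right_def proj_on_def cinner_vec_def row_vec_def sum_distrib_left sum_distrib_right mult_ac)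
    finally show ?thesis .
  qed
  then show ?thesis by (simp add: vec_eq_iff)
qed

lemma row_vec_proj_right: "row_vec (proj_right S w) a = proj_on S (row_vec w a)"
  by (simp add: row_vec_def proj_right_def vec_eq_iff)

lemma row_vec_diff: "row_vec (w - w') a = row_vec w a - row_vec w' a"
  by (simp add: row_vec_def vec_eq_iff)

lemma cinner_vec_rows: "cinner_vec x y = (\<Sum>a\<in>UNIV. cinner_vec (row_vec x a) (row_vec y a))"
  by (simp add: cinner_vec_def sum_UNIV_pair row_vec_def)

lemma cinner_proj_on_commute: "cinner_vec (proj_on S x) y = cinner_vec x (proj_on S y)"
proof -
  have "cnj (cinner_vec b x) * cinner_vec b y = cinner_vec b y * cinner_vec x b" for b
    using cinner_vec_commute[of x b] by simp
  then show ?thesis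
    unfolding proj_on_def cinner_vec_sum_left cinner_vec_sum_right cinner_vec_smult_left cinner_vec_smult_right
    by (intro sum.cong refl)
qed

lemma cinner_proj_right_commute: "cinner_vec (proj_right S x) y = cinner_vec x (proj_right S y)"
  unfolding cinner_vec_rows row_vec_proj_right cinner_proj_on_commute ..

lemma norm_proj_right:
  assumes "orthonormal S" "finite S"
  shows "norm (proj_right S w) \<le> norm w" "norm (w - proj_right S w) \<le> norm w"
proof -
  have *: "(norm w)\<^sup>2 = (norm (proj_right S w))\<^sup>2 + (norm (w - proj_right S w))\<^sup>2"
    unfolding norm_sq_row_vec row_vec_diff row_vec_proj_right sum.distrib[symmetric]
    by (intro sum.cong refl norm_proj_on_pythagoras assms)
  show "norm (proj_right S w) \<le> norm w" "norm (w - proj_right S w) \<le> norm w"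
    by (rule power2_le_imp_le; simp add: *)+
qed

lemma proj_right_tensor: "proj_right S (tensor_vec u v) = tensor_vec u (proj_on S v)"
proof -
  have r: "row_vec (tensor_vec u v) a = u $ a *s v" for a
    by (simp add: row_vec_def tensor_vec_def vec_eq_iff)
  show ?thesis
    unfolding proj_right_def r
    by (simp add: vec_eq_iff proj_on_def cinner_vec_smult_right)
       (simp add: tensor_vec_def sum_distrib_left mult_ac)
qed

lemma matrix_vector_mult_eq_sum_columns: "(A :: complex^'j^'i) *v x = (\<Sum>j\<in>UNIV. x $ j *s (A *v axis j 1))"
proof -
  have "(A *v x) $ i = (\<Sum>j\<in>UNIV. x $ j *s (A *v axis j 1)) $ i" for i
    unfolding sum_component vector_smult_component mult_axis_nth
    by (simp add: matrix_vector_mult_def mult.commute)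
  then show ?thesis by (simp add: vec_eq_iff)
qed

text \<open>The projection is moved onto the columns of \<open>H\<close>, whose remainders
  \<open>w y\<close> are orthogonal to \<open>S\<close> in the right factor and hence have small
  weight on the family \<open>\<eta>\<close>. Cauchy-Schwarz over the pairs of member and column
  then produces the Hilbert-Schmidt norm of \<open>H\<close>.\<close>

lemma cross_term_bound:
  fixes H :: "complex^('a::finite \<times> 'b::finite)^('a \<times> 'b)"
  assumes S: "orthonormal S" "finite S" and "finite K" "0 \<le> C"
    and \<eta>: "\<And>w. (\<And>a b. b \<in> S \<Longrightarrow> cinner_vec b (row_vec w a) = 0) \<Longrightarrow>
      (\<Sum>j\<in>K. (norm (cinner_vec w (\<eta> j)))\<^sup>2) \<le> C\<^sup>2 * (norm w)\<^sup>2"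
    and \<xi>: "(\<Sum>j\<in>K. (norm (\<xi> j))\<^sup>2) \<le> 1"
  shows "norm (\<Sum>j\<in>K. cinner_vec (\<eta> j - proj_right S (\<eta> j)) (H *v \<xi> j)) \<le> C * norm H"
proof -
  define h where "h y = H *v axis y 1" for y
  define w where "w y = h y - proj_right S (h y)" for y
  have w: "(\<Sum>j\<in>K. (norm (cinner_vec (w y) (\<eta> j)))\<^sup>2) \<le> C\<^sup>2 * (norm (w y))\<^sup>2" for y
    by (rule \<eta>) (simp add: w_def row_vec_diff row_vec_proj_right cinner_vec_diff_right cinner_proj_on[OF S])
  have e: "cinner_vec (\<eta> j - proj_right S (\<eta> j)) (H *v \<xi> j) = (\<Sum>y\<in>UNIV. \<xi> j $ y * cinner_vec (\<eta> j) (w y))" for j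
    by (subst matrix_vector_mult_eq_sum_columns)
       (simp add: cinner_vec_sum_right cinner_vec_smult_right w_def cinner_vec_diff_left cinner_vec_diff_right
         cinner_proj_right_commute flip: h_def)
  have "norm (\<Sum>j\<in>K. cinner_vec (\<eta> j - proj_right S (\<eta> j)) (H *v \<xi> j))
      \<le> (\<Sum>j\<in>K. \<Sum>y\<in>UNIV. norm (\<xi> j $ y) * norm (cinner_vec (w y) (\<eta> j)))"
    unfolding e
  proof (intro sum_norm_le)
    fix j y
    show "norm (\<xi> j $ y * cinner_vec (\<eta> j) (w y)) \<le> norm (\<xi> j $ y) * norm (cinner_vec (w y) (\<eta> j))"
      unfolding norm_mult by (subst cinner_vec_commute) simp
  qed
  also have "\<dots> = (\<Sum>p\<in>K \<times> UNIV. norm (\<xi> (fst p) $ snd p) * norm (cinner_vec (w (snd p)) (\<eta> (fst p))))"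
    by (simp add: sum.cartesian_product')
  finally have 1: "norm (\<Sum>j\<in>K. cinner_vec (\<eta> j - proj_right S (\<eta> j)) (H *v \<xi> j))
    \<le> (\<Sum>p\<in>K \<times> UNIV. norm (\<xi> (fst p) $ snd p) * norm (cinner_vec (w (snd p)) (\<eta> (fst p))))" .
  have "(norm (\<Sum>j\<in>K. cinner_vec (\<eta> j - proj_right S (\<eta> j)) (H *v \<xi> j)))\<^sup>2
      \<le> (\<Sum>p\<in>K \<times> UNIV. norm (\<xi> (fst p) $ snd p) * norm (cinner_vec (w (snd p)) (\<eta> (fst p))))\<^sup>2"
    using 1 by (rule power_mono) simp
  also have "\<dots> \<le> (\<Sum>p\<in>K \<times> UNIV. (norm (\<xi> (fst p) $ snd p))\<^sup>2)
      * (\<Sum>p\<in>K \<times> UNIV. (norm (cinner_vec (w (snd p)) (\<eta> (fst p))))\<^sup>2)"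
    by (rule Cauchy_Schwarz_ineq_sum)
  also have "\<dots> \<le> 1 * (C\<^sup>2 * (norm H)\<^sup>2)"
  proof (rule mult_mono)
    show "(\<Sum>p\<in>K \<times> UNIV. (norm (\<xi> (fst p) $ snd p))\<^sup>2) \<le> 1"
      using \<xi> by (simp add: sum.cartesian_product' norm_vec_sq)
    have "(\<Sum>p\<in>K \<times> UNIV. (norm (cinner_vec (w (snd p)) (\<eta> (fst p))))\<^sup>2)
        = (\<Sum>y\<in>UNIV. \<Sum>j\<in>K. (norm (cinner_vec (w y) (\<eta> j)))\<^sup>2)"
      unfolding sum.cartesian_product' fst_conv snd_conv by (rule sum.swap)
    also have "\<dots> \<le> (\<Sum>y\<in>UNIV. C\<^sup>2 * (norm (h y))\<^sup>2)"
    proof (rule sum_mono)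
      fix y
      have "(norm (w y))\<^sup>2 \<le> (norm (h y))\<^sup>2"
        unfolding w_def by (intro power_mono norm_proj_right S norm_ge_zero)
      then show "(\<Sum>j\<in>K. (norm (cinner_vec (w y) (\<eta> j)))\<^sup>2) \<le> C\<^sup>2 * (norm (h y))\<^sup>2"
        using w[of y] by (meson mult_left_mono order_trans zero_le_power2)
    qed
    also have "\<dots> = C\<^sup>2 * (\<Sum>y\<in>UNIV. \<Sum>x\<in>UNIV. (norm (H $ x $ y))\<^sup>2)"
      by (simp add: sum_distrib_left norm_vec_sq h_def mult_axis_nth)
    also have "\<dots> = C\<^sup>2 * (norm H)\<^sup>2"
      unfolding norm_vec_sq[of H] norm_vec_sq[of "H $ _"] by (subst sum.swap) (rule refl)
    finally show "(\<Sum>p\<in>K \<times> UNIV. (norm (cinner_vec (w (snd p)) (\<eta> (fst p))))\<^sup>2) \<le> C\<^sup>2 * (norm H)\<^sup>2" .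
  qed (simp_all add: sum_nonneg)
  finally have "(norm (\<Sum>j\<in>K. cinner_vec (\<eta> j - proj_right S (\<eta> j)) (H *v \<xi> j)))\<^sup>2 \<le> (C * norm H)\<^sup>2"
    by (simp add: power_mult_distrib)
  then show ?thesis by (rule power2_le_imp_le) (simp add: assms(4))
qed

text \<open>For the compression of \<open>H\<close> to the range of a projection on the right factor, the vector
  \<open>H (u \<otimes> v)\<close> has tensor rank at most the rank of the projection, whatever \<open>u\<close> and \<open>v\<close> are.\<close>

lemma hform_compressed_le:
  fixes H :: "complex^('a::finite \<times> 'b::finite)^('a \<times> 'b)" and k :: "'n::finite"
  assumes H: "adjoint_op H = H" and S: "orthonormal S" and s: "0 \<le> s"
    and sep: "\<And>u v. norm u = 1 \<Longrightarrow> norm v = 1 \<Longrightarrow> Re (cinner_vec (tensor_vec u v) (H *v tensor_vec u v)) \<le> s"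
    and \<phi>: "\<phi> \<in> bisym"
  shows "(\<Sum>r\<in>rest k \<times> rest k. Re (cinner_vec (proj_right S (slice k \<phi> r)) (H *v proj_right S (slice k \<phi> r))))
    \<le> (s + sqrt (real (card S)) * norm H / real CARD('n)) * (norm \<phi>)\<^sup>2"
proof -
  have fin: "finite S" using S by (rule orthonormal_card_le)
  define G where "G = proj_mat S ** H ** proj_mat S"
  have G: "G *v w = proj_right S (H *v proj_right S w)" for w
    by (simp add: G_def proj_mat_mult flip: matrix_vector_mul_assoc)
  have qG: "cinner_vec x (G *v y) = cinner_vec (proj_right S x) (H *v proj_right S y)" for x y
    by (simp add: G cinner_proj_right_commute)
  have "cinner_vec x (G *v y) = cinner_vec (G *v x) y" for x y
    unfolding qG cinner_vec_hermitian[OF H] by (simp add: G cinner_proj_right_commute)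
  then have adj: "adjoint_op G = G" by (rule hermitianI)
  have sepG: "Re (cinner_vec (tensor_vec u v) (G *v tensor_vec u v)) \<le> s" if u: "norm u = 1" and v: "norm v = 1" for u v
  proof -
    obtain v' where v': "norm v' = 1" "proj_on S v = of_real (norm (proj_on S v)) *s v'"
      by (rule exists_unit_direction)
    define c where "c = norm (proj_on S v)"
    have "c\<^sup>2 \<le> 1"
      using norm_proj_on_pythagoras[OF S fin, of v, unfolded v] zero_le_power2[of "norm (v - proj_on S v)"]
      unfolding c_def power_one by linarith
    have p: "proj_right S (tensor_vec u v) = of_real c *s tensor_vec u v'"
      using v'(2) by (simp add: proj_right_tensor c_def flip: tensor_vec_smult_right)
    have "cinner_vec (tensor_vec u v) (G *v tensor_vec u v)
        = of_real (c\<^sup>2) * cinner_vec (tensor_vec u v') (H *v tensor_vec u v')"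
      unfolding qG p by (simp add: vector_scalar_commute cinner_vec_smult_left cinner_vec_smult_right power2_eq_square)
    then have "Re (cinner_vec (tensor_vec u v) (G *v tensor_vec u v))
        = c\<^sup>2 * Re (cinner_vec (tensor_vec u v') (H *v tensor_vec u v'))"
      by (simp only: Re_of_real_mult)
    also have "\<dots> \<le> c\<^sup>2 * s" using sep[OF u v'(1)] by (intro mult_left_mono) simp_all
    \<comment> \<open>Projecting keeps a product vector a product but may shorten it, so its form is
      scaled by a number in [0, 1]. The bound survives because \<open>s\<close> is
      nonnegative.\<close>
    also have "\<dots> \<le> s" using \<open>c\<^sup>2 \<le> 1\<close> s by (rule mult_left_le_one_le[rotated 2]) simp
    finally show ?thesis .
  qed
  have dec: "\<exists>(J :: (complex^'b) set) \<alpha> \<beta>. finite J \<and>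
      G *v tensor_vec u v = (\<Sum>j\<in>J. tensor_vec (\<alpha> j) (\<beta> j)) \<and>
      (\<Sum>j\<in>J. norm (ortho_part u (\<alpha> j)) * norm (ortho_part v (\<beta> j))) \<le> sqrt (real (card S)) * norm H"
    if u: "norm u = 1" and v: "norm v = 1" for u v
  proof -
    define w where "w = H *v proj_right S (tensor_vec u v)"
    have "norm w \<le> norm H * norm (proj_right S (tensor_vec u v))"
      unfolding w_def by (rule norm_mult_vec_le)
    also have "\<dots> \<le> norm H * 1"
      using norm_proj_right(1)[OF S fin, of "tensor_vec u v"] u v by (intro mult_left_mono) (simp_all add: norm_tensor_vec)
    finally have w: "norm w \<le> norm H" by simp
    have "card (S - {v}) \<le> card S" using fin by (simp add: card_Diff1_le)
    then have "sqrt (real (card (S - {v}))) * norm w \<le> sqrt (real (card S)) * norm H"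
      using w by (intro mult_mono) simp_all
    then show ?thesis
      using decomposition_right[OF S u v, of w] proj_right_eq_sum[of S w] fin
      by (intro exI[of _ S] exI[of _ "\<lambda>b. right_coeff b w"] exI[of _ "\<lambda>b. b"]) (simp add: G w_def)
  qed
  have "(\<Sum>r\<in>rest k \<times> rest k. Re (cinner_vec (proj_right S (slice k \<phi> r)) (H *v proj_right S (slice k \<phi> r))))
      = Re (hform k G \<phi> \<phi>)"
    by (simp add: hform_def qG)
  also have "\<dots> \<le> (s + sqrt (real (card S)) * norm H / real CARD('n)) * (norm \<phi>)\<^sup>2"
    by (rule compression_bound[OF adj sepG dec \<phi>])
  finally show ?thesis .
qed

text \<open>\<open>S\<close> spans the directions of the right factor that carry marginal weight more than \<open>1 / (2 n)\<close>.\<close>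

lemma heavy_directions:
  fixes \<psi> :: "'i::finite \<Rightarrow> complex^(('n::finite \<Rightarrow> 'a::finite) \<times> ('n \<Rightarrow> 'b::finite))"
  assumes \<psi>: "\<And>i. \<psi> i \<in> bisym" and one: "(\<Sum>i\<in>UNIV. (norm (\<psi> i))\<^sup>2) = 1"
  obtains S where "orthonormal S" "real (card S) \<le> 2 * real CARD('n) - 1"
    "\<And>w. (\<And>a b. b \<in> S \<Longrightarrow> cinner_vec b (row_vec w a) = 0) \<Longrightarrow>
      (\<Sum>p\<in>UNIV \<times> (rest k \<times> rest k). (norm (cinner_vec w (slice k (\<psi> (fst p)) (snd p))))\<^sup>2)
        \<le> (sqrt (3 / (2 * real CARD('n))))\<^sup>2 * (norm w)\<^sup>2"
proof -
  let ?R = "rest k \<times> rest k :: (('n \<Rightarrow> 'a) \<times> ('n \<Rightarrow> 'b)) set"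
  define N where "N = real CARD('n)"
  have N: "N \<ge> 1" by (simp add: N_def Suc_leI)
  \<comment> \<open>\<open>m x\<close> is the quadratic form at \<open>x\<close> of the marginal
    state on the right factor labelled \<open>k\<close>.\<close>
  define m where "m x = (\<Sum>i\<in>UNIV. \<Sum>r\<in>?R. \<Sum>a\<in>UNIV. (norm (cinner_vec x (row_vec (slice k (\<psi> i) r) a)))\<^sup>2)" for x
  obtain S where S: "orthonormal S" and heavy: "\<forall>b\<in>S. m b > 1 / (2 * N)"
    and light: "\<And>x. norm x = 1 \<Longrightarrow> (\<forall>b\<in>S. cinner_vec b x = 0) \<Longrightarrow> \<not> m x > 1 / (2 * N)"
    by (rule maximal_orthonormal[of "{}" "\<lambda>b. m b > 1 / (2 * N)"]) (auto simp: orthonormal_def)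
  have fin: "finite S" using S by (rule orthonormal_card_le)
  have "(\<Sum>b\<in>S. m b) = (\<Sum>i\<in>UNIV. \<Sum>r\<in>?R. \<Sum>a\<in>UNIV. \<Sum>b\<in>S. (norm (cinner_vec b (row_vec (slice k (\<psi> i) r) a)))\<^sup>2)"
    unfolding m_def by (simp only: sum.swap[of _ _ S])
  also have "\<dots> \<le> (\<Sum>i\<in>UNIV. \<Sum>r\<in>?R. \<Sum>a\<in>UNIV. (norm (row_vec (slice k (\<psi> i) r) a))\<^sup>2)"
    by (intro sum_mono bessel S fin)
  also have "\<dots> = 1"
    unfolding norm_sq_row_vec[symmetric] norm_slices_sq[symmetric] by (rule one)
  finally have m1: "(\<Sum>b\<in>S. m b) \<le> 1" .
  \<comment> \<open>The weights exceed \<open>1 / (2 * N)\<close> strictly and add up to at most 1.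
    Strictness yields \<open>2 * n - 1\<close>, the number under the root; it requires a nonempty
    sum, hence the case distinction.\<close>
  have "card S < 2 * CARD('n)"
  proof (cases "S = {}")
    case False
    then have "real (card S) * (1 / (2 * N)) < (\<Sum>b\<in>S. m b)"
      using sum_strict_mono[OF fin False, of "\<lambda>_. 1 / (2 * N)" m] heavy by simp
    then have "real (card S) * (1 / (2 * N)) < 1" using m1 by linarith
    then have "real (card S) < 2 * N" using N by (simp add: field_simps)
    then show ?thesis by (simp add: N_def)
  qed simp
  then have card: "real (card S) \<le> 2 * real CARD('n) - 1" by linarith
  have tail: "m x \<le> (norm x)\<^sup>2 / (2 * N)" if x: "\<forall>b\<in>S. cinner_vec b x = 0" for x
  proof (cases "x = 0")
    case False
    obtain x' where x': "norm x' = 1" "x = of_real (norm x) *s x'" by (rule exists_unit_direction)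
    have "cinner_vec b x = of_real (norm x) * cinner_vec b x'" for b
      by (subst x'(2)) (rule cinner_vec_smult_right)
    then have "\<forall>b\<in>S. cinner_vec b x' = 0" using x False by simp
    then have "m x' \<le> 1 / (2 * N)" using light[OF x'(1)] by simp
    moreover have "m x = (norm x)\<^sup>2 * m x'"
    proof -
      have "cinner_vec x z = of_real (norm x) * cinner_vec x' z" for z
        by (subst x'(2)) (simp add: cinner_vec_smult_left)
      then show ?thesis by (simp add: m_def norm_mult power_mult_distrib sum_distrib_left)
    qed
    ultimately show ?thesis using mult_left_mono[of "m x'" "1 / (2 * N)" "(norm x)\<^sup>2"] by simp
  qed (simp add: m_def)
  have "(\<Sum>p\<in>UNIV \<times> (rest k \<times> rest k). (norm (cinner_vec w (slice k (\<psi> (fst p)) (snd p))))\<^sup>2)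
        \<le> (sqrt (3 / (2 * real CARD('n))))\<^sup>2 * (norm w)\<^sup>2"
    if w: "\<And>a b. b \<in> S \<Longrightarrow> cinner_vec b (row_vec w a) = 0" for w
  proof -
    define T where "T = (\<Sum>p\<in>UNIV \<times> ?R. (norm (cinner_vec w (slice k (\<psi> (fst p)) (snd p))))\<^sup>2)"
    have "N * T = (\<Sum>i\<in>UNIV. N * (\<Sum>r\<in>?R. (norm (cinner_vec w (slice k (\<psi> i) r)))\<^sup>2))"
      unfolding T_def sum.cartesian_product'[of _ UNIV] by (simp add: sum_distrib_left)
    also have "\<dots> \<le> (\<Sum>i\<in>UNIV. (norm w)\<^sup>2 * (norm (\<psi> i))\<^sup>2 + N * (\<Sum>r\<in>?R. \<Sum>a\<in>UNIV. \<Sum>a'\<in>UNIV.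
        (norm (cinner_vec (row_vec w a') (row_vec (slice k (\<psi> i) r) a)))\<^sup>2))"
      unfolding N_def by (intro sum_mono overlap_bound \<psi>)
    also have "\<dots> = (norm w)\<^sup>2 + N * (\<Sum>a'\<in>UNIV. m (row_vec w a'))"
    proof -
      have "(\<Sum>i\<in>UNIV. \<Sum>r\<in>?R. \<Sum>a\<in>UNIV. \<Sum>a'\<in>UNIV. (norm (cinner_vec (row_vec w a') (row_vec (slice k (\<psi> i) r) a)))\<^sup>2)
          = (\<Sum>a'\<in>UNIV. m (row_vec w a'))"
      proof -
        have "(\<Sum>a'\<in>UNIV. m (row_vec w a'))
            = (\<Sum>i\<in>UNIV. \<Sum>a'\<in>UNIV. \<Sum>r\<in>?R. \<Sum>a\<in>UNIV. (norm (cinner_vec (row_vec w a') (row_vec (slice k (\<psi> i) r) a)))\<^sup>2)"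
          unfolding m_def by (rule sum.swap)
        also have "\<dots> = (\<Sum>i\<in>UNIV. \<Sum>r\<in>?R. \<Sum>a'\<in>UNIV. \<Sum>a\<in>UNIV. (norm (cinner_vec (row_vec w a') (row_vec (slice k (\<psi> i) r) a)))\<^sup>2)"
          by (intro sum.cong refl sum.swap)
        also have "\<dots> = (\<Sum>i\<in>UNIV. \<Sum>r\<in>?R. \<Sum>a\<in>UNIV. \<Sum>a'\<in>UNIV. (norm (cinner_vec (row_vec w a') (row_vec (slice k (\<psi> i) r) a)))\<^sup>2)"
          by (intro sum.cong refl sum.swap)
        finally show ?thesis by simp
      qed
      then show ?thesis by (simp add: sum.distrib one flip: sum_distrib_left)
    qed
    also have "\<dots> \<le> (norm w)\<^sup>2 + N * (\<Sum>a'\<in>UNIV. (norm (row_vec w a'))\<^sup>2 / (2 * N))"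
      using N w by (intro add_left_mono mult_left_mono sum_mono tail) auto
    also have "\<dots> = (norm w)\<^sup>2 + (norm w)\<^sup>2 / 2"
      unfolding sum_divide_distrib[symmetric] norm_sq_row_vec[symmetric] using N by simp
    \<comment> \<open>The factor 3/2 is 1 from the overlap bound plus 1/2 from the light
      directions.\<close>
    finally have "T \<le> 3 / (2 * N) * (norm w)\<^sup>2" using N by (simp add: field_simps)
    then show ?thesis using N by (simp add: T_def N_def)
  qed
  then show ?thesis by (rule that[OF S card])
qed

text \<open>Each slice is split into its projection and the rest. The projected part is governed by
  the compression bound with at most 2 n - 1 directions, and each of the two remaining terms by the
  small weight of the light directions.\<close>

lemma hform_sum_le_sqrt:
  fixes H :: "complex^('a::finite \<times> 'b::finite)^('a \<times> 'b)" and k :: "'n::finite"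
    and \<psi> :: "'i::finite \<Rightarrow> complex^(('n \<Rightarrow> 'a) \<times> ('n \<Rightarrow> 'b))"
  assumes H: "adjoint_op H = H" and s: "0 \<le> s"
    and sep: "\<And>u v. norm u = 1 \<Longrightarrow> norm v = 1 \<Longrightarrow> Re (cinner_vec (tensor_vec u v) (H *v tensor_vec u v)) \<le> s"
    and \<psi>: "\<And>i. \<psi> i \<in> bisym" and one: "(\<Sum>i\<in>UNIV. (norm (\<psi> i))\<^sup>2) = 1"
  shows "(\<Sum>i\<in>UNIV. Re (hform k H (\<psi> i) (\<psi> i))) \<le> s + 8 * sqrt (2 * real CARD('n) - 1) / real CARD('n) * norm H"
proof -
  define N where "N = real CARD('n)"
  have N: "N \<ge> 1" by (simp add: N_def Suc_leI)
  define C where "C = sqrt (3 / (2 * N))"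
  have C: "0 \<le> C" using N by (simp add: C_def)
  obtain S where S: "orthonormal S" "real (card S) \<le> 2 * N - 1"
    and tail: "\<And>w. (\<And>a b. b \<in> S \<Longrightarrow> cinner_vec b (row_vec w a) = 0) \<Longrightarrow>
      (\<Sum>p\<in>UNIV \<times> (rest k \<times> rest k). (norm (cinner_vec w (slice k (\<psi> (fst p)) (snd p))))\<^sup>2) \<le> C\<^sup>2 * (norm w)\<^sup>2"
    using heavy_directions[OF \<psi> one, of k] unfolding N_def C_def by blast
  have fin: "finite S" using S(1) by (rule orthonormal_card_le)
  let ?K = "UNIV \<times> (rest k \<times> rest k) :: ('i \<times> (('n \<Rightarrow> 'a) \<times> ('n \<Rightarrow> 'b))) set"
  define \<eta> where "\<eta> p = slice k (\<psi> (fst p)) (snd p)" for p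
  define e where "e p = proj_right S (\<eta> p)" for p
  have \<eta>1: "(\<Sum>p\<in>?K. (norm (\<eta> p))\<^sup>2) \<le> 1"
    unfolding \<eta>_def sum.cartesian_product'[of _ UNIV] fst_conv snd_conv norm_slices_sq[symmetric] one ..
  have e1: "(\<Sum>p\<in>?K. (norm (e p))\<^sup>2) \<le> 1"
    using \<eta>1 unfolding e_def by (rule order_trans[rotated]) (intro sum_mono power_mono norm_proj_right S(1) fin norm_ge_zero)
  have cross: "norm (\<Sum>p\<in>?K. cinner_vec (\<eta> p - e p) (H *v \<xi> p)) \<le> C * norm H"
    if "(\<Sum>p\<in>?K. (norm (\<xi> p))\<^sup>2) \<le> 1" for \<xi>
    unfolding e_def by (rule cross_term_bound[OF S(1) fin _ C _ that]) (simp_all add: \<eta>_def tail)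
  \<comment> \<open>Self-adjointness lets the projected-away vector stand on the left in both
    remaining terms, as the cross-term estimate requires; the last one also contains the block in
    which both vectors are projected away.\<close>
  have split: "Re (cinner_vec (\<eta> p) (H *v \<eta> p)) = Re (cinner_vec (e p) (H *v e p))
      + Re (cinner_vec (\<eta> p - e p) (H *v e p)) + Re (cinner_vec (\<eta> p - e p) (H *v \<eta> p))" for p
  proof -
    have "cinner_vec (e p) (H *v (\<eta> p - e p)) = cnj (cinner_vec (\<eta> p - e p) (H *v e p))"
      by (subst cinner_vec_commute) (simp only: cinner_vec_hermitian[OF H])
    from arg_cong[OF this, of Re] have "Re (cinner_vec (e p) (H *v \<eta> p)) = Re (cinner_vec (e p) (H *v e p)) + Re (cinner_vec (\<eta> p - e p) (H *v e p))"
      by (simp add: matrix_vector_mult_diff_distrib cinner_vec_diff_right)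
    then show ?thesis by (simp add: cinner_vec_diff_left)
  qed
  have "(\<Sum>i\<in>UNIV. Re (hform k H (\<psi> i) (\<psi> i))) = (\<Sum>p\<in>?K. Re (cinner_vec (\<eta> p) (H *v \<eta> p)))"
    unfolding hform_def \<eta>_def sum.cartesian_product'[of _ UNIV] by simp
  also have "\<dots> = (\<Sum>p\<in>?K. Re (cinner_vec (e p) (H *v e p)))
      + Re (\<Sum>p\<in>?K. cinner_vec (\<eta> p - e p) (H *v e p)) + Re (\<Sum>p\<in>?K. cinner_vec (\<eta> p - e p) (H *v \<eta> p))"
    unfolding split sum.distrib Re_sum ..
  also have "\<dots> \<le> (s + sqrt (2 * N - 1) * norm H / N) + C * norm H + C * norm H"
  proof (intro add_mono)
    have "(\<Sum>p\<in>?K. Re (cinner_vec (e p) (H *v e p)))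
        = (\<Sum>i\<in>UNIV. \<Sum>r\<in>rest k \<times> rest k. Re (cinner_vec (proj_right S (slice k (\<psi> i) r)) (H *v proj_right S (slice k (\<psi> i) r))))"
      unfolding e_def \<eta>_def sum.cartesian_product'[of _ UNIV] by simp
    also have "\<dots> \<le> (\<Sum>i\<in>UNIV. (s + sqrt (real (card S)) * norm H / N) * (norm (\<psi> i))\<^sup>2)"
      unfolding N_def by (intro sum_mono hform_compressed_le[OF H S(1) s sep \<psi>])
    also have "\<dots> = s + sqrt (real (card S)) * norm H / N"
      unfolding sum_distrib_left[symmetric] one by simp
    also have "\<dots> \<le> s + sqrt (2 * N - 1) * norm H / N"
      using S(2) N by (intro add_left_mono divide_right_mono mult_right_mono) auto
    finally show "(\<Sum>p\<in>?K. Re (cinner_vec (e p) (H *v e p))) \<le> s + sqrt (2 * N - 1) * norm H / N" .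
    show "Re (\<Sum>p\<in>?K. cinner_vec (\<eta> p - e p) (H *v e p)) \<le> C * norm H"
      using cross[OF e1] complex_Re_le_cmod order_trans by blast
    show "Re (\<Sum>p\<in>?K. cinner_vec (\<eta> p - e p) (H *v \<eta> p)) \<le> C * norm H"
      using cross[OF \<eta>1] complex_Re_le_cmod order_trans by blast
  qed
  also have "\<dots> = s + (sqrt (2 * N - 1) / N + 2 * C) * norm H"
    by (simp add: algebra_simps)
  also have "\<dots> \<le> s + (8 * sqrt (2 * N - 1) / N) * norm H"
  proof (intro add_left_mono mult_right_mono)
    \<comment> \<open>8 = 1 + 2 * (7 / 2): one unit for the compressed part and 7/2 for each of the
      two others. The estimate is generous.\<close>
    have "C \<le> sqrt (2 * N - 1) * (7 / 2) / N"
    proof (rule power2_le_imp_le)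
      have "3 * N \<le> 2 * ((2 * N - 1) * (49 / 4))" using N by simp
      then have "3 / (2 * N) \<le> (2 * N - 1) * (49 / 4) / N\<^sup>2"
        using N by (simp add: field_simps power2_eq_square)
      then show "C\<^sup>2 \<le> (sqrt (2 * N - 1) * (7 / 2) / N)\<^sup>2"
        using N by (simp add: C_def power_mult_distrib power_divide)
    qed (use N in simp)
    then show "sqrt (2 * N - 1) / N + 2 * C \<le> 8 * sqrt (2 * N - 1) / N"
      using N by (simp add: field_simps)
  qed simp
  finally show ?thesis by (simp add: N_def)
qed

section \<open>From operator bounds to the distance\<close>

text \<open>The diagonal entries of \<open>H\<close> are its forms at product basis vectors, and
  they average to zero.\<close>

lemma trace_zero_sep_nonneg:
  fixes H :: "complex^('a::finite \<times> 'b::finite)^('a \<times> 'b)"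
  assumes "trace H = 0"
    and sep: "\<And>u v. norm u = 1 \<Longrightarrow> norm v = 1 \<Longrightarrow> Re (cinner_vec (tensor_vec u v) (H *v tensor_vec u v)) \<le> s"
  shows "0 \<le> s"
proof -
  have "tensor_vec (axis a 1) (axis b 1) = (axis (a, b) 1 :: complex^('a \<times> 'b))" for a b
    by (auto simp: tensor_vec_def axis_def vec_eq_iff)
  then have "Re (H $ x $ x) \<le> s" for x
    using sep[of "axis (fst x) 1" "axis (snd x) 1"] by (simp add: cinner_vec_axis mult_axis_nth)
  then have "(\<Sum>x\<in>UNIV. Re (H $ x $ x)) \<le> (\<Sum>x\<in>(UNIV :: ('a \<times> 'b) set). s)" by (intro sum_mono)
  moreover have "(\<Sum>x\<in>UNIV. Re (H $ x $ x)) = Re (trace H)" by (simp add: trace_def)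
  ultimately have "0 \<le> real CARD('a \<times> 'b) * s"
    using assms(1) by (simp del: card_prod)
  moreover have "0 < real CARD('a \<times> 'b)"
    using zero_less_card_finite[where 'a = "'a \<times> 'b"] by (simp only: of_nat_0_less_iff)
  ultimately show ?thesis by (simp only: zero_le_mult_iff) linarith
qed

lemma BEXT_close_to_SEP:
  fixes \<rho> :: "complex^('a::finite \<times> 'b::finite)^('a \<times> 'b)" and k :: "'n::finite"
  assumes "\<rho> \<in> BEXT k"
  obtains \<sigma> where "\<sigma> \<in> SEP" "norm (\<rho> - \<sigma>) \<le> min (sqrt (real (min CARD('a) CARD('b)) - 1) / real CARD('n))
               (8 * sqrt (2 * real CARD('n) - 1) / real CARD('n))"
proof -
  obtain \<psi> :: "('n \<Rightarrow> 'a) \<times> ('n \<Rightarrow> 'b) \<Rightarrow> complex^(('n \<Rightarrow> 'a) \<times> ('n \<Rightarrow> 'b))"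
    where \<psi>: "\<And>i. \<psi> i \<in> bisym" and one: "(\<Sum>i\<in>UNIV. (norm (\<psi> i))\<^sup>2) = 1"
      and \<rho>: "\<rho> = (\<Sum>i\<in>UNIV. \<Sum>r\<in>rest k \<times> rest k. pure_state (slice k (\<psi> i) r))"
    using BEXT_decomposition[OF assms] by blast
  have "trace \<rho> = of_real (\<Sum>i\<in>UNIV. \<Sum>r\<in>rest k \<times> rest k. (norm (slice k (\<psi> i) r))\<^sup>2)"
    unfolding \<rho> trace_sum trace_pure_state of_real_sum ..
  then have \<rho>_trace: "trace \<rho> = 1" unfolding norm_slices_sq[symmetric] one by simp
  have "adjoint_op \<rho> = (\<Sum>i\<in>UNIV. \<Sum>r\<in>rest k \<times> rest k. adjoint_op (pure_state (slice k (\<psi> i) r)))"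
    unfolding \<rho> by (simp only: adjoint_op_def vec_eq_iff) simp
  then have \<rho>_adj: "adjoint_op \<rho> = \<rho>" unfolding \<rho> by simp
  have closed: "closed (SEP :: (complex^('a \<times> 'b)^('a \<times> 'b)) set)"
    using compact_SEP by (rule compact_imp_closed)
  have ne: "(SEP :: (complex^('a \<times> 'b)^('a \<times> 'b)) set) \<noteq> {}"
    using pure_tensor_in_SEP[of "axis undefined 1" "axis undefined 1"] by auto
  define \<sigma> where "\<sigma> = closest_point SEP \<rho>"
  have \<sigma>: "\<sigma> \<in> SEP" unfolding \<sigma>_def by (rule closest_point_in_set[OF closed ne])
  define H where "H = \<rho> - \<sigma>"
  define s where "s = H \<bullet> \<sigma>"
  have H: "adjoint_op H = H"
    using \<rho>_adj SEP_hermitian_trace(1)[OF \<sigma>] by (simp add: H_def adjoint_op_def vec_eq_iff)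
  have "trace H = 0"
    using \<rho>_trace SEP_hermitian_trace(2)[OF \<sigma>] by (simp add: H_def trace_def sum_subtractf)
  \<comment> \<open>The variational inequality of the closest point, tested at a pure product
    state.\<close>
  have sep: "Re (cinner_vec (tensor_vec u v) (H *v tensor_vec u v)) \<le> s" if "norm u = 1" "norm v = 1" for u v
  proof -
    have "H \<bullet> (pure_state (tensor_vec u v) - \<sigma>) \<le> 0"
      unfolding H_def \<sigma>_def
      by (rule closest_point_dot[OF convex_SEP closed pure_tensor_in_SEP[OF that]])
    then show ?thesis by (simp add: inner_diff_right s_def inner_pure_state[OF H])
  qed
  have s: "0 \<le> s" by (rule trace_zero_sep_nonneg[OF \<open>trace H = 0\<close> sep])
  have H\<rho>: "H \<bullet> \<rho> = (\<Sum>i\<in>UNIV. Re (hform k H (\<psi> i) (\<psi> i)))"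
    unfolding \<rho> inner_sum_right inner_pure_state[OF H] hform_def Re_sum ..
  have "norm H * norm H = H \<bullet> H"
    by (simp flip: power2_norm_eq_inner power2_eq_square)
  also have "\<dots> = H \<bullet> \<rho> - s"
    unfolding s_def inner_diff_right[symmetric] H_def[symmetric] ..
  finally have "norm H * norm H = H \<bullet> \<rho> - s" .
  moreover have "H \<bullet> \<rho> \<le> s + sqrt (real (min CARD('a) CARD('b)) - 1) / real CARD('n) * norm H"
  proof -
    have "H \<bullet> \<rho> \<le> (\<Sum>i\<in>UNIV. (s + sqrt (real (min CARD('a) CARD('b)) - 1) * norm H / real CARD('n)) * (norm (\<psi> i))\<^sup>2)"
      unfolding H\<rho> by (intro sum_mono hform_le_sqrt_dim[OF H sep \<psi>])
    then show ?thesis unfolding sum_distrib_left[symmetric] one by simp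
  qed
  moreover have "H \<bullet> \<rho> \<le> s + 8 * sqrt (2 * real CARD('n) - 1) / real CARD('n) * norm H"
    unfolding H\<rho> by (rule hform_sum_le_sqrt[OF H s sep \<psi> one])
  ultimately have *: "norm H * norm H \<le> sqrt (real (min CARD('a) CARD('b)) - 1) / real CARD('n) * norm H"
    "norm H * norm H \<le> 8 * sqrt (2 * real CARD('n) - 1) / real CARD('n) * norm H"
    by linarith+
  have "0 \<le> real (min CARD('a) CARD('b)) - 1"
    using zero_less_card_finite[where 'a = 'a] zero_less_card_finite[where 'a = 'b] by (simp add: min_def Suc_leI)
  moreover have "0 \<le> 2 * real CARD('n) - 1"
    using zero_less_card_finite[where 'a = 'n] by linarith
  ultimately have "norm H \<le> min (sqrt (real (min CARD('a) CARD('b)) - 1) / real CARD('n))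
               (8 * sqrt (2 * real CARD('n) - 1) / real CARD('n))"
  proof (cases "H = 0")
    case False
    then have "0 < norm H" by simp
    with *[THEN mult_right_le_imp_le] show ?thesis by simp
  qed simp
  then show ?thesis using \<sigma> by (intro that[of \<sigma>]) (simp_all add: H_def)
qed

theorem corollary6p8:
  fixes k :: "'n::finite"
  shows "(SUP \<rho> \<in> (BEXT k :: (complex^('a::finite \<times> 'b::finite)^('a \<times> 'b)) set).
            INF \<sigma> \<in> SEP. hs_norm (\<rho> - \<sigma>))
         \<le> min (sqrt (real (min CARD('a) CARD('b)) - 1) / real CARD('n))
               (8 * sqrt (2 * real CARD('n) - 1) / real CARD('n))"
proof (rule cSUP_least[OF BEXT_nonempty])
  fix \<rho> :: "complex^('a \<times> 'b)^('a \<times> 'b)"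
  assume "\<rho> \<in> BEXT k"
  then obtain \<sigma> where \<sigma>: "\<sigma> \<in> SEP" "norm (\<rho> - \<sigma>) \<le> min (sqrt (real (min CARD('a) CARD('b)) - 1) / real CARD('n))
               (8 * sqrt (2 * real CARD('n) - 1) / real CARD('n))"
    by (rule BEXT_close_to_SEP)
  \<comment> \<open>An infimum of reals lies below the members of the set only if a lower bound
    exists; norms supply 0.\<close>
  have "bdd_below ((\<lambda>\<sigma>. hs_norm (\<rho> - \<sigma>)) ` SEP)"
    by (intro bdd_belowI2[of _ 0]) (simp add: hs_norm_eq_norm)
  then have "(INF \<sigma>\<in>SEP. hs_norm (\<rho> - \<sigma>)) \<le> hs_norm (\<rho> - \<sigma>)"
    using \<sigma>(1) by (rule cINF_lower)
  with \<sigma>(2) show "(INF \<sigma>\<in>SEP. hs_norm (\<rho> - \<sigma>)) \<le> min (sqrt (real (min CARD('a) CARD('b)) - 1) / real CARD('n))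
               (8 * sqrt (2 * real CARD('n) - 1) / real CARD('n))"
    unfolding hs_norm_eq_norm by (rule order_trans[rotated])
qed

end
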